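(* Let $\phi:\mathbb R^2\to\mathbb R$ be a $C^2$ function and let $S,E\subset\mathbb H^1$ be respectively the $X_1$-graph and the $X_1$-subgraph induced by $\phi$, i.e. $$S=\{(0,\eta,\tau)\cdot(\phi(\eta,\tau),0,0):\ (\eta,\tau)\in\mathbb R^2\},\qquad E=\{(x,y,t)\in\mathbb H^1:\ x<\phi(y,t-2xy)\}.$$ Suppose that $E$ is a minimizer for the $\mathbb H$-perimeter measure in $\mathbb H^1\equiv\mathbb R^3$. Then $S$ is a vertical plane, i.e. there are constants $w,c\in\mathbb R$ such that $\phi(\eta,\tau)=w\eta+c$ for all $(\eta,\tau)\in\mathbb R^2$.
   Context: $\mathbb H^1=(\mathbb R^3,\cdot)$ is the first Heisenberg group with group law $(x,y,t)\cdot(x',y',t')=(x+x',y+y',t+t'+2(yx'-xy'))$. Its horizontal left-invariant vector fields are $X_1=\partial_x+2y\,\partial_t$ and $X_2=\partial_y-2x\,\partial_t$; their $L^2(\mathbb R^3)$-adjoints are $X_j^*=-X_j$. $\mathbb H$-perimeter: for $E\subset\mathbb R^3$ measurable and $U\subset\mathbb R^3$ open, $\|\partial E\|_{\mathbb H}(U):=\sup\{\int_E(X_1^*\varphi_1+X_2^*\varphi_2)\,d\mathcal L^3:\ \varphi=(\varphi_1,\varphi_2)\in C^1_c(U;\mathbb R^2),\ |\varphi|\le1\}$. Minimizer: $E$ is a minimizer for the $\mathbb H$-perimeter in $\mathbb R^3$ if it has locally finite $\mathbb H$-perimeter (finite in every bounded open set) and $\|\partial E\|_{\mathbb H}(\Omega')\le\|\partial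 F\|_{\mathbb H}(\Omega')$ for every bounded open set $\Omega'\subset\mathbb R^3$ and every measurable $F\subset\mathbb R^3$ such that the closure of $E\Delta F$ is a compact subset of $\Omega'$. *)

theory Defs
  imports "HOL-Analysis.Analysis"
begin

type_synonym heis = "real \<times> real \<times> real"

fun heis_mult :: "heis \<Rightarrow> heis \<Rightarrow> heis" (infixl "\<cdot>\<^sub>H" 70) where
  "(x, y, t) \<cdot>\<^sub>H (x', y', t') = (x + x', y + y', t + t' + 2 * (y * x' - x * y'))"

definition X1 :: "(heis \<Rightarrow> real) \<Rightarrow> heis \<Rightarrow> real" where
  "X1 f = (\<lambda>(x, y, t). deriv (\<lambda>s. f (s, y, t)) x + 2 * y * deriv (\<lambda>s. f (x, y, s)) t)"

definition X2 :: "(heis \<Rightarrow> real) \<Rightarrow> heis \<Rightarrow> real" where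
  "X2 f = (\<lambda>(x, y, t). deriv (\<lambda>s. f (x, s, t)) y - 2 * x * deriv (\<lambda>s. f (x, y, s)) t)"

text \<open>The formal adjoints in \<open>L\<^sup>2\<close> of Lebesgue measure; both fields are divergence free.\<close>

definition X1_adj :: "(heis \<Rightarrow> real) \<Rightarrow> heis \<Rightarrow> real" where
  "X1_adj f p = - X1 f p"

definition X2_adj :: "(heis \<Rightarrow> real) \<Rightarrow> heis \<Rightarrow> real" where
  "X2_adj f p = - X2 f p"

text \<open>The Frechet derivative is a map into the normed space of bounded linear maps, so that
  continuity and differentiability of the derivative refer to the operator norm.\<close>

definition C1_map :: "('a::real_normed_vector \<Rightarrow> 'b::real_normed_vector) \<Rightarrow> bool" where
  "C1_map f \<longleftrightarrow> (\<exists>f' :: 'a \<Rightarrow> 'a \<Rightarrow>\<^sub>L 'b.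
     (\<forall>x. (f has_derivative blinfun_apply (f' x)) (at x)) \<and> continuous_on UNIV f')"

definition C2_map :: "('a::real_normed_vector \<Rightarrow> 'b::real_normed_vector) \<Rightarrow> bool" where
  "C2_map f \<longleftrightarrow> (\<exists>f' :: 'a \<Rightarrow> 'a \<Rightarrow>\<^sub>L 'b.
     (\<forall>x. (f has_derivative blinfun_apply (f' x)) (at x)) \<and> C1_map f')"

text \<open>A compactly supported \<open>C\<^sup>1\<close> field on \<open>U\<close> is identified with its extension by zero.
  The norm on pairs of reals is the Euclidean one.\<close>

definition horizontal_test_fields :: "heis set \<Rightarrow> (heis \<Rightarrow> real \<times> real) set" where
  "horizontal_test_fields U =
     {\<phi>. C1_map \<phi> \<and> compact (closure {p. \<phi> p \<noteq> 0}) \<and> closure {p. \<phi> p \<noteq> 0} \<subseteq> U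
        \<and> (\<forall>p. norm (\<phi> p) \<le> 1)}"

definition H_perimeter :: "heis set \<Rightarrow> heis set \<Rightarrow> ereal" where
  "H_perimeter E U =
     (SUP \<phi>\<in>horizontal_test_fields U.
        ereal (LINT p:E|lebesgue. X1_adj (\<lambda>q. fst (\<phi> q)) p + X2_adj (\<lambda>q. snd (\<phi> q)) p))"

definition locally_finite_H_perimeter :: "heis set \<Rightarrow> bool" where
  "locally_finite_H_perimeter E \<longleftrightarrow> E \<in> sets lebesgue \<and>
     (\<forall>U. open U \<and> bounded U \<longrightarrow> H_perimeter E U < \<infinity>)"

definition H_perimeter_minimizer :: "heis set \<Rightarrow> bool" where
  "H_perimeter_minimizer E \<longleftrightarrow> locally_finite_H_perimeter E \<and>
     (\<forall>\<Omega> F. open \<Omega> \<and> bounded \<Omega> \<and> F \<in> sets lebesgue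
        \<and> compact (closure (sym_diff E F)) \<and> closure (sym_diff E F) \<subseteq> \<Omega>
        \<longrightarrow> H_perimeter E \<Omega> \<le> H_perimeter F \<Omega>)"

definition X1_graph :: "(real \<times> real \<Rightarrow> real) \<Rightarrow> heis set" where
  "X1_graph \<phi> = {(0, \<eta>, \<tau>) \<cdot>\<^sub>H (\<phi> (\<eta>, \<tau>), 0, 0) | \<eta> \<tau>. True}"

definition X1_subgraph :: "(real \<times> real \<Rightarrow> real) \<Rightarrow> heis set" where
  "X1_subgraph \<phi> = {(x, y, t). x < \<phi> (y, t - 2 * x * y)}"

text \<open>The vertical planes are the affine planes parallel to the \<open>t\<close>-axis.\<close>

definition vertical_plane :: "heis set \<Rightarrow> bool" where
  "vertical_plane P \<longleftrightarrow>
     (\<exists>a b c :: real. (a, b) \<noteq> (0, 0) \<and> P = {(x, y, t). a * x + b * y = c})"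

end

theory Submission
  imports Defs
begin

text \<open>In the coordinates \<open>(s, \<eta>, \<tau>) \<mapsto> (0, \<eta>, \<tau>) \<cdot> (s, 0, 0)\<close> the perimeter of the subgraph of \<open>f\<close> in a
  cylinder over \<open>D\<close> is the integral over \<open>D\<close> of \<open>sqrt (1 + w\<^sup>2)\<close>, where \<open>w = f\<^sub>\<eta> - 4 f f\<^sub>\<tau>\<close>. The first
  variation gives \<open>w\<^sub>\<eta> = 4 f w\<^sub>\<tau>\<close>, so \<open>w\<close> is constant and \<open>f\<close> is affine along the curves
  \<open>\<tau>' = - 4 f\<close>, which are therefore parabolas defined for all times. With
  \<open>a' = f\<^sub>\<tau> (0, t)\<close> and \<open>b' = w\<^sub>\<tau> (0, t)\<close> the flow of these curves has the Jacobian
  \<open>J x = 1 - 4 a' x - 2 b' x\<^sup>2\<close>, which must be positive for all \<open>x\<close>. If \<open>b' \<noteq> 0\<close>, then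
  \<open>\<delta> = - b' - 2 a'\<^sup>2 > 0\<close>, and the second variation, concentrated near a single characteristic,
  becomes \<open>\<integral> v'\<^sup>2 \<ge> 6 \<delta> \<integral> v\<^sup>2 / J\<^sup>2\<close> for all compactly supported \<open>v\<close>, which fails for a wide
  cut-off \<open>v\<close>. Hence \<open>b' = 0\<close>, positivity of \<open>J\<close> forces \<open>a' = 0\<close>, and all characteristics are
  translates of each other.\<close>

section \<open>Continuously differentiable maps\<close>

text \<open>The two perimeter bounds are asymmetric. From above, Cauchy-Schwarz suffices and the
  graph function is merely C^1; from below, the unit normal itself must serve as a C^1 test field,
  and this, together with differentiating \<open>w\<close>, is where second derivatives of the given
  function enter. Minimality combines the lower bound for \<open>f\<close> with the upper bound for
  \<open>f + e * g\<close>, so C^1 variations \<open>g\<close> are admissible and simple C^1 bumps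
  are enough. Since \<open>w\<close> is quadratic in \<open>f\<close>, such a variation changes it
  by exactly \<open>e * L + e^2 * N\<close>; the part \<open>N = - 4 * g * g2\<close> is what brings
  \<open>w2\<close> into the second variation. Shrinking the test functions to one characteristic
  makes every coefficient explicit: there \<open>w\<close> is constant, so the weight
  \<open>area (w q) ^ 3\<close> factors out, while \<open>f2\<close> and \<open>w2\<close> become
  rational functions of \<open>x\<close> with denominator \<open>J\<close>. The contradiction is a
  feature of dimension one: a cut-off of width \<open>N\<close> has energy of order
  \<open>1 / N\<close>, so a fixed positive weight on the line cannot be controlled by the
  energy.\<close>

lemma C1_mapI:
  fixes f :: "'a::euclidean_space \<Rightarrow> 'b::real_normed_vector"
  assumes "\<And>x. (f has_derivative f' x) (at x)" and "\<And>v. continuous_on UNIV (\<lambda>x. f' x v)"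
  shows "C1_map f"
  unfolding C1_map_def
proof (intro exI conjI allI)
  have bl: "bounded_linear (f' x)" for x
    using assms(1) by (rule has_derivative_bounded_linear)
  show "(f has_derivative blinfun_apply (Blinfun (f' x))) (at x)" for x
    using assms(1) bl by (simp add: bounded_linear_Blinfun_apply)
  show "continuous_on UNIV (\<lambda>x. Blinfun (f' x))"
    by (rule continuous_on_blinfun_componentwise) (simp add: bounded_linear_Blinfun_apply[OF bl] assms(2))
qed

text \<open>Evaluation at a fixed vector is continuous, so norm continuity of the derivative passes
  to each \<open>f' x v\<close>; the converse, \<open>C1_mapI\<close>, rests on the source being
  finite-dimensional. Together they keep \<open>blinfun\<close> out of most later
  calculations.\<close>

lemma C1_mapD:
  assumes "C1_map f"
  shows "\<exists>f'. (\<forall>x. (f has_derivative f' x) (at x)) \<and> (\<forall>v. continuous_on UNIV (\<lambda>x. f' x v))"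
proof -
  from assms obtain D where D: "\<And>x. (f has_derivative blinfun_apply (D x)) (at x)" "continuous_on UNIV D"
    unfolding C1_map_def by blast
  have "continuous_on UNIV (\<lambda>x. blinfun_apply (D x) v)" for v
    by (intro continuous_intros D)
  with D(1) show ?thesis by (intro exI[of _ "\<lambda>x. blinfun_apply (D x)"]) auto
qed

lemma C1_map_continuous: "C1_map f \<Longrightarrow> continuous_on S f"
  by (meson C1_mapD continuous_at_imp_continuous_on has_derivative_continuous)

lemma C1_map_compose:
  assumes "C1_map g" "C1_map f"
  shows "C1_map (\<lambda>x. g (f x))"
proof -
  from assms obtain f' g' where f': "\<And>x. (f has_derivative blinfun_apply (f' x)) (at x)" "continuous_on UNIV f'"
    and g': "\<And>x. (g has_derivative blinfun_apply (g' x)) (at x)" "continuous_on UNIV g'"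
    unfolding C1_map_def by blast
  have "((\<lambda>x. g (f x)) has_derivative blinfun_apply (g' (f x) o\<^sub>L f' x)) (at x)" for x
    using has_derivative_compose[OF f'(1) g'(1)] by (simp add: blinfun_compose.rep_eq comp_def)
  moreover have "continuous_on UNIV (\<lambda>x. g' (f x) o\<^sub>L f' x)"
    by (intro continuous_intros bounded_bilinear.continuous_on[OF bounded_bilinear_blinfun_compose]
        continuous_on_compose2[OF g'(2)] C1_map_continuous[OF assms(2)] f'(2)) auto
  ultimately show ?thesis unfolding C1_map_def by (intro exI[of _ "\<lambda>x. g' (f x) o\<^sub>L f' x"]) auto
qed

lemma C1_map_bounded_linear: "bounded_linear f \<Longrightarrow> C1_map f"
  unfolding C1_map_def
  by (intro exI[of _ "\<lambda>_. Blinfun f"]) (auto simp: bounded_linear_Blinfun_apply bounded_linear_imp_has_derivative)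

lemma C1_map_const: "C1_map (\<lambda>x. c)"
  unfolding C1_map_def by (intro exI[of _ "\<lambda>_. 0"]) (auto simp: zero_blinfun.rep_eq)

lemma C1_map_ident: "C1_map (\<lambda>x. x)"
  by (intro C1_map_bounded_linear bounded_linear_ident)

lemma C1_map_fst: "C1_map f \<Longrightarrow> C1_map (\<lambda>x. fst (f x))"
  by (rule C1_map_compose[OF C1_map_bounded_linear[OF bounded_linear_fst]])

lemma C1_map_snd: "C1_map f \<Longrightarrow> C1_map (\<lambda>x. snd (f x))"
  by (rule C1_map_compose[OF C1_map_bounded_linear[OF bounded_linear_snd]])

lemma C1_map_Pair:
  fixes f :: "'a::euclidean_space \<Rightarrow> 'b::real_normed_vector" and g :: "'a \<Rightarrow> 'c::real_normed_vector"
  assumes "C1_map f" "C1_map g"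
  shows "C1_map (\<lambda>x. (f x, g x))"
proof -
  obtain f' where f': "\<And>x. (f has_derivative f' x) (at x)" "\<And>v. continuous_on UNIV (\<lambda>x. f' x v)"
    using C1_mapD[OF assms(1)] by blast
  obtain g' where g': "\<And>x. (g has_derivative g' x) (at x)" "\<And>v. continuous_on UNIV (\<lambda>x. g' x v)"
    using C1_mapD[OF assms(2)] by blast
  show ?thesis
    by (rule C1_mapI[of _ "\<lambda>x v. (f' x v, g' x v)"])
       (auto intro!: has_derivative_Pair continuous_intros f' g')
qed

lemma C1_map_add:
  fixes f g :: "'a::euclidean_space \<Rightarrow> 'b::real_normed_vector"
  assumes "C1_map f" "C1_map g"
  shows "C1_map (\<lambda>x. f x + g x)"
proof -
  have "C1_map (\<lambda>p::'b\<times>'b. fst p + snd p)"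
    by (intro C1_map_bounded_linear bounded_linear_intros)
  from C1_map_compose[OF this C1_map_Pair[OF assms]] show ?thesis by simp
qed

lemma C1_map_mult:
  fixes f g :: "'a::euclidean_space \<Rightarrow> real"
  assumes "C1_map f" "C1_map g"
  shows "C1_map (\<lambda>x. f x * g x)"
proof -
  have "C1_map (\<lambda>p::real\<times>real. fst p * snd p)"
    by (rule C1_mapI[of _ "\<lambda>p h. fst p * snd h + fst h * snd p"])
       (auto intro!: derivative_eq_intros continuous_intros)
  from C1_map_compose[OF this C1_map_Pair[OF assms]] show ?thesis by simp
qed

lemma C1_map_minus:
  fixes f :: "'a::euclidean_space \<Rightarrow> real"
  assumes "C1_map f" shows "C1_map (\<lambda>x. - f x)"
  using C1_map_mult[OF C1_map_const[of "-1"] assms] by simp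

lemma C1_map_diff:
  fixes f g :: "'a::euclidean_space \<Rightarrow> real"
  assumes "C1_map f" "C1_map g" shows "C1_map (\<lambda>x. f x - g x)"
  using C1_map_add[OF assms(1) C1_map_minus[OF assms(2)]] by simp

lemma C1_map_power:
  fixes f :: "'a::euclidean_space \<Rightarrow> real"
  assumes "C1_map f" shows "C1_map (\<lambda>x. f x ^ n)"
  by (induction n) (auto intro!: C1_map_const C1_map_mult assms)

lemma C1_map_real:
  fixes g :: "real \<Rightarrow> real"
  assumes "\<And>x. (g has_real_derivative g' x) (at x)" "continuous_on UNIV g'"
  shows "C1_map g"
  by (rule C1_mapI[of _ "\<lambda>x h. g' x * h"])
     (use assms in \<open>auto intro!: continuous_intros simp: has_field_derivative_def\<close>)

lemmas C1_map_intros = C1_map_const C1_map_ident C1_map_fst C1_map_snd C1_map_Pair C1_map_add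
  C1_map_mult C1_map_minus C1_map_diff C1_map_power

section \<open>Gradients of functions of two real variables\<close>

text \<open>Total differentiability with gradient \<open>(F1, F2)\<close>, so that the chain rule
  along curves is available. Continuity of the gradient is stated separately, which lets C^1 and C^2
  data share one calculus.\<close>

definition has_partials :: "(real \<times> real \<Rightarrow> real) \<Rightarrow> (real \<times> real \<Rightarrow> real) \<Rightarrow> (real \<times> real \<Rightarrow> real) \<Rightarrow> bool" where
  "has_partials F F1 F2 \<longleftrightarrow> (\<forall>q. (F has_derivative (\<lambda>h. fst h * F1 q + snd h * F2 q)) (at q))"

lemma has_partials_continuous:
  assumes "has_partials F F1 F2"
  shows "continuous_on S F"
proof (intro continuous_at_imp_continuous_on ballI)
  fix q
  have "(F has_derivative (\<lambda>h. fst h * F1 q + snd h * F2 q)) (at q)"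
    using assms unfolding has_partials_def by (rule spec)
  then show "isCont F q" by (rule has_derivative_continuous)
qed

lemma derivative_pair_partials:
  fixes F :: "real \<times> real \<Rightarrow> 'b::real_normed_vector"
  assumes "(F has_derivative D) (at q)"
  shows "D h = fst h *\<^sub>R D (1, 0) + snd h *\<^sub>R D (0, 1)"
proof -
  interpret bounded_linear D using assms by (rule has_derivative_bounded_linear)
  have "D h = D (fst h *\<^sub>R (1, 0) + snd h *\<^sub>R (0, 1))"
    by (rule arg_cong[where f = D]) (cases h, simp)
  also have "\<dots> = fst h *\<^sub>R D (1, 0) + snd h *\<^sub>R D (0, 1)" by (simp only: add scaleR)
  finally show ?thesis .
qed

lemma C1_map_partials:
  assumes "C1_map (F :: real \<times> real \<Rightarrow> real)"
  obtains F1 F2 where "has_partials F F1 F2" "continuous_on UNIV F1" "continuous_on UNIV F2"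
proof -
  obtain F' where F': "\<And>x. (F has_derivative F' x) (at x)" "\<And>v. continuous_on UNIV (\<lambda>x. F' x v)"
    using C1_mapD[OF assms] by blast
  have "F' q h = fst h * F' q (1, 0) + snd h * F' q (0, 1)" for q h
    using derivative_pair_partials[OF F'(1), of q h] unfolding real_scaleR_def .
  then have "F' q = (\<lambda>h. fst h * F' q (1, 0) + snd h * F' q (0, 1))" for q by (rule ext)
  then have "has_partials F (\<lambda>q. F' q (1, 0)) (\<lambda>q. F' q (0, 1))"
    unfolding has_partials_def by (blast intro: has_derivative_eq_rhs[OF F'(1)])
  then show thesis using F'(2) F'(2) by (rule that)
qed

lemma has_partials_C1_map:
  assumes "has_partials F F1 F2" "continuous_on UNIV F1" "continuous_on UNIV F2"
  shows "C1_map F"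
  by (rule C1_mapI[of _ "\<lambda>q h. fst h * F1 q + snd h * F2 q"])
     (use assms in \<open>auto intro!: continuous_intros simp: has_partials_def\<close>)

lemma C2_map_partials:
  assumes "C2_map (F :: real \<times> real \<Rightarrow> real)"
  obtains F1 F2 where "has_partials F F1 F2" "C1_map F1" "C1_map F2"
proof -
  obtain D where D: "\<And>x. (F has_derivative blinfun_apply (D x)) (at x)" "C1_map D"
    using assms unfolding C2_map_def by blast
  have ap: "C1_map (\<lambda>q. blinfun_apply (D q) v)" for v
    using C1_map_compose[OF C1_map_bounded_linear[OF blinfun.bounded_linear_left] D(2)] . 
  have "blinfun_apply (D q) h = fst h * D q (1, 0) + snd h * D q (0, 1)" for q h
    using derivative_pair_partials[OF D(1), of q h] unfolding real_scaleR_def .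
  then have "blinfun_apply (D q) = (\<lambda>h. fst h * D q (1, 0) + snd h * D q (0, 1))" for q by (rule ext)
  then have "has_partials F (\<lambda>q. D q (1, 0)) (\<lambda>q. D q (0, 1))"
    unfolding has_partials_def by (blast intro: has_derivative_eq_rhs[OF D(1)])
  then show thesis using ap ap by (rule that)
qed

lemma has_partials_along:
  assumes "has_partials F F1 F2" "(x has_real_derivative x') (at s)" "(y has_real_derivative y') (at s)"
  shows "((\<lambda>s. F (x s, y s)) has_real_derivative x' * F1 (x s, y s) + y' * F2 (x s, y s)) (at s)"
proof -
  have "((\<lambda>s. (x s, y s)) has_derivative (\<lambda>h. (x' * h, y' * h))) (at s)"
    using assms(2,3) by (intro has_derivative_Pair) (auto simp: has_field_derivative_def)
  moreover have "(F has_derivative (\<lambda>h. fst h * F1 (x s, y s) + snd h * F2 (x s, y s))) (at (x s, y s))"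
    using assms(1) unfolding has_partials_def by blast
  ultimately have "((\<lambda>s. F (x s, y s)) has_derivative (\<lambda>h. (x' * h) * F1 (x s, y s) + (y' * h) * F2 (x s, y s))) (at s)"
    using has_derivative_compose[of "\<lambda>s. (x s, y s)" _ s UNIV F] by fastforce
  moreover have "(\<lambda>h. (x' * h) * F1 (x s, y s) + (y' * h) * F2 (x s, y s)) = (*) (x' * F1 (x s, y s) + y' * F2 (x s, y s))"
    by (auto simp: algebra_simps)
  ultimately show ?thesis unfolding has_field_derivative_def by simp
qed

lemma has_partials_fst:
  assumes "has_partials F F1 F2"
  shows "((\<lambda>s. F (s, t)) has_real_derivative F1 (s, t)) (at s)"
  using has_partials_along[OF assms DERIV_ident DERIV_const, of t] by simp

lemma has_partials_snd:
  assumes "has_partials F F1 F2"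
  shows "((\<lambda>t. F (s, t)) has_real_derivative F2 (s, t)) (at t)"
  using has_partials_along[OF assms DERIV_const DERIV_ident, of s] by simp

lemma has_partials_add:
  assumes "has_partials F F1 F2" "has_partials G G1 G2"
  shows "has_partials (\<lambda>q. F q + G q) (\<lambda>q. F1 q + G1 q) (\<lambda>q. F2 q + G2 q)"
  using assms unfolding has_partials_def
  by (auto intro!: derivative_eq_intros simp: algebra_simps)

lemma has_partials_mult:
  assumes "has_partials F F1 F2" "has_partials G G1 G2"
  shows "has_partials (\<lambda>q. F q * G q) (\<lambda>q. F1 q * G q + F q * G1 q) (\<lambda>q. F2 q * G q + F q * G2 q)"
  unfolding has_partials_def
proof
  fix q
  have "(F has_derivative (\<lambda>h. fst h * F1 q + snd h * F2 q)) (at q)"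
    "(G has_derivative (\<lambda>h. fst h * G1 q + snd h * G2 q)) (at q)"
    using assms unfolding has_partials_def by blast+
  from has_derivative_mult[OF this]
  show "((\<lambda>q. F q * G q) has_derivative (\<lambda>h. fst h * (F1 q * G q + F q * G1 q) + snd h * (F2 q * G q + F q * G2 q))) (at q)"
    by (simp add: algebra_simps)
qed

lemma has_partials_const: "has_partials (\<lambda>q. c) (\<lambda>q. 0) (\<lambda>q. 0)"
  unfolding has_partials_def by auto

lemma has_partials_cmult:
  assumes "has_partials F F1 F2"
  shows "has_partials (\<lambda>q. c * F q) (\<lambda>q. c * F1 q) (\<lambda>q. c * F2 q)"
  using has_partials_mult[OF has_partials_const assms, of c] by simp

lemma has_partials_compose:
  assumes "has_partials F F1 F2" "\<And>x. (g has_real_derivative g' x) (at x)"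
  shows "has_partials (\<lambda>q. g (F q)) (\<lambda>q. g' (F q) * F1 q) (\<lambda>q. g' (F q) * F2 q)"
  unfolding has_partials_def
proof
  fix q
  have "(F has_derivative (\<lambda>h. fst h * F1 q + snd h * F2 q)) (at q)" 
    using assms unfolding has_partials_def by blast+
  from has_derivative_compose[OF this assms(2)[of "F q", unfolded has_field_derivative_def]]
  show "((\<lambda>q. g (F q)) has_derivative (\<lambda>h. fst h * (g' (F q) * F1 q) + snd h * (g' (F q) * F2 q))) (at q)"
    by (simp add: algebra_simps)
qed

section \<open>Integrals of compactly supported derivatives\<close>

lemma integrable_continuous_compact_support:
  fixes f :: "'a::euclidean_space \<Rightarrow> real"
  assumes "continuous_on UNIV f" "compact K" "\<And>x. x \<notin> K \<Longrightarrow> f x = 0"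
  shows "integrable lborel f"
proof -
  have "integrable lborel (\<lambda>x. indicator K x *\<^sub>R f x)"
    by (rule borel_integrable_compact[OF assms(2)]) (use assms(1) continuous_on_subset in blast)
  moreover have "(\<lambda>x. indicator K x *\<^sub>R f x) = f"
    using assms(3) by (force simp: indicator_def fun_eq_iff)
  ultimately show ?thesis by simp
qed

lemma integral_deriv_compact_support:
  fixes k k' :: "real \<Rightarrow> real"
  assumes k: "\<And>x. (k has_real_derivative k' x) (at x)" and c: "continuous_on UNIV k'"
    and K: "bounded K" "\<And>x. x \<notin> K \<Longrightarrow> k x = 0" "\<And>x. x \<notin> K \<Longrightarrow> k' x = 0"
  shows "(\<integral>x. k' x \<partial>lborel) = 0" "(\<integral>x. indicator {..<0} x * k' x \<partial>lborel) = k 0"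
proof -
  obtain N where N: "N > 0" "\<And>x. x \<in> K \<Longrightarrow> \<bar>x\<bar> \<le> N"
    using K(1) unfolding bounded_pos by auto
  have c': "isCont k' x" for x using c by (simp add: continuous_on_eq_continuous_at)
  have out: "k x = 0" "k' x = 0" if "\<bar>x\<bar> > N" for x
    using K(2,3)[of x] N(2)[of x] that by linarith+
  \<comment> \<open>The end points lie strictly beyond the bound \<open>N\<close>, so
    \<open>k\<close> vanishes there and the interval contains the whole support.\<close>
  have "(\<integral>x. k' x * indicator {-(N+1)..N+1} x \<partial>lborel) = k (N+1) - k (-(N+1))"
    by (rule integral_FTC_Icc_real) (use N k c' in auto)
  moreover have "(\<lambda>x. k' x * indicator {-(N+1)..N+1} x) = k'"
    using out by (force simp: indicator_def fun_eq_iff)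
  ultimately show "(\<integral>x. k' x \<partial>lborel) = 0"
    using out[of "N+1"] out[of "-(N+1)"] N(1) by simp
  have "(\<integral>x. k' x * indicator {-(N+1)..0} x \<partial>lborel) = k 0 - k (-(N+1))"
    by (rule integral_FTC_Icc_real) (use N k c' in auto)
  moreover have "(\<integral>x. k' x * indicator {-(N+1)..0} x \<partial>lborel) = (\<integral>x. indicator {..<0} x * k' x \<partial>lborel)"
  proof (rule integral_cong_AE)
    have [measurable]: "k' \<in> borel_measurable borel" by (rule borel_measurable_continuous_onI[OF c])
    show "(\<lambda>x. k' x * indicator {-(N+1)..0} x) \<in> borel_measurable lborel"
      "(\<lambda>x. indicator {..<0} x * k' x) \<in> borel_measurable lborel" by measurable
    show "AE x in lborel. k' x * indicator {-(N+1)..0} x = indicator {..<0} x * k' x"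
      using AE_lborel_singleton[of 0] by eventually_elim (use out in \<open>force simp: indicator_def\<close>)
  qed
  ultimately show "(\<integral>x. indicator {..<0} x * k' x \<partial>lborel) = k 0"
    using out[of "-(N+1)"] N(1) by simp
qed

text \<open>The complement of \<open>K\<close> is open, so \<open>k\<close> vanishes along
  \<open>p\<close> on a whole neighbourhood of \<open>s\<close>. In the applications
  \<open>p\<close> is a coordinate line.\<close>

lemma deriv_zero_off_closed:
  fixes k :: "'a::topological_space \<Rightarrow> real"
  assumes "closed K" "\<And>x. x \<notin> K \<Longrightarrow> k x = 0" "p s \<notin> K" "isCont p (s::real)"
    and "((\<lambda>s. k (p s)) has_real_derivative d) (at s)"
  shows "d = 0"
proof -
  have "eventually (\<lambda>y. p y \<in> -K) (nhds s)"
    using assms(1,3,4) unfolding continuous_at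
    by (metis ComplI eventually_nhds_conv_at open_Compl topological_tendstoD)
  then have "eventually (\<lambda>y. k (p y) = 0) (nhds s)"
    by eventually_elim (use assms(2) in auto)
  then have "((\<lambda>s. 0) has_real_derivative d) (at s)"
    using assms(5) by (subst (asm) DERIV_cong_ev[OF refl _ refl]) auto
  then show ?thesis using DERIV_const DERIV_unique by blast
qed

lemma lborel_fst_integral:
  fixes f :: "'a::euclidean_space \<times> 'b::euclidean_space \<Rightarrow> real"
  assumes "integrable lborel f"
  shows "integral\<^sup>L lborel f = (\<integral>x. (\<integral>y. f (x, y) \<partial>lborel) \<partial>lborel)"
  using lborel_pair.integral_fst'[of f] assms by (simp add: lborel_prod)

lemma lborel_snd_integral:
  fixes f :: "'a::euclidean_space \<times> 'b::euclidean_space \<Rightarrow> real"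
  assumes "integrable lborel f"
  shows "integral\<^sup>L lborel f = (\<integral>y. (\<integral>x. f (x, y) \<partial>lborel) \<partial>lborel)"
  using lborel_pair.integral_snd[of "\<lambda>x y. f (x, y)"] assms by (simp add: lborel_prod)

lemma bounded_slice:
  assumes "bounded (K :: ('a::real_normed_vector \<times> 'b::real_normed_vector) set)"
  shows "bounded {x. (x, y) \<in> K}" "bounded {y. (x, y) \<in> K}"
proof -
  have "{x. (x, y) \<in> K} \<subseteq> fst ` K" "{y. (x, y) \<in> K} \<subseteq> snd ` K" by force+
  then show "bounded {x. (x, y) \<in> K}" "bounded {y. (x, y) \<in> K}"
    using bounded_fst[OF assms] bounded_snd[OF assms] bounded_subset by auto
qed

text \<open>By Fubini the variable of differentiation is integrated first; the fundamental theorem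
  then leaves nothing over the full line and the boundary value at 0 over the half line.\<close>

lemma integral_deriv_fst:
  fixes k k' :: "real \<times> 'b::euclidean_space \<Rightarrow> real"
  assumes k: "\<And>x y. ((\<lambda>x. k (x, y)) has_real_derivative k' (x, y)) (at x)" and c: "continuous_on UNIV k'"
    and K: "compact K" "\<And>p. p \<notin> K \<Longrightarrow> k p = 0"
  shows "integral\<^sup>L lborel k' = 0"
    "(\<integral>p. indicator {..<0} (fst p) * k' p \<partial>lborel) = (\<integral>y. k (0, y) \<partial>lborel)"
proof -
  have z: "k' p = 0" if "p \<notin> K" for p
  proof (cases p)
    case (Pair x y)
    show ?thesis
      using deriv_zero_off_closed[of K k "\<lambda>x. (x, y)" x, OF compact_imp_closed[OF K(1)] K(2)] k[of y x] that Pair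
      by (auto intro!: continuous_intros)
  qed
  have int: "integrable lborel k'" by (rule integrable_continuous_compact_support[OF c K(1) z])
  have slice: "continuous_on UNIV (\<lambda>x. k' (x, y))" for y
    by (rule continuous_on_compose2[OF c]) (auto intro!: continuous_intros)
  have 1: "(\<integral>x. k' (x, y) \<partial>lborel) = 0" for y
    by (rule integral_deriv_compact_support(1)[OF k slice bounded_slice(1)[OF compact_imp_bounded[OF K(1)]]])
      (use z K(2) in auto)
  have 2: "(\<integral>x. indicator {..<0} x * k' (x, y) \<partial>lborel) = k (0, y)" for y
    by (rule integral_deriv_compact_support(2)[OF k slice bounded_slice(1)[OF compact_imp_bounded[OF K(1)]]])
      (use z K(2) in auto)
  show "integral\<^sup>L lborel k' = 0"
    by (subst lborel_snd_integral[OF int]) (simp add: 1)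
  have [measurable]: "k' \<in> borel_measurable borel" by (rule borel_measurable_continuous_onI[OF c])
  have int2: "integrable lborel (\<lambda>p. indicator {..<0} (fst p) * k' p)"
  proof (rule Bochner_Integration.integrable_bound[OF int])
    have "(\<lambda>p::real \<times> 'b. indicator {..<0} (fst p) :: real) \<in> borel_measurable borel"
      unfolding borel_prod[symmetric] by measurable
    then show "(\<lambda>p. indicator {..<0} (fst p) * k' p) \<in> borel_measurable lborel" by simp
  qed (auto simp: indicator_def)
  show "(\<integral>p. indicator {..<0} (fst p) * k' p \<partial>lborel) = (\<integral>y. k (0, y) \<partial>lborel)"
    by (subst lborel_snd_integral[OF int2]) (simp add: 2)
qed

lemma integral_deriv_snd:
  fixes k k' :: "'a::euclidean_space \<times> real \<Rightarrow> real"
  assumes k: "\<And>x y. ((\<lambda>y. k (x, y)) has_real_derivative k' (x, y)) (at y)" and c: "continuous_on UNIV k'"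
    and K: "compact K" "\<And>p. p \<notin> K \<Longrightarrow> k p = 0"
  shows "integral\<^sup>L lborel k' = 0"
proof -
  have z: "k' p = 0" if "p \<notin> K" for p
  proof (cases p)
    case (Pair x y)
    show ?thesis
      using deriv_zero_off_closed[of K k "\<lambda>y. (x, y)" y, OF compact_imp_closed[OF K(1)] K(2)] k[of x y] that Pair
      by (auto intro!: continuous_intros)
  qed
  have int: "integrable lborel k'" by (rule integrable_continuous_compact_support[OF c K(1) z])
  have slice: "continuous_on UNIV (\<lambda>y. k' (x, y))" for x
    by (rule continuous_on_compose2[OF c]) (auto intro!: continuous_intros)
  have 2: "(\<integral>y. k' (x, y) \<partial>lborel) = 0" for x
    by (rule integral_deriv_compact_support(1)[OF k slice bounded_slice(2)[OF compact_imp_bounded[OF K(1)]]])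
      (use z K(2) in auto)
  show "integral\<^sup>L lborel k' = 0"
    by (subst lborel_fst_integral[OF int]) (simp add: 2)
qed

section \<open>The divergence theorem on intrinsic subgraphs\<close>

text \<open>On each fibre a shear is a translation, so Fubini and translation invariance replace a
  change-of-variables theorem, and a Borel \<open>k\<close> is enough.\<close>

lemma nn_integral_shear_snd:
  fixes f :: "'a::euclidean_space \<times> 'b::euclidean_space \<Rightarrow> ennreal"
  assumes [measurable]: "f \<in> borel_measurable borel" "k \<in> borel_measurable borel"
  shows "(\<integral>\<^sup>+p. f (fst p, snd p + k (fst p)) \<partial>lborel) = (\<integral>\<^sup>+p. f p \<partial>lborel)"
proof -
  have [measurable]: "f \<in> borel_measurable (lborel \<Otimes>\<^sub>M lborel)"
    by (simp add: lborel_prod)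
  have "(\<integral>\<^sup>+p. f (fst p, snd p + k (fst p)) \<partial>lborel) = (\<integral>\<^sup>+x. \<integral>\<^sup>+y. f (x, y + k x) \<partial>lborel \<partial>lborel)"
    by (subst lborel_prod[symmetric], subst lborel.nn_integral_fst[symmetric]) simp_all
  also have "\<dots> = (\<integral>\<^sup>+x. \<integral>\<^sup>+y. f (x, y) \<partial>lborel \<partial>lborel)"
  proof (rule nn_integral_cong)
    fix x :: 'a
    have [measurable]: "(\<lambda>y. f (x, y)) \<in> borel_measurable borel"
      by (rule measurable_compose[OF _ assms(1)]) (simp add: borel_prod[symmetric])
    have "(\<integral>\<^sup>+y. f (x, y) \<partial>lborel) = (\<integral>\<^sup>+y. f (x, y) \<partial>distr lborel borel ((+) (k x)))"
      by (simp add: lborel_distr_plus)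
    also have "\<dots> = (\<integral>\<^sup>+y. f (x, y + k x) \<partial>lborel)"
      by (subst nn_integral_distr) (auto simp: add.commute)
    finally show "(\<integral>\<^sup>+y. f (x, y + k x) \<partial>lborel) = (\<integral>\<^sup>+y. f (x, y) \<partial>lborel)" ..
  qed
  also have "\<dots> = (\<integral>\<^sup>+p. f p \<partial>lborel)"
    by (subst lborel.nn_integral_fst) (simp_all add: lborel_prod)
  finally show ?thesis .
qed

lemma nn_integral_shear_fst:
  fixes f :: "'a::euclidean_space \<times> 'b::euclidean_space \<Rightarrow> ennreal"
  assumes [measurable]: "f \<in> borel_measurable borel" "k \<in> borel_measurable borel"
  shows "(\<integral>\<^sup>+p. f (fst p + k (snd p), snd p) \<partial>lborel) = (\<integral>\<^sup>+p. f p \<partial>lborel)"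
proof -
  have swap: "(\<integral>\<^sup>+p. g p \<partial>lborel) = (\<integral>\<^sup>+p. g (snd p, fst p) \<partial>lborel)"
    if [measurable]: "g \<in> borel_measurable borel" for g :: "'a \<times> 'b \<Rightarrow> ennreal"
  proof -
    have [measurable]: "g \<in> borel_measurable (lborel \<Otimes>\<^sub>M lborel)"
      by (simp add: lborel_prod)
    have "(\<integral>\<^sup>+p. g p \<partial>lborel) = (\<integral>\<^sup>+y. \<integral>\<^sup>+x. g (x, y) \<partial>lborel \<partial>lborel)"
      by (subst lborel_pair.nn_integral_snd) (simp_all add: lborel_prod split_beta')
    also have "\<dots> = (\<integral>\<^sup>+p. g (snd p, fst p) \<partial>(lborel \<Otimes>\<^sub>M lborel))"
      by (subst lborel.nn_integral_fst[symmetric]) simp_all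
    finally show ?thesis by (simp add: lborel_prod)
  qed
  have [measurable]: "(\<lambda>p. f (fst p + k (snd p), snd p)) \<in> borel_measurable borel"
    by (rule measurable_compose[OF _ assms(1)]) (simp add: borel_prod[symmetric])
  have m: "(\<lambda>p. f (snd p, fst p)) \<in> borel_measurable borel"
    by (rule measurable_compose[OF _ assms(1)]) (simp add: borel_prod[symmetric])
  show ?thesis
    using nn_integral_shear_snd[OF m assms(2)] by (subst (1 2) swap) simp_all
qed

text \<open>For \<open>p = (s, \<eta>, \<tau>)\<close> this is \<open>(0, \<eta>, \<tau>)
  \<cdot>\<^sub>H (f (\<eta>, \<tau>) + s, 0, 0)\<close>, the point reached from the graph by
  following \<open>X1\<close> for time \<open>s\<close>. The graph becomes the plane
  \<open>s = 0\<close>, the subgraph the half space \<open>s < 0\<close>, and \<open>X1\<close> the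
  first partial derivative.\<close>

definition graph_chart :: "(real \<times> real \<Rightarrow> real) \<Rightarrow> heis \<Rightarrow> heis" where
  "graph_chart f p = (let s = f (snd p) + fst p in (s, fst (snd p), snd (snd p) + 2 * fst (snd p) * s))"

text \<open>The chart is a composition of two shears: first by \<open>f\<close> in the transversal
  variable, then, for a fixed value of that variable, in the last coordinate. Each preserves
  Lebesgue measure.\<close>

lemma distr_graph_chart:
  assumes f: "continuous_on UNIV f"
  shows "distr lborel lborel (graph_chart f) = lborel"
proof (rule measure_eqI)
  have mf[measurable]: "f \<in> borel_measurable borel" by (rule borel_measurable_continuous_onI[OF f])
  have gc: "graph_chart f \<in> borel_measurable borel"
    unfolding graph_chart_def Let_def
    by (intro borel_measurable_continuous_onI continuous_intros continuous_on_compose2[OF f]) auto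
  fix A assume "A \<in> sets (distr lborel lborel (graph_chart f))"
  then have A[measurable]: "A \<in> sets borel" by simp
  define F :: "heis \<Rightarrow> ennreal" where "F = indicator A"
  have F[measurable]: "F \<in> borel_measurable borel" unfolding F_def by simp
  define G :: "heis \<Rightarrow> ennreal" where "G p = F (fst p, fst (snd p), snd (snd p) + 2 * fst (snd p) * fst p)" for p
  have G: "G \<in> borel_measurable borel"
    unfolding G_def by (rule measurable_compose[OF _ F]) (intro borel_measurable_continuous_onI continuous_intros)
  have "emeasure (distr lborel lborel (graph_chart f)) A = (\<integral>\<^sup>+p. F p \<partial>distr lborel lborel (graph_chart f))"
    by (simp add: F_def)
  also have "\<dots> = (\<integral>\<^sup>+p. F (graph_chart f p) \<partial>lborel)"
    using gc F by (intro nn_integral_distr) simp_all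
  also have "\<dots> = (\<integral>\<^sup>+p. G (fst p + f (snd p), snd p) \<partial>lborel)"
    by (simp add: graph_chart_def G_def Let_def algebra_simps)
  also have "\<dots> = (\<integral>\<^sup>+p. G p \<partial>lborel)"
    by (rule nn_integral_shear_fst[OF G mf])
  also have "\<dots> = (\<integral>\<^sup>+x. \<integral>\<^sup>+q. G (x, q) \<partial>lborel \<partial>lborel)"
    using G by (subst lborel.nn_integral_fst) (simp_all add: lborel_prod)
  also have "\<dots> = (\<integral>\<^sup>+x. \<integral>\<^sup>+q. F (x, q) \<partial>lborel \<partial>lborel)"
  proof (rule nn_integral_cong)
    fix x :: real
    have m: "(\<lambda>q. F (x, q)) \<in> borel_measurable borel"
      by (rule measurable_compose[OF _ F]) (simp add: borel_prod[symmetric])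
    show "(\<integral>\<^sup>+q. G (x, q) \<partial>lborel) = (\<integral>\<^sup>+q. F (x, q) \<partial>lborel)"
      using nn_integral_shear_snd[OF m, of "\<lambda>y. 2 * y * x"] by (simp add: G_def)
  qed
  also have "\<dots> = (\<integral>\<^sup>+p. F p \<partial>lborel)"
    using F by (subst lborel.nn_integral_fst) (simp_all add: lborel_prod)
  also have "\<dots> = emeasure lborel A" by (simp add: F_def)
  finally show "emeasure (distr lborel lborel (graph_chart f)) A = emeasure lborel A" .
qed simp

lemma integral_graph_chart:
  fixes F :: "heis \<Rightarrow> real"
  assumes f: "continuous_on UNIV f" and F: "F \<in> borel_measurable borel"
  shows "integral\<^sup>L lborel F = (\<integral>p. F (graph_chart f p) \<partial>lborel)"
proof -
  have gc: "graph_chart f \<in> borel_measurable borel"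
    unfolding graph_chart_def Let_def
    by (intro borel_measurable_continuous_onI continuous_intros continuous_on_compose2[OF f]) auto
  have "integral\<^sup>L lborel F = integral\<^sup>L (distr lborel lborel (graph_chart f)) F"
    by (simp add: distr_graph_chart[OF f])
  also have "\<dots> = (\<integral>p. F (graph_chart f p) \<partial>lborel)"
    using gc F by (intro integral_distr) simp_all
  finally show ?thesis .
qed

lemma graph_chart_in_subgraph: "graph_chart f p \<in> X1_subgraph f \<longleftrightarrow> fst p < 0"
  by (cases p) (simp add: graph_chart_def X1_subgraph_def Let_def algebra_simps)

lemma compact_graph_chart_vimage:
  assumes f: "continuous_on UNIV f" and K: "compact K"
  shows "compact (graph_chart f -` K)"
proof -
  define g where "g p = (fst p - f (fst (snd p), snd (snd p) - 2 * fst (snd p) * fst p), 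
    fst (snd p), snd (snd p) - 2 * fst (snd p) * fst p)" for p :: heis
  have gf: "g (graph_chart f p) = p" and fg: "graph_chart f (g p) = p" for p
    by (cases p; simp add: g_def graph_chart_def Let_def)+
  have "continuous_on UNIV g"
    unfolding g_def by (intro continuous_intros continuous_on_compose2[OF f]) auto
  then have "compact (g ` K)" using K compact_continuous_image continuous_on_subset by blast
  moreover have "g ` K = graph_chart f -` K" using gf fg by (auto intro!: image_eqI) (metis gf)
  ultimately show ?thesis by simp
qed

lemma open_X1_subgraph:
  assumes f: "continuous_on UNIV f"
  shows "open (X1_subgraph f)"
proof -
  have eq: "X1_subgraph f = {p. fst p < f (fst (snd p), snd (snd p) - 2 * fst p * fst (snd p))}"
    unfolding X1_subgraph_def by auto
  show ?thesis unfolding eq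
    by (intro open_Collect_less continuous_intros continuous_on_compose2[OF f]) auto
qed

section \<open>The divergence of a horizontal field in the chart\<close>

lemma heis_partials:
  fixes g :: "heis \<Rightarrow> real"
  assumes "C1_map g"
  obtains P1 P2 P3 where "continuous_on UNIV P1" "continuous_on UNIV P2" "continuous_on UNIV P3"
    "\<And>p. (g has_derivative (\<lambda>h. fst h * P1 p + fst (snd h) * P2 p + snd (snd h) * P3 p)) (at p)"
proof -
  obtain D where D: "\<And>x. (g has_derivative D x) (at x)" "\<And>v. continuous_on UNIV (\<lambda>x. D x v)"
    using C1_mapD[OF assms] by blast
  have eq: "D p = (\<lambda>h. fst h * D p (1, 0, 0) + fst (snd h) * D p (0, 1, 0) + snd (snd h) * D p (0, 0, 1))" for p
  proof
    fix h
    interpret bounded_linear "D p" using D(1) by (rule has_derivative_bounded_linear)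
    have "D p h = D p (fst h *\<^sub>R (1, 0, 0) + fst (snd h) *\<^sub>R (0, 1, 0) + snd (snd h) *\<^sub>R (0, 0, 1))"
      by (rule arg_cong[where f = "D p"]) (cases h, simp)
    also have "\<dots> = fst h * D p (1, 0, 0) + fst (snd h) * D p (0, 1, 0) + snd (snd h) * D p (0, 0, 1)"
      by (simp only: add scaleR real_scaleR_def)
    finally show "D p h = fst h * D p (1, 0, 0) + fst (snd h) * D p (0, 1, 0) + snd (snd h) * D p (0, 0, 1)" .
  qed
  show thesis
    by (rule that[OF D(2) D(2) D(2) has_derivative_eq_rhs[OF D(1) eq]])
qed

lemma heis_deriv_along:
  fixes g :: "heis \<Rightarrow> real"
  assumes "(g has_derivative (\<lambda>h. fst h * P1 + fst (snd h) * P2 + snd (snd h) * P3)) (at (x s, y s, t s))"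
    "(x has_real_derivative x') (at s)" "(y has_real_derivative y') (at s)" "(t has_real_derivative t') (at s)"
  shows "((\<lambda>s. g (x s, y s, t s)) has_real_derivative x' * P1 + y' * P2 + t' * P3) (at s)"
proof -
  have "((\<lambda>s. (x s, y s, t s)) has_derivative (\<lambda>h. (x' * h, y' * h, t' * h))) (at s)"
    using assms(2-4) by (intro has_derivative_Pair) (auto simp: has_field_derivative_def)
  from has_derivative_compose[OF this assms(1)]
  have "((\<lambda>s. g (x s, y s, t s)) has_derivative (\<lambda>h. x' * h * P1 + y' * h * P2 + t' * h * P3)) (at s)"
    by simp
  moreover have "(\<lambda>h. x' * h * P1 + y' * h * P2 + t' * h * P3) = (*) (x' * P1 + y' * P2 + t' * P3)"
    by (auto simp: algebra_simps)
  ultimately show ?thesis unfolding has_field_derivative_def by simp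
qed

lemma integrable_halfspace:
  fixes k :: "real \<times> 'b::euclidean_space \<Rightarrow> real"
  assumes int: "integrable lborel k"
  shows "integrable lborel (\<lambda>p. indicator {..<0} (fst p) * k p)"
proof (rule Bochner_Integration.integrable_bound[OF int])
  have "(\<lambda>p::real \<times> 'b. indicator {..<0} (fst p) :: real) \<in> borel_measurable borel"
    unfolding borel_prod[symmetric] by measurable
  then show "(\<lambda>p. indicator {..<0} (fst p) * k p) \<in> borel_measurable lborel" using int by simp
qed (auto simp: indicator_def)

lemma set_integral_graph_chart:
  fixes F :: "heis \<Rightarrow> real"
  assumes f: "continuous_on UNIV f" and F: "continuous_on UNIV F"
  shows "(LINT p:X1_subgraph f|lebesgue. F p) = (\<integral>p. indicator {..<0} (fst p) * F (graph_chart f p) \<partial>lborel)"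
proof -
  have m: "(\<lambda>p. indicator (X1_subgraph f) p * F p) \<in> borel_measurable borel"
    by (intro borel_measurable_times borel_measurable_indicator borel_measurable_continuous_onI[OF F]
        borel_open open_X1_subgraph[OF f])
  have "(LINT p:X1_subgraph f|lebesgue. F p) = (\<integral>p. indicator (X1_subgraph f) p * F p \<partial>lborel)"
    unfolding set_lebesgue_integral_def using m by (simp add: integral_completion)
  also have "\<dots> = (\<integral>p. indicator (X1_subgraph f) (graph_chart f p) * F (graph_chart f p) \<partial>lborel)"
    by (rule integral_graph_chart[OF f m])
  also have "\<dots> = (\<integral>p. indicator {..<0} (fst p) * F (graph_chart f p) \<partial>lborel)"
    by (simp add: indicator_def graph_chart_in_subgraph)
  finally show ?thesis .
qed

text \<open>In the coordinates of \<^const>\<open>graph_chart\<close> the divergence of a horizontal field is a sum of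
  pure partial derivatives, of which only the one transversal to the graph survives integration
  over the half space.\<close>

lemma subgraph_divergence:
  assumes f: "has_partials f f1 f2" "continuous_on UNIV f1" "continuous_on UNIV f2"
    and \<zeta>: "C1_map \<zeta>" "compact (closure {p. \<zeta> p \<noteq> 0})"
  shows "(LINT p:X1_subgraph f|lebesgue. X1_adj (\<lambda>q. fst (\<zeta> q)) p + X2_adj (\<lambda>q. snd (\<zeta> q)) p) =
    (\<integral>q. snd (\<zeta> (graph_chart f (0, q))) * (f1 q - 4 * f q * f2 q) - fst (\<zeta> (graph_chart f (0, q))) \<partial>lborel)"
proof -
  have fc: "continuous_on UNIV f" by (rule has_partials_continuous[OF f(1)])
  have gc: "continuous_on UNIV (graph_chart f)"
    unfolding graph_chart_def Let_def
    by (intro continuous_intros continuous_on_compose2[OF fc]) auto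
  obtain P1 P2 P3 where P: "continuous_on UNIV P1" "continuous_on UNIV P2" "continuous_on UNIV P3"
    "\<And>p. ((\<lambda>q. fst (\<zeta> q)) has_derivative (\<lambda>h. fst h * P1 p + fst (snd h) * P2 p + snd (snd h) * P3 p)) (at p)"
    using heis_partials[OF C1_map_fst[OF \<zeta>(1)]] by blast
  obtain Q1 Q2 Q3 where Q: "continuous_on UNIV Q1" "continuous_on UNIV Q2" "continuous_on UNIV Q3"
    "\<And>p. ((\<lambda>q. snd (\<zeta> q)) has_derivative (\<lambda>h. fst h * Q1 p + fst (snd h) * Q2 p + snd (snd h) * Q3 p)) (at p)"
    using heis_partials[OF C1_map_snd[OF \<zeta>(1)]] by blast
  have X1: "X1_adj (\<lambda>q. fst (\<zeta> q)) p = - (P1 p + 2 * fst (snd p) * P3 p)" for p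
  proof (cases p)
    case (fields x y t)
    have "((\<lambda>s. fst (\<zeta> (s, y, t))) has_real_derivative P1 (x, y, t)) (at x)"
      using heis_deriv_along[OF P(4) DERIV_ident DERIV_const DERIV_const, of y t x] by simp
    moreover have "((\<lambda>s. fst (\<zeta> (x, y, s))) has_real_derivative P3 (x, y, t)) (at t)"
      using heis_deriv_along[OF P(4) DERIV_const DERIV_const DERIV_ident, of x y t] by simp
    ultimately show ?thesis
      unfolding X1_adj_def X1_def fields by (simp add: DERIV_imp_deriv)
  qed
  have X2: "X2_adj (\<lambda>q. snd (\<zeta> q)) p = - (Q2 p - 2 * fst p * Q3 p)" for p
  proof (cases p)
    case (fields x y t)
    have "((\<lambda>s. snd (\<zeta> (x, s, t))) has_real_derivative Q2 (x, y, t)) (at y)"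
      using heis_deriv_along[OF Q(4) DERIV_const DERIV_ident DERIV_const, of x t y] by simp
    moreover have "((\<lambda>s. snd (\<zeta> (x, y, s))) has_real_derivative Q3 (x, y, t)) (at t)"
      using heis_deriv_along[OF Q(4) DERIV_const DERIV_const DERIV_ident, of x y t] by simp
    ultimately show ?thesis
      unfolding X2_adj_def X2_def fields by (simp add: DERIV_imp_deriv)
  qed
  define K where "K = graph_chart f -` closure {p. \<zeta> p \<noteq> 0}"
  have K: "compact K" unfolding K_def by (rule compact_graph_chart_vimage[OF fc \<zeta>(2)])
  have out: "\<zeta> (graph_chart f p) = 0" if "p \<notin> K" for p
    using that closure_subset[of "{p. \<zeta> p \<noteq> 0}"] unfolding K_def by auto
  define T where "T = graph_chart f"
  define H where "H p = snd (\<zeta> (T p))" for p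
  \<comment> \<open>With \<open>\<sigma>\<close> the transversal variable and
    \<open>s = f + \<sigma>\<close>, the field \<open>X2\<close> reads
    \<open>d_\<eta> - 4 s d_\<tau> - (f1 - 4 s f2) d_\<sigma>\<close> in the chart;
    \<open>ks\<close> and \<open>kt\<close> are the fluxes belonging to its last and its middle
    term. Only \<open>d_\<sigma>\<close> falls on \<open>ks\<close>, where \<open>f1\<close> and
    \<open>f2\<close> are constant, so no second derivative of \<open>f\<close> occurs.\<close>
  define ks where "ks p = (f1 (snd p) - 4 * (f (snd p) + fst p) * f2 (snd p)) * H p" for p
  define kt where "kt p = (f (snd p) + fst p) * H p" for p
  define H1' where "H1' p = P1 (T p) + 2 * fst (snd p) * P3 (T p)" for p
  define ks' where "ks' p = - 4 * f2 (snd p) * H p + (f1 (snd p) - 4 * (f (snd p) + fst p) * f2 (snd p)) *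
    (Q1 (T p) + 2 * fst (snd p) * Q3 (T p))" for p
  define ke' where "ke' p = f1 (snd p) * Q1 (T p) + Q2 (T p) +
    (2 * (f (snd p) + fst p) + 2 * fst (snd p) * f1 (snd p)) * Q3 (T p)" for p
  define kt' where "kt' p = f2 (snd p) * H p + (f (snd p) + fst p) *
    (f2 (snd p) * Q1 (T p) + (1 + 2 * fst (snd p) * f2 (snd p)) * Q3 (T p))" for p
  have T: "T (s, y, t) = (f (y, t) + s, y, t + 2 * y * (f (y, t) + s))" for s y t
    by (simp add: T_def graph_chart_def Let_def)
  have cT: "continuous_on UNIV (\<lambda>p. g (T p))" if "continuous_on UNIV g" for g :: "heis \<Rightarrow> real"
    using continuous_on_compose2[OF that gc] by (simp add: T_def)
  have csnd: "continuous_on UNIV (\<lambda>p::heis. g (snd p))" if "continuous_on UNIV g" for g :: "real \<times> real \<Rightarrow> real"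
    by (rule continuous_on_compose2[OF that]) (auto intro!: continuous_intros)
  note cont = continuous_intros csnd[OF fc] csnd[OF f(2)] csnd[OF f(3)] cT[OF P(1)] cT[OF P(3)]
    cT[OF Q(1)] cT[OF Q(2)] cT[OF Q(3)]
  have cz: "continuous_on UNIV (\<lambda>p. fst (\<zeta> (T p)))" and cH: "continuous_on UNIV H"
    unfolding H_def by (intro cT C1_map_continuous C1_map_fst C1_map_snd \<zeta>(1))+
  have cont': "continuous_on UNIV H1'" "continuous_on UNIV ks'" "continuous_on UNIV ke'" "continuous_on UNIV kt'"
    unfolding H1'_def[abs_def] ks'_def[abs_def] ke'_def[abs_def] kt'_def[abs_def] by (intro cont cH)+
  have dH1: "((\<lambda>s. fst (\<zeta> (T (s, q)))) has_real_derivative H1' (s, q)) (at s)" for s q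
  proof (cases q)
    case (Pair y t)
    show ?thesis unfolding Pair T H1'_def snd_conv fst_conv
      by (rule DERIV_cong[OF heis_deriv_along[OF P(4)]]) (auto intro!: derivative_eq_intros)
  qed
  have dHs: "((\<lambda>s. H (s, q)) has_real_derivative Q1 (T (s, q)) + 2 * fst q * Q3 (T (s, q))) (at s)" for s q
  proof (cases q)
    case (Pair y t)
    show ?thesis unfolding Pair T H_def snd_conv fst_conv
      by (rule DERIV_cong[OF heis_deriv_along[OF Q(4)]]) (auto intro!: derivative_eq_intros)
  qed
  have dks: "((\<lambda>s. ks (s, q)) has_real_derivative ks' (s, q)) (at s)" for s q
    unfolding ks_def ks'_def by (rule derivative_eq_intros dHs refl | simp)+
  have dke: "((\<lambda>y. H (s, y, t)) has_real_derivative ke' (s, y, t)) (at y)" for s y t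
    unfolding H_def ke'_def T snd_conv fst_conv
    by (rule DERIV_cong[OF heis_deriv_along[OF Q(4)]])
      (auto intro!: derivative_eq_intros has_partials_fst[OF f(1)] simp: algebra_simps)
  have dHt: "((\<lambda>t. H (s, y, t)) has_real_derivative
      f2 (y, t) * Q1 (T (s, y, t)) + (1 + 2 * y * f2 (y, t)) * Q3 (T (s, y, t))) (at t)" for s y t
    unfolding H_def T snd_conv fst_conv
    by (rule DERIV_cong[OF heis_deriv_along[OF Q(4)]])
      (auto intro!: derivative_eq_intros has_partials_snd[OF f(1)] simp: algebra_simps)
  have dkt: "((\<lambda>t. kt (s, y, t)) has_real_derivative kt' (s, y, t)) (at t)" for s y t
    unfolding kt_def kt'_def by (rule derivative_eq_intros dHt has_partials_snd[OF f(1)] refl | simp)+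
  have zero: "fst (\<zeta> (T p)) = 0" "H p = 0" "ks p = 0" "kt p = 0" if "p \<notin> K" for p
    using out[OF that] unfolding H_def ks_def kt_def T_def by auto
  have zero': "H1' p = 0" "ks' p = 0" "ke' p = 0" "kt' p = 0" if p: "p \<notin> K" for p
  proof -
    obtain s y t where [simp]: "p = (s, y, t)" by (cases p)
    note z = deriv_zero_off_closed[OF compact_imp_closed[OF K]]
    show "H1' p = 0" 
      using z[of "\<lambda>p. fst (\<zeta> (T p))" "\<lambda>s. (s, y, t)", OF zero(1) _ _ dH1] p by (auto intro!: continuous_intros)
    show "ks' p = 0" 
      using z[of "ks" "\<lambda>s. (s, y, t)", OF zero(3) _ _ dks] p by (auto intro!: continuous_intros)
    show "ke' p = 0" 
      using z[of "H" "\<lambda>y. (s, y, t)", OF zero(2) _ _ dke] p by (auto intro!: continuous_intros)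
    show "kt' p = 0" 
      using z[of "kt" "\<lambda>t. (s, y, t)", OF zero(4) _ _ dkt] p by (auto intro!: continuous_intros)
  qed
  note int = integrable_halfspace[OF integrable_continuous_compact_support[OF _ K]]
  note ints = int[OF cont'(1) zero'(1)] int[OF cont'(2) zero'(2)] int[OF cont'(3) zero'(3)] int[OF cont'(4) zero'(4)]
  have slice: "compact {q. (s, q) \<in> K}" for s
  proof -
    have "{q. (s, q) \<in> K} = snd ` (K \<inter> ({s} \<times> UNIV))" by force
    also have "compact \<dots>"
      by (intro compact_continuous_image continuous_intros compact_Int_closed K closed_Times)
    finally show ?thesis .
  qed
  \<comment> \<open>The indicator depends on the transversal variable alone, so it is constant on
    each slice, and a derivative taken within the slice integrates to zero.\<close>
  have e0: "(\<integral>p. indicator {..<0} (fst p) * ke' p \<partial>lborel) = 0"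
  proof (subst lborel_fst_integral[OF ints(3)])
    have "(\<integral>q. ke' (s, q) \<partial>lborel) = 0" for s
      by (rule integral_deriv_fst(1)[OF dke _ slice])
         (use zero in \<open>auto intro!: continuous_on_compose2[OF cont'(3)] continuous_intros\<close>)
    then show "(\<integral>s. \<integral>q. indicator {..<0} (fst (s, q)) * ke' (s, q) \<partial>lborel \<partial>lborel) = 0" by simp
  qed
  have t0: "(\<integral>p. indicator {..<0} (fst p) * kt' p \<partial>lborel) = 0"
  proof (subst lborel_fst_integral[OF ints(4)])
    have "(\<integral>q. kt' (s, q) \<partial>lborel) = 0" for s
      by (rule integral_deriv_snd[OF dkt _ slice])
         (use zero in \<open>auto intro!: continuous_on_compose2[OF cont'(4)] continuous_intros\<close>)
    then show "(\<integral>s. \<integral>q. indicator {..<0} (fst (s, q)) * kt' (s, q) \<partial>lborel \<partial>lborel) = 0" by simp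
  qed
  have s0: "(\<integral>p. indicator {..<0} (fst p) * ks' p \<partial>lborel) = (\<integral>q. ks (0, q) \<partial>lborel)"
    by (rule integral_deriv_fst(2)[OF dks cont'(2) K zero(3)])
  have h0: "(\<integral>p. indicator {..<0} (fst p) * H1' p \<partial>lborel) = (\<integral>q. fst (\<zeta> (T (0, q))) \<partial>lborel)"
    by (rule integral_deriv_fst(2)[OF dH1 cont'(1) K zero(1)])
  \<comment> \<open>Moving the coefficients under the derivatives adds \<open>- 4 * f2 * H\<close>
    in the \<open>\<tau>\<close> term and \<open>4 * f2 * H\<close> in the transversal one; these
    cancel.\<close>
  have id: "P1 (T p) + 2 * fst (snd (T p)) * P3 (T p) = H1' p"
    "Q2 (T p) - 2 * fst (T p) * Q3 (T p) = ke' p - 4 * kt' p - ks' p" for p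
    by (cases p; simp add: T H1'_def ke'_def kt'_def ks'_def algebra_simps)+
  have cX: "continuous_on UNIV (\<lambda>p. X1_adj (\<lambda>q. fst (\<zeta> q)) p + X2_adj (\<lambda>q. snd (\<zeta> q)) p)"
    unfolding X1 X2 by (intro continuous_intros P Q)
  have "(LINT p:X1_subgraph f|lebesgue. X1_adj (\<lambda>q. fst (\<zeta> q)) p + X2_adj (\<lambda>q. snd (\<zeta> q)) p) =
     (\<integral>p. indicator {..<0} (fst p) * (- (H1' p) - (ke' p - 4 * kt' p - ks' p)) \<partial>lborel)"
    unfolding set_integral_graph_chart[OF fc cX] unfolding X1 X2 T_def[symmetric] id by (simp add: algebra_simps)
  also have "\<dots> = (\<integral>p. - (indicator {..<0} (fst p) * H1' p) - indicator {..<0} (fst p) * ke' p 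
      + 4 * (indicator {..<0} (fst p) * kt' p) + indicator {..<0} (fst p) * ks' p \<partial>lborel)"
    by (rule Bochner_Integration.integral_cong) (simp_all add: algebra_simps)
  also have "\<dots> = - (\<integral>p. indicator {..<0} (fst p) * H1' p \<partial>lborel) - (\<integral>p. indicator {..<0} (fst p) * ke' p \<partial>lborel)
     + 4 * (\<integral>p. indicator {..<0} (fst p) * kt' p \<partial>lborel) + (\<integral>p. indicator {..<0} (fst p) * ks' p \<partial>lborel)"
    using ints by simp
  also have "\<dots> = (\<integral>q. ks (0, q) \<partial>lborel) - (\<integral>q. fst (\<zeta> (T (0, q))) \<partial>lborel)"
    unfolding e0 t0 s0 h0 by simp
  also have "\<dots> = (\<integral>q. ks (0, q) - fst (\<zeta> (T (0, q))) \<partial>lborel)"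
  proof (rule Bochner_Integration.integral_diff[symmetric])
    have c0: "continuous_on UNIV (\<lambda>q. (0::real, q))" by (intro continuous_intros)
    show "integrable lborel (\<lambda>q. ks (0, q))"
      by (rule integrable_continuous_compact_support[OF _ slice[of 0]])
        (use zero in \<open>auto simp: ks_def intro!: continuous_intros f(2,3) fc continuous_on_compose2[OF cH]\<close>)
    show "integrable lborel (\<lambda>q. fst (\<zeta> (T (0, q))))"
      by (rule integrable_continuous_compact_support[OF continuous_on_compose2[OF cz c0] slice[of 0]])
        (use zero in auto)
  qed
  finally show ?thesis by (simp add: ks_def H_def T_def mult.commute)
qed

section \<open>Perimeter of intrinsic subgraphs in cylinders\<close>

text \<open>Squaring removes the kink of the positive part at 0 and leaves a C^1 function, the
  regularity that test fields and variations require.\<close>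

definition pos_sq :: "real \<Rightarrow> real" where "pos_sq x = (max 0 x)\<^sup>2"

lemma pos_sq_deriv: "(pos_sq has_real_derivative 2 * max 0 x) (at x)"
proof -
  consider "x > 0" | "x < 0" | "x = 0" by linarith
  then show ?thesis
  proof cases
    case 1
    have "((\<lambda>x. x\<^sup>2) has_real_derivative 2 * max 0 x) (at x)"
      using 1 by (auto intro!: derivative_eq_intros)
    then show ?thesis
      by (rule DERIV_cong_ev[THEN iffD1, rotated -1, OF _ refl _ refl])
         (use 1 in \<open>auto simp: pos_sq_def eventually_nhds intro!: exI[of _ "{0<..}"]\<close>)
  next
    case 2
    have "((\<lambda>x. 0) has_real_derivative 2 * max 0 x) (at x)"
      using 2 by (auto intro!: derivative_eq_intros)
    then show ?thesis
      by (rule DERIV_cong_ev[THEN iffD1, rotated -1, OF _ refl _ refl])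
         (use 2 in \<open>auto simp: pos_sq_def eventually_nhds intro!: exI[of _ "{..<0}"]\<close>)
  next
    case 3
    have "((\<lambda>h. max 0 h) \<longlongrightarrow> max 0 0) (at (0::real))"
      by (intro tendsto_intros)
    moreover have "(\<lambda>h. (pos_sq (0 + h) - pos_sq 0) / h) = (\<lambda>h. max 0 h)"
      by (auto simp: pos_sq_def max_def power2_eq_square)
    ultimately show ?thesis unfolding DERIV_def 3 by simp
  qed
qed

lemma C1_map_pos_sq: "C1_map f \<Longrightarrow> C1_map (\<lambda>x. pos_sq (f x))"
  by (rule C1_map_compose[OF C1_map_real[OF pos_sq_deriv]]) (auto intro!: continuous_intros)

definition bump :: "real \<Rightarrow> real" where "bump x = pos_sq (1 - x\<^sup>2)"

definition bump' :: "real \<Rightarrow> real" where "bump' x = - 4 * x * max 0 (1 - x\<^sup>2)"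

lemma bump_deriv: "(bump has_real_derivative bump' x) (at x)"
proof -
  have "((\<lambda>x. 1 - x\<^sup>2) has_real_derivative - 2 * x) (at x)"
    by (auto intro!: derivative_eq_intros)
  from DERIV_chain2[OF pos_sq_deriv this] show ?thesis
    unfolding bump_def[abs_def] bump'_def by (simp add: mult_ac)
qed

lemma continuous_bump: "continuous_on S bump" "continuous_on S bump'"
  unfolding bump_def bump'_def pos_sq_def by (intro continuous_intros)+

lemma bump_props: "0 \<le> bump x" "bump x \<le> 1" "bump 0 = 1"
  "\<bar>x\<bar> \<ge> 1 \<Longrightarrow> bump x = 0" "\<bar>x\<bar> \<ge> 1 \<Longrightarrow> bump' x = 0" "\<bar>x\<bar> < 1 \<Longrightarrow> 0 < bump x"
proof -
  have *: "\<bar>x\<bar> \<ge> 1 \<Longrightarrow> 1 - x\<^sup>2 \<le> 0" "\<bar>x\<bar> < 1 \<Longrightarrow> 0 < 1 - x\<^sup>2"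
    using abs_le_square_iff[of 1 x] abs_square_less_1[of x] by auto
  show "0 \<le> bump x" "bump x \<le> 1" "bump 0 = 1"
    by (auto simp: bump_def pos_sq_def power_le_one_iff max_def)
  show "\<bar>x\<bar> \<ge> 1 \<Longrightarrow> bump x = 0" "\<bar>x\<bar> \<ge> 1 \<Longrightarrow> bump' x = 0" "\<bar>x\<bar> < 1 \<Longrightarrow> 0 < bump x"
    using * by (auto simp: bump_def bump'_def pos_sq_def max_def)
qed

text \<open>Nesting \<open>pos_sq\<close> yields a C^1 step by composition, without gluing: the
  inner square vanishes for \<open>x \<ge> 1\<close>, the outer one for
  \<open>x \<le> 0\<close>.\<close>

definition smooth_step :: "real \<Rightarrow> real" where "smooth_step x = pos_sq (1 - pos_sq (1 - x))"

lemma smooth_step_props: "0 \<le> smooth_step x" "smooth_step x \<le> 1"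
  "x \<le> 0 \<Longrightarrow> smooth_step x = 0" "1 \<le> x \<Longrightarrow> smooth_step x = 1"
proof -
  show "0 \<le> smooth_step x" "smooth_step x \<le> 1"
    by (auto simp: smooth_step_def pos_sq_def power_le_one_iff max_def)
  have "1 \<le> (1 - x)\<^sup>2" if "x \<le> 0" using that by (intro one_le_power) simp
  then show "x \<le> 0 \<Longrightarrow> smooth_step x = 0" "1 \<le> x \<Longrightarrow> smooth_step x = 1"
    by (auto simp: smooth_step_def pos_sq_def max_def intro: antisym)
qed

text \<open>The Euclidean norm of \<open>(-1, x)\<close>. At \<open>x = w\<close> it is the density
  of the perimeter over the parameter plane; its derivatives \<open>x / area x\<close> and
  \<open>1 / area x ^ 3\<close> are the weights of the first and second variation.\<close>

definition area :: "real \<Rightarrow> real" where "area x = sqrt (1 + x\<^sup>2)"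

lemma area_ge_1: "1 \<le> area x" by (simp add: area_def)

lemma area_pos: "0 < area x" using area_ge_1[of x] by linarith

lemma area_sq: "(area x)\<^sup>2 = 1 + x\<^sup>2" by (simp add: area_def)

lemma area_deriv: "(area has_real_derivative x / area x) (at x)"
proof -
  have "0 < 1 + x\<^sup>2" by (intro add_pos_nonneg) auto
  then show ?thesis unfolding area_def
    by (auto intro!: derivative_eq_intros simp: field_simps)
qed

lemma continuous_area: "continuous_on S area"
  unfolding area_def by (intro continuous_intros)

section \<open>Cylinders along the integral curves of X1\<close>

text \<open>The projection along the integral curves of \<open>X1\<close>: \<open>p\<close> lies on
  the line \<open>(0, q) \<cdot>\<^sub>H (s, 0, 0)\<close> exactly for
  \<open>q = char_proj p\<close>, and then \<open>s = fst p\<close>.\<close>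

definition char_proj :: "heis \<Rightarrow> real \<times> real" where
  "char_proj p = (fst (snd p), snd (snd p) - 2 * fst p * fst (snd p))"

lemma X1_subgraph_char_proj: "X1_subgraph f = {p. fst p < f (char_proj p)}"
  by (auto simp: X1_subgraph_def char_proj_def)

lemma char_proj_graph_chart: "char_proj (graph_chart f (s, q)) = q" "fst (graph_chart f (s, q)) = f q + s"
  by (simp_all add: char_proj_def graph_chart_def Let_def prod_eq_iff)

lemma continuous_char_proj: "continuous_on S char_proj"
  unfolding char_proj_def by (intro continuous_intros)

lemma C1_map_char_proj: "C1_map char_proj"
  unfolding char_proj_def by (intro C1_map_intros)

text \<open>The base is measured by \<open>char_proj\<close> and not by a Euclidean projection, so a
  graph that is bounded by less than \<open>M\<close> over the ball meets the cylinder exactly over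
  that ball.\<close>

definition cylinder :: "real \<Rightarrow> real \<Rightarrow> heis set" where
  "cylinder M R = {p. \<bar>fst p\<bar> < M \<and> char_proj p \<in> ball 0 R}"

definition closed_cylinder :: "real \<Rightarrow> real \<Rightarrow> heis set" where
  "closed_cylinder M R = {p. \<bar>fst p\<bar> \<le> M \<and> char_proj p \<in> cball 0 R}"

lemma open_cylinder: "open (cylinder M R)"
proof -
  have "cylinder M R = {p. \<bar>fst p\<bar> < M} \<inter> {p. norm (char_proj p) < R}"
    unfolding cylinder_def by auto
  then show ?thesis
    by (simp add: open_Int open_Collect_less continuous_intros continuous_char_proj)
qed

lemma compact_closed_cylinder: "compact (closed_cylinder M R)"
proof -
  have eq: "closed_cylinder M R = {p. \<bar>fst p\<bar> \<le> M} \<inter> {p. norm (char_proj p) \<le> R}"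
    unfolding closed_cylinder_def by auto
  have "closed (closed_cylinder M R)"
    unfolding eq by (intro closed_Int closed_Collect_le continuous_intros continuous_char_proj)
  moreover have "bounded (closed_cylinder M R)"
  proof (rule bounded_subset)
    show "bounded ({-M..M} \<times> {-R..R} \<times> {-(R + 2 * M * R)..R + 2 * M * R})"
      by (intro bounded_Times bounded_closed_interval)
    show "closed_cylinder M R \<subseteq> {-M..M} \<times> {-R..R} \<times> {-(R + 2 * M * R)..R + 2 * M * R}"
    proof
      fix p assume "p \<in> closed_cylinder M R"
      then obtain x y t where p: "p = (x, y, t)" and x: "\<bar>x\<bar> \<le> M" and n: "norm (y, t - 2 * x * y) \<le> R"
        by (cases p) (auto simp: closed_cylinder_def char_proj_def)
      have y: "\<bar>y\<bar> \<le> R" using norm_fst_le[of y "t - 2 * x * y"] n by simp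
      have t: "\<bar>t - 2 * x * y\<bar> \<le> R" using norm_snd_le[of "t - 2 * x * y" y] n by simp
      have "\<bar>x * y\<bar> \<le> M * R" unfolding abs_mult using x y by (intro mult_mono) auto
      then show "p \<in> {-M..M} \<times> {-R..R} \<times> {-(R + 2 * M * R)..R + 2 * M * R}"
        using x y t unfolding p by auto
    qed
  qed
  ultimately show ?thesis by (simp add: compact_eq_bounded_closed)
qed

lemma closed_cylinder_subset_cylinder: "M' < M \<Longrightarrow> R' < R \<Longrightarrow> closed_cylinder M' R' \<subseteq> cylinder M R"
  unfolding closed_cylinder_def cylinder_def by auto

lemma bounded_cylinder: "bounded (cylinder M R)"
  by (rule bounded_subset[OF compact_imp_bounded[OF compact_closed_cylinder[of M R]]]) (auto simp: cylinder_def closed_cylinder_def)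

lemma integrable_on_ball:
  fixes f :: "'a::euclidean_space \<Rightarrow> real"
  assumes "continuous_on UNIV f"
  shows "integrable lborel (\<lambda>q. indicator (ball 0 R) q * f q)"
proof (rule Bochner_Integration.integrable_bound)
  show "integrable lborel (\<lambda>q. indicator (cball 0 R) q *\<^sub>R f q)"
    by (rule borel_integrable_compact) (use assms continuous_on_subset in auto)
  have "f \<in> borel_measurable borel" by (rule borel_measurable_continuous_onI[OF assms])
  then show "(\<lambda>q. indicator (ball 0 R) q * f q) \<in> borel_measurable lborel"
    by (intro borel_measurable_times borel_measurable_indicator) simp_all
qed (auto simp: indicator_def)

text \<open>After the divergence formula the integrand is the scalar product of the field with
  \<open>(-1, w)\<close>, and Cauchy-Schwarz bounds it by \<open>area\<close>. Over points outside
  the ball the graph misses the cylinder, where the field vanishes.\<close>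

lemma H_perimeter_subgraph_le:
  assumes f: "has_partials f f1 f2" "continuous_on UNIV f1" "continuous_on UNIV f2"
  shows "H_perimeter (X1_subgraph f) (cylinder M R) \<le>
    ereal (\<integral>q. indicator (ball 0 R) q * area (f1 q - 4 * f q * f2 q) \<partial>lborel)"
  unfolding H_perimeter_def
proof (rule SUP_least)
  fix \<zeta> assume "\<zeta> \<in> horizontal_test_fields (cylinder M R)"
  then have \<zeta>: "C1_map \<zeta>" "compact (closure {p. \<zeta> p \<noteq> 0})" "closure {p. \<zeta> p \<noteq> 0} \<subseteq> cylinder M R"
    "\<And>p. norm (\<zeta> p) \<le> 1"
    unfolding horizontal_test_fields_def by auto
  have out: "\<zeta> p = 0" if "p \<notin> cylinder M R" for p
    using \<zeta>(3) closure_subset[of "{p. \<zeta> p \<noteq> 0}"] that by auto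
  let ?B = "\<lambda>q. f1 q - 4 * f q * f2 q" and ?z = "\<lambda>q. \<zeta> (graph_chart f (0, q))"
  have "(\<integral>q. snd (?z q) * ?B q - fst (?z q) \<partial>lborel) \<le> (\<integral>q. indicator (ball 0 R) q * area (?B q) \<partial>lborel)"
  proof (rule integral_mono')
    show "integrable lborel (\<lambda>q. indicator (ball 0 R) q * area (?B q))"
      by (intro integrable_on_ball continuous_on_compose2[OF continuous_area[of UNIV]] continuous_intros f
          has_partials_continuous[OF f(1)]) auto
    fix q :: "real \<times> real"
    show "0 \<le> indicator (ball 0 R) q * area (?B q)" using area_pos[of "?B q"] by (simp add: indicator_def less_imp_le)
    show "snd (?z q) * ?B q - fst (?z q) \<le> indicator (ball 0 R) q * area (?B q)"
    proof (cases "q \<in> ball 0 R")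
      case True
      have "snd (?z q) * ?B q - fst (?z q) = (?z q) \<bullet> (-1, ?B q)"
        by (simp add: inner_prod_def)
      also have "\<dots> \<le> norm (?z q) * norm (-1::real, ?B q)" by (rule norm_cauchy_schwarz)
      also have "\<dots> \<le> 1 * norm (-1::real, ?B q)" by (intro mult_right_mono \<zeta>(4)) auto
      also have "\<dots> = area (?B q)" by (simp add: norm_Pair area_def)
      finally show ?thesis using True by simp
    next
      case False
      then have "?z q = 0" by (intro out) (simp add: cylinder_def char_proj_graph_chart)
      then show ?thesis using False by simp
    qed
  qed
  then show "ereal (LINT p:X1_subgraph f|lebesgue. X1_adj (\<lambda>q. fst (\<zeta> q)) p + X2_adj (\<lambda>q. snd (\<zeta> q)) p)
     \<le> ereal (\<integral>q. indicator (ball 0 R) q * area (?B q) \<partial>lborel)"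
    unfolding subgraph_divergence[OF f \<zeta>(1,2)] by simp
qed

lemma C1_map_area_inverse:
  assumes "C1_map f"
  shows "C1_map (\<lambda>x. inverse (area (f x)))"
proof -
  have ne: "area x \<noteq> 0" for x using area_pos[of x] by simp
  have "((\<lambda>x. inverse (area x)) has_real_derivative - (x / area x) / (area x)\<^sup>2) (at x)" for x
    using ne[of x] by (auto intro!: derivative_eq_intros area_deriv simp: power2_eq_square field_simps)
  moreover have "continuous_on UNIV (\<lambda>x. - (x / area x) / (area x)\<^sup>2)"
    using ne by (auto intro!: continuous_intros continuous_area)
  ultimately show ?thesis by (intro C1_map_compose[OF C1_map_real assms])
qed

text \<open>The test fields below extend the unit normal of the graph, cut off away from the graph
  and near the boundary of the cylinder.\<close>

lemma H_perimeter_subgraph_ge: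
  assumes f: "has_partials f f1 f2" "C1_map f1" "C1_map f2"
    and R: "0 < R" and M: "\<And>q. q \<in> ball 0 R \<Longrightarrow> \<bar>f q\<bar> + 1 \<le> M'" "M' < M"
  shows "ereal (\<integral>q. indicator (ball 0 R) q * area (f1 q - 4 * f q * f2 q) \<partial>lborel)
    \<le> H_perimeter (X1_subgraph f) (cylinder M R)"
proof -
  let ?B = "\<lambda>q. f1 q - 4 * f q * f2 q"
  have cf: "continuous_on UNIV f1" "continuous_on UNIV f2" using f C1_map_continuous by auto
  have fC: "C1_map f" by (rule has_partials_C1_map[OF f(1) cf])
  have BC: "C1_map ?B" by (intro C1_map_intros fC f)
  have Bc: "continuous_on UNIV (\<lambda>q. area (?B q))"
    by (rule continuous_on_compose2[OF continuous_area C1_map_continuous[OF BC]]) auto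
  \<comment> \<open>A polynomial in the coordinates that is positive exactly on the ball of radius
    \<open>R\<close>; the norm itself would not be differentiable at the origin.\<close>
  define u where "u q = 1 - (norm q / R)\<^sup>2" for q :: "real \<times> real"
  have u_alt: "u q = 1 - ((fst q)\<^sup>2 + (snd q)\<^sup>2) * inverse (R\<^sup>2)" for q
    by (cases q) (simp add: u_def norm_Pair power_divide divide_inverse power_mult_distrib power_inverse)
  \<comment> \<open>Zero where \<open>u \<le> 1 / (n + 1)\<close> and one where
    \<open>u \<ge> 2 / (n + 1)\<close>, so the cut-offs converge pointwise to the indicator of the
    ball.\<close>
  define cut where "cut n q = smooth_step (real (Suc n) * u q - 1)" for n q
  \<comment> \<open>The normal \<open>(-1, w) / area w\<close> is extended constantly along the
    \<open>X1\<close> lines; the transversal factor \<open>bump\<close> equals one on the graph and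
    confines the support to distance one from it.\<close>
  define \<zeta> where "\<zeta> n p = (- cut n (char_proj p) * bump (fst p - f (char_proj p)) * inverse (area (?B (char_proj p))),
     cut n (char_proj p) * bump (fst p - f (char_proj p)) * ?B (char_proj p) * inverse (area (?B (char_proj p))))" for n p
  have cutC: "C1_map (cut n)" for n
    unfolding cut_def smooth_step_def u_alt by (intro C1_map_intros C1_map_pos_sq)
  note comp = C1_map_compose[OF _ C1_map_char_proj]
  have \<zeta>C: "C1_map (\<zeta> n)" for n
    unfolding \<zeta>_def bump_def
    by (intro C1_map_Pair C1_map_mult C1_map_minus C1_map_diff C1_map_const C1_map_power C1_map_pos_sq
        comp[OF cutC] comp[OF fC] comp[OF BC] C1_map_fst C1_map_ident C1_map_area_inverse)
  have cut01: "0 \<le> cut n q" "cut n q \<le> 1" for n q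
    unfolding cut_def by (rule smooth_step_props)+
  have \<zeta>1: "norm (\<zeta> n p) \<le> 1" for n p
  proof -
    let ?b = "?B (char_proj p)"
    let ?c = "cut n (char_proj p) * bump (fst p - f (char_proj p))"
    have "\<zeta> n p = (?c * inverse (area ?b)) *\<^sub>R (-1, ?b)" by (simp add: \<zeta>_def)
    then have "norm (\<zeta> n p) = \<bar>?c * inverse (area ?b)\<bar> * norm (-1::real, ?b)" by (simp only: norm_scaleR)
    also have "norm (-1::real, ?b) = area ?b" by (simp add: norm_Pair area_def)
    also have "\<bar>?c * inverse (area ?b)\<bar> * area ?b = \<bar>?c\<bar>"
      using area_pos[of ?b] by (simp add: abs_mult)
    also have "\<dots> \<le> 1" using cut01[of n "char_proj p"] bump_props(1,2)[of "fst p - f (char_proj p)"]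
      by (simp add: abs_mult mult_le_one)
    finally show ?thesis .
  qed
  \<comment> \<open>The radius at which \<open>u = 1 / (n + 1)\<close>, beyond which the cut-off
    vanishes.\<close>
  define R' where "R' n = R * sqrt (1 - 1 / real (Suc n))" for n
  have R': "R' n < R" for n
    unfolding R'_def using R by (simp add: field_simps)
  have cut0: "norm q \<le> R' n" if "cut n q \<noteq> 0" for n q
  proof -
    have "0 < real (Suc n) * u q - 1"
      using that smooth_step_props(3)[of "real (Suc n) * u q - 1"] unfolding cut_def by (meson not_less)
    then have "1 / real (Suc n) < u q" by (simp add: field_simps del: of_nat_Suc)
    then have "(norm q / R)\<^sup>2 < 1 - 1 / real (Suc n)" unfolding u_def by linarith
    then have "norm q / R < sqrt (1 - 1 / real (Suc n))" by (rule real_less_rsqrt)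
    then show ?thesis unfolding R'_def using R by (simp add: field_simps)
  qed
  have supp: "{p. \<zeta> n p \<noteq> 0} \<subseteq> closed_cylinder M' (R' n)" for n
  proof
    fix p assume "p \<in> {p. \<zeta> n p \<noteq> 0}"
    then have 1: "cut n (char_proj p) \<noteq> 0" and 2: "bump (fst p - f (char_proj p)) \<noteq> 0"
      by (auto simp: \<zeta>_def zero_prod_def)
    have q: "norm (char_proj p) \<le> R' n" by (rule cut0[OF 1])
    then have "\<bar>f (char_proj p)\<bar> + 1 \<le> M'" using R'[of n] by (intro M) simp
    moreover have "\<bar>fst p - f (char_proj p)\<bar> < 1" using bump_props(4)[of "fst p - f (char_proj p)"] 2 by (meson not_less)
    ultimately show "p \<in> closed_cylinder M' (R' n)" using q by (simp add: closed_cylinder_def)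
  qed
  have csupp: "closure {p. \<zeta> n p \<noteq> 0} \<subseteq> closed_cylinder M' (R' n)" for n
    by (rule closure_minimal[OF supp compact_imp_closed[OF compact_closed_cylinder]])
  have comp: "compact (closure {p. \<zeta> n p \<noteq> 0})" for n
    unfolding compact_closure by (rule bounded_subset[OF compact_imp_bounded[OF compact_closed_cylinder] supp])
  have test: "\<zeta> n \<in> horizontal_test_fields (cylinder M R)" for n
    unfolding horizontal_test_fields_def
    using \<zeta>C \<zeta>1 comp csupp[of n] closed_cylinder_subset_cylinder[OF M(2) R'] by blast
  have val: "snd (\<zeta> n (graph_chart f (0, q))) * ?B q - fst (\<zeta> n (graph_chart f (0, q))) = cut n q * area (?B q)" for n q
  proof -
    have "snd (\<zeta> n (graph_chart f (0, q))) * ?B q - fst (\<zeta> n (graph_chart f (0, q))) =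
       cut n q * ((1 + (?B q)\<^sup>2) * inverse (area (?B q)))"
      by (simp add: \<zeta>_def char_proj_graph_chart bump_props(3) power2_eq_square algebra_simps)
    also have "(1 + (?B q)\<^sup>2) * inverse (area (?B q)) = area (?B q)"
      unfolding area_sq[symmetric] using area_pos[of "?B q"] by (simp add: power2_eq_square)
    finally show ?thesis .
  qed
  have le: "ereal (\<integral>q. cut n q * area (?B q) \<partial>lborel) \<le> H_perimeter (X1_subgraph f) (cylinder M R)" for n
    unfolding H_perimeter_def val[symmetric, of n] subgraph_divergence[OF f(1) cf \<zeta>C comp, symmetric]
    by (rule SUP_upper[OF test])
  have "(\<lambda>n. \<integral>q. cut n q * area (?B q) \<partial>lborel) \<longlonglongrightarrow> (\<integral>q. indicator (ball 0 R) q * area (?B q) \<partial>lborel)"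
  proof (rule integral_dominated_convergence)
    have mB: "(\<lambda>q. area (?B q)) \<in> borel_measurable borel" by (rule borel_measurable_continuous_onI[OF Bc])
    show "(\<lambda>q. indicator (ball 0 R) q * area (?B q)) \<in> borel_measurable lborel"
      using mB by (intro borel_measurable_times borel_measurable_indicator) simp_all
    have mc: "cut n \<in> borel_measurable borel" for n
      by (rule borel_measurable_continuous_onI[OF C1_map_continuous[OF cutC]])
    show "(\<lambda>q. cut n q * area (?B q)) \<in> borel_measurable lborel" for n
      using mB mc by (intro borel_measurable_times) simp_all
    show "integrable lborel (\<lambda>q. indicator (ball 0 R) q * area (?B q))"
      by (rule integrable_on_ball[OF Bc])
    have z: "cut n q = 0" if "q \<notin> ball 0 R" for n q
      using cut0[of n q] R'[of n] that by force
    show "AE q in lborel. norm (cut n q * area (?B q)) \<le> indicator (ball 0 R) q * area (?B q)" for n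
    proof (rule AE_I2)
      fix q
      show "norm (cut n q * area (?B q)) \<le> indicator (ball 0 R) q * area (?B q)"
        using cut01[of n q] z[of q n] area_pos[of "?B q"] by (auto simp: indicator_def abs_mult)
    qed
    show "AE q in lborel. (\<lambda>n. cut n q * area (?B q)) \<longlonglongrightarrow> indicator (ball 0 R) q * area (?B q)"
    proof (rule AE_I2)
      fix q :: "real \<times> real"
      show "(\<lambda>n. cut n q * area (?B q)) \<longlonglongrightarrow> indicator (ball 0 R) q * area (?B q)"
      proof (cases "q \<in> ball 0 R")
        case False
        then show ?thesis by (simp add: z)
      next
        case q: True
      then have "norm q / R < 1" using R by simp
      then have "(norm q / R)\<^sup>2 < 1" using R by (subst abs_square_less_1) simp
      then have "u q > 0" unfolding u_def by simp
      then obtain N where N: "2 < real N * u q" using reals_Archimedean3 by blast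
      have "eventually (\<lambda>n. cut n q * area (?B q) = area (?B q)) sequentially"
      proof (rule eventually_sequentiallyI[of N])
        fix n assume "N \<le> n"
        then have "real N * u q \<le> real (Suc n) * u q"
          using \<open>u q > 0\<close> by (intro mult_right_mono) auto
        then have "cut n q = 1" unfolding cut_def using N by (intro smooth_step_props(4)) linarith
        then show "cut n q * area (?B q) = area (?B q)" by simp
      qed
      then show ?thesis
        using q by (auto intro: tendsto_eventually)
      qed
    qed
  qed
  then have "(\<lambda>n. ereal (\<integral>q. cut n q * area (?B q) \<partial>lborel)) \<longlonglongrightarrow> ereal (\<integral>q. indicator (ball 0 R) q * area (?B q) \<partial>lborel)"
    by (rule tendsto_ereal)
  then show ?thesis by (rule LIMSEQ_le_const2) (use le in blast)
qed

text \<open>The lower bound is applied to \<open>f\<close> and the upper bound to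
  \<open>f + g\<close>, hence the different regularity asked of the two functions.\<close>

lemma minimizer_area_le:
  assumes f: "has_partials f f1 f2" "C1_map f1" "C1_map f2"
    and min: "H_perimeter_minimizer (X1_subgraph f)"
    and g: "has_partials g g1 g2" "continuous_on UNIV g1" "continuous_on UNIV g2"
    and R: "0 < R" "R' < R" and gs: "\<And>q. norm q > R' \<Longrightarrow> g q = 0" and g1: "\<And>q. \<bar>g q\<bar> \<le> 1"
  shows "(\<integral>q. indicator (ball 0 R) q * area (f1 q - 4 * f q * f2 q) \<partial>lborel) \<le>
    (\<integral>q. indicator (ball 0 R) q * area (f1 q + g1 q - 4 * (f q + g q) * (f2 q + g2 q)) \<partial>lborel)"
proof -
  have cf: "continuous_on UNIV f1" "continuous_on UNIV f2" using f C1_map_continuous by auto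
  have fc: "continuous_on UNIV f" by (rule has_partials_continuous[OF f(1)])
  note h = has_partials_add[OF f(1) g(1)]
  have hc: "continuous_on UNIV (\<lambda>q. f q + g q)" by (rule has_partials_continuous[OF h])
  have "compact (f ` cball 0 R)"
    using fc by (intro compact_continuous_image) (auto intro: continuous_on_subset)
  then obtain M0 where M0: "\<And>q. q \<in> cball 0 R \<Longrightarrow> \<bar>f q\<bar> \<le> M0"
    using compact_imp_bounded bounded_iff by (metis imageI real_norm_def)
  \<comment> \<open>On the symmetric difference \<open>fst p\<close> lies between \<open>f\<close>
    and \<open>f + g\<close>, at distance at most 1 from \<open>f\<close>; the heights
    \<open>M0 + 1\<close> and \<open>M0 + 2\<close> therefore make it relatively compact in the open
    cylinder.\<close>
  let ?E = "X1_subgraph f" and ?F = "X1_subgraph (\<lambda>q. f q + g q)" and ?U = "cylinder (M0 + 2) R"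
  have sub: "sym_diff ?E ?F \<subseteq> closed_cylinder (M0 + 1) R'"
  proof
    fix p assume p: "p \<in> sym_diff ?E ?F"
    then have "g (char_proj p) \<noteq> 0" unfolding X1_subgraph_char_proj by auto
    then have n: "norm (char_proj p) \<le> R'" using gs[of "char_proj p"] by (meson not_less)
    then have "\<bar>f (char_proj p)\<bar> \<le> M0" using R by (intro M0) simp
    moreover have "\<bar>fst p - f (char_proj p)\<bar> \<le> \<bar>g (char_proj p)\<bar>"
      using p unfolding X1_subgraph_char_proj by auto
    ultimately have "\<bar>fst p\<bar> \<le> M0 + 1" using g1[of "char_proj p"] by linarith
    then show "p \<in> closed_cylinder (M0 + 1) R'" using n by (simp add: closed_cylinder_def)
  qed
  have minD: "H_perimeter ?E \<Omega> \<le> H_perimeter F \<Omega>"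
    if "open \<Omega>" "bounded \<Omega>" "F \<in> sets lebesgue" "compact (closure (sym_diff ?E F))"
      "closure (sym_diff ?E F) \<subseteq> \<Omega>" for \<Omega> F
    using min that unfolding H_perimeter_minimizer_def by simp
  have le: "H_perimeter ?E ?U \<le> H_perimeter ?F ?U"
  proof (rule minD[OF open_cylinder bounded_cylinder])
    show "?F \<in> sets lebesgue" using open_X1_subgraph[OF hc] by simp
    show "compact (closure (sym_diff ?E ?F))"
      unfolding compact_closure by (rule bounded_subset[OF compact_imp_bounded[OF compact_closed_cylinder] sub])
    have "closure (sym_diff ?E ?F) \<subseteq> closed_cylinder (M0 + 1) R'"
      by (rule closure_minimal[OF sub compact_imp_closed[OF compact_closed_cylinder]])
    also have "\<dots> \<subseteq> ?U" using R by (intro closed_cylinder_subset_cylinder) auto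
    finally show "closure (sym_diff ?E ?F) \<subseteq> ?U" .
  qed
  have "ereal (\<integral>q. indicator (ball 0 R) q * area (f1 q - 4 * f q * f2 q) \<partial>lborel) \<le> H_perimeter ?E ?U"
    by (rule H_perimeter_subgraph_ge[OF f R(1), of "M0 + 1"]) (use M0 in force)+
  also note le
  also have "H_perimeter ?F ?U \<le> ereal (\<integral>q. indicator (ball 0 R) q *
       area (f1 q + g1 q - 4 * (f q + g q) * (f2 q + g2 q)) \<partial>lborel)"
    by (rule H_perimeter_subgraph_le[OF h]) (intro continuous_intros cf g)+
  finally show ?thesis by simp
qed

section \<open>First and second variation of the area\<close>

lemma area_slope_deriv: "((\<lambda>x. x / area x) has_real_derivative 1 / area x ^ 3) (at x)"
proof -
  have p: "area x > 0" by (rule area_pos)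
  have "((\<lambda>x. x / area x) has_real_derivative (1 * area x - x * (x / area x)) / (area x * area x)) (at x)"
    using p by (intro DERIV_divide DERIV_ident area_deriv) auto
  moreover have "(1 * area x - x * (x / area x)) / (area x * area x) = ((area x)\<^sup>2 - x\<^sup>2) / area x ^ 3"
    using p by (simp add: field_simps power2_eq_square power3_eq_cube)
  ultimately show ?thesis by (simp add: area_sq)
qed

text \<open>The third derivative of \<open>area\<close> is \<open>- 3 * t / area t ^ 5\<close>, of
  absolute value at most 3 because \<open>\<bar>t\<bar> \<le> area t\<close>. Division by
  \<open>3!\<close> gives the factor 1/2, uniformly in \<open>w\<close>.\<close>

lemma area_taylor:
  "area (w + x) \<le> area w + w / area w * x + x\<^sup>2 / (2 * area w ^ 3) + \<bar>x\<bar> ^ 3 / 2"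
proof (cases "x = 0")
  case False
  define D :: "nat \<Rightarrow> real \<Rightarrow> real" where "D m = (if m = 0 then area else if m = 1 then (\<lambda>x. x / area x)
     else if m = 2 then (\<lambda>x. 1 / area x ^ 3) else (\<lambda>x. - (3 * x / area x ^ 5)))" for m
  have d2: "((\<lambda>x. 1 / area x ^ 3) has_real_derivative - (3 * t / area t ^ 5)) (at t)" for t
    using area_pos[of t]
    by (auto intro!: derivative_eq_intros area_deriv simp: field_simps eval_nat_numeral)
  have "\<forall>m t. m < 3 \<and> min w (w + x) \<le> t \<and> t \<le> max w (w + x) \<longrightarrow> (D m has_real_derivative D (Suc m) t) (at t)"
  proof (intro allI impI)
    fix m :: nat and t assume "m < 3 \<and> min w (w + x) \<le> t \<and> t \<le> max w (w + x)"
    then consider "m = 0" | "m = 1" | "m = 2" by linarith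
    then show "(D m has_real_derivative D (Suc m) t) (at t)"
      by cases (auto simp: D_def area_deriv area_slope_deriv d2)
  qed
  then obtain t where "area (w + x) = (\<Sum>m<3. D m w / fact m * (w + x - w) ^ m) + D 3 t / fact 3 * (w + x - w) ^ 3"
    using Taylor[of 3 D area "min w (w + x)" "max w (w + x)" w "w + x"] False
    by (auto simp: D_def)
  then have eq: "area (w + x) = area w + w / area w * x + x\<^sup>2 / (2 * area w ^ 3) - t / (2 * area t ^ 5) * x ^ 3"
    by (simp add: D_def eval_nat_numeral field_simps)
  have "\<bar>t\<bar> \<le> area t" unfolding area_def by (rule real_le_rsqrt) simp
  also have "\<dots> \<le> area t ^ 5" using area_ge_1[of t] by (rule self_le_power) simp
  finally have "\<bar>t\<bar> / (2 * area t ^ 5) \<le> 1 / 2" using area_pos[of t] by (simp add: field_simps)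
  then have "\<bar>t\<bar> / (2 * area t ^ 5) * \<bar>x\<bar> ^ 3 \<le> 1 / 2 * \<bar>x\<bar> ^ 3" by (rule mult_right_mono) simp
  moreover have "\<bar>t / (2 * area t ^ 5) * x ^ 3\<bar> = \<bar>t\<bar> / (2 * area t ^ 5) * \<bar>x\<bar> ^ 3"
    using area_pos[of t] by (simp add: abs_mult power_abs)
  ultimately have "- (t / (2 * area t ^ 5) * x ^ 3) \<le> \<bar>x\<bar> ^ 3 / 2" by linarith
  then show ?thesis unfolding eq by linarith
qed simp

text \<open>The increment \<open>e * l + e^2 * n\<close> is inserted into the Taylor bound and
  sorted by powers of \<open>e\<close>. What exceeds second order is at least cubic, and
  \<open>\<bar>e\<bar> \<le> 1\<close> reduces it to \<open>\<bar>e\<bar> ^ 3\<close> times an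
  expression free of \<open>w\<close>.\<close>

lemma area_quadratic_bound:
  fixes w l n e :: real
  assumes e1: "\<bar>e\<bar> \<le> 1"
  shows "area (w + (e * l + e\<^sup>2 * n)) \<le> area w + e * (w / area w * l) +
    e\<^sup>2 * (w / area w * n + l\<^sup>2 / (2 * area w ^ 3)) + \<bar>e\<bar> ^ 3 * (\<bar>l * n\<bar> + n\<^sup>2 + (\<bar>l\<bar> + \<bar>n\<bar>) ^ 3)"
proof -
  define x where "x = e * l + e\<^sup>2 * n"
  have e2: "e\<^sup>2 \<le> \<bar>e\<bar>" using mult_right_mono[OF e1, of "\<bar>e\<bar>"] by (simp add: power2_eq_square abs_mult_self_eq)
    have "\<bar>x\<bar> \<le> \<bar>e\<bar> * \<bar>l\<bar> + e\<^sup>2 * \<bar>n\<bar>"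
      unfolding x_def by (rule order_trans[OF abs_triangle_ineq]) (simp add: abs_mult)
    also have "\<dots> \<le> \<bar>e\<bar> * \<bar>l\<bar> + \<bar>e\<bar> * \<bar>n\<bar>" using e2 by (intro add_mono mult_right_mono) auto
    finally have "\<bar>x\<bar> \<le> \<bar>e\<bar> * (\<bar>l\<bar> + \<bar>n\<bar>)" by (simp add: algebra_simps)
    then have x3: "\<bar>x\<bar> ^ 3 \<le> \<bar>e\<bar> ^ 3 * (\<bar>l\<bar> + \<bar>n\<bar>) ^ 3"
      unfolding power_mult_distrib[symmetric] by (rule power_mono) simp
    have a1: "1 / (2 * area (w) ^ 3) \<le> 1" "0 \<le> 1 / (2 * area (w) ^ 3)"
      using one_le_power[OF area_ge_1[of "w"], of 3] area_pos[of "w"] by (auto simp: divide_le_eq)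
    have "\<bar>2 * e ^ 3 * (l * n) + e ^ 4 * (n)\<^sup>2\<bar> \<le> 2 * \<bar>e\<bar> ^ 3 * \<bar>l * n\<bar> + \<bar>e\<bar> ^ 3 * (n)\<^sup>2"
    proof (rule order_trans[OF abs_triangle_ineq add_mono])
      show "\<bar>2 * e ^ 3 * (l * n)\<bar> \<le> 2 * \<bar>e\<bar> ^ 3 * \<bar>l * n\<bar>"
        by (simp add: abs_mult power_abs)
      have "\<bar>e\<bar> ^ 4 \<le> \<bar>e\<bar> ^ 3" by (rule power_decreasing) (use e1 in auto)
      then show "\<bar>e ^ 4 * (n)\<^sup>2\<bar> \<le> \<bar>e\<bar> ^ 3 * (n)\<^sup>2"
        by (simp add: abs_mult power_abs mult_right_mono)
    qed
    then have "(2 * e ^ 3 * (l * n) + e ^ 4 * (n)\<^sup>2) * (1 / (2 * area (w) ^ 3)) \<le>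
        (2 * \<bar>e\<bar> ^ 3 * \<bar>l * n\<bar> + \<bar>e\<bar> ^ 3 * (n)\<^sup>2) * (1 / (2 * area (w) ^ 3))"
      using a1 by (intro mult_right_mono) auto
    also have "\<dots> \<le> \<bar>e\<bar> ^ 3 * \<bar>l * n\<bar> + \<bar>e\<bar> ^ 3 * (n)\<^sup>2"
    proof -
      have "2 * \<bar>e\<bar> ^ 3 * \<bar>l * n\<bar> * (1 / (2 * area (w) ^ 3)) \<le> 2 * \<bar>e\<bar> ^ 3 * \<bar>l * n\<bar> * (1 / 2)"
        using one_le_power[OF area_ge_1[of "w"], of 3] area_pos[of "w"]
        by (intro mult_left_mono) (auto simp: divide_le_eq)
      moreover have "\<bar>e\<bar> ^ 3 * (n)\<^sup>2 * (1 / (2 * area (w) ^ 3)) \<le> \<bar>e\<bar> ^ 3 * (n)\<^sup>2 * 1"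
        using a1 by (intro mult_left_mono) auto
      ultimately show ?thesis by (simp add: algebra_simps)
    qed
    finally have t2: "(2 * e ^ 3 * (l * n) + e ^ 4 * (n)\<^sup>2) * (1 / (2 * area (w) ^ 3))
       \<le> \<bar>e\<bar> ^ 3 * \<bar>l * n\<bar> + \<bar>e\<bar> ^ 3 * (n)\<^sup>2" .
    have xx: "x\<^sup>2 = e\<^sup>2 * (l)\<^sup>2 + (2 * e ^ 3 * (l * n) + e ^ 4 * (n)\<^sup>2)"
      unfolding x_def by (simp add: power2_eq_square power3_eq_cube power4_eq_xxxx algebra_simps)
  have "\<bar>x\<bar> ^ 3 / 2 \<le> \<bar>e\<bar> ^ 3 * (\<bar>l\<bar> + \<bar>n\<bar>) ^ 3"
    using x3 zero_le_power[OF abs_ge_zero, of x 3] by linarith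
  moreover have "x\<^sup>2 / (2 * area w ^ 3) = e\<^sup>2 * (l\<^sup>2 / (2 * area w ^ 3)) +
      (2 * e ^ 3 * (l * n) + e ^ 4 * n\<^sup>2) * (1 / (2 * area w ^ 3))"
    unfolding xx by (simp add: add_divide_distrib)
  moreover have "w / area w * x = e * (w / area w * l) + e\<^sup>2 * (w / area w * n)"
    by (simp add: x_def algebra_simps)
  ultimately show ?thesis
    using area_taylor[of w x] t2 unfolding x_def[symmetric] distrib_left by linarith
qed

text \<open>Dividing by \<open>\<bar>e\<bar>\<close> for both signs of \<open>e\<close> and letting
  \<open>e\<close> tend to 0 forces \<open>A = 0\<close>; after that, dividing by \<open>e^2\<close>
  gives the sign of \<open>B\<close>.\<close>

lemma cubic_bound_coeffs:
  fixes A B C e0 :: real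
  assumes e0: "0 < e0" and ineq: "\<And>e. \<bar>e\<bar> \<le> e0 \<Longrightarrow> 0 \<le> e * A + e\<^sup>2 * B + \<bar>e\<bar> ^ 3 * C"
  shows "A = 0" "0 \<le> B"
proof -
  have ev: "eventually (\<lambda>e. 0 < e \<and> e \<le> e0) (at_right 0)"
    using eventually_at_right_less[of 0] eventually_at_right_real[OF e0] by eventually_elim auto
  have "0 \<le> A"
  proof (rule tendsto_lowerbound)
    show "((\<lambda>e. A + e * B + e\<^sup>2 * C) \<longlongrightarrow> A) (at_right 0)" by (auto intro!: tendsto_eq_intros)
    show "eventually (\<lambda>e. 0 \<le> A + e * B + e\<^sup>2 * C) (at_right 0)"
      using ev
    proof eventually_elim
      case (elim e)
      with ineq[of e] have "0 \<le> e * (A + e * B + e\<^sup>2 * C)"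
        by (simp add: algebra_simps power2_eq_square power3_eq_cube)
      then show ?case using elim by (simp add: zero_le_mult_iff)
    qed
  qed simp
  moreover have "0 \<le> - A"
  proof (rule tendsto_lowerbound)
    show "((\<lambda>e. - A + e * B + e\<^sup>2 * C) \<longlongrightarrow> - A) (at_right 0)" by (auto intro!: tendsto_eq_intros)
    show "eventually (\<lambda>e. 0 \<le> - A + e * B + e\<^sup>2 * C) (at_right 0)"
      using ev
    proof eventually_elim
      case (elim e)
      with ineq[of "- e"] have "0 \<le> e * (- A + e * B + e\<^sup>2 * C)"
        by (simp add: algebra_simps power2_eq_square power3_eq_cube)
      then show ?case using elim by (simp add: zero_le_mult_iff)
    qed
  qed simp
  ultimately show A: "A = 0" by simp
  show "0 \<le> B"
  proof (rule tendsto_lowerbound)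
    show "((\<lambda>e. B + e * C) \<longlongrightarrow> B) (at_right 0)" by (auto intro!: tendsto_eq_intros)
    show "eventually (\<lambda>e. 0 \<le> B + e * C) (at_right 0)"
      using ev
    proof eventually_elim
      case (elim e)
      with ineq[of e] A have "0 \<le> e\<^sup>2 * (B + e * C)"
        by (simp add: algebra_simps power2_eq_square power3_eq_cube)
      then show ?case using elim by (simp add: zero_le_mult_iff)
    qed
  qed simp
qed

lemma continuous_nonneg_integral_zero:
  fixes h :: "'a::euclidean_space \<Rightarrow> real"
  assumes h: "continuous_on UNIV h" "integrable lborel h" "\<And>x. 0 \<le> h x" and z: "integral\<^sup>L lborel h = 0"
  shows "h x = 0"
proof (rule ccontr)
  assume "h x \<noteq> 0"
  have "AE x in lborel. h x = 0"
    using integral_nonneg_eq_0_iff_AE[OF h(2)] h(3) z by auto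
  then have ae: "AE x in lebesgue. h x = 0" by (rule AE_completion)
  have op: "open {x. h x \<noteq> 0}" using h(1) by (intro open_Collect_neq continuous_intros)
  then have "{x. h x \<noteq> 0} \<in> null_sets lebesgue"
    using ae by (subst AE_iff_null_sets) auto
  then have "negligible {x. h x \<noteq> 0}" by (simp add: negligible_iff_null_sets)
  then show False using open_not_negligible[OF op] \<open>h x \<noteq> 0\<close> by blast
qed

lemma has_partials_affine: "has_partials (\<lambda>q. a * fst q + b * snd q + c) (\<lambda>_. a) (\<lambda>_. b)"
  unfolding has_partials_def by (auto intro!: derivative_eq_intros simp: algebra_simps)

lemma has_partials_zero_off_closed:
  assumes F: "has_partials F F1 F2" and K: "closed K" "\<And>q. q \<notin> K \<Longrightarrow> F q = 0" and q: "q \<notin> K"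
  shows "F1 q = 0" "F2 q = 0"
proof -
  obtain a b where [simp]: "q = (a, b)" by (cases q)
  show "F1 q = 0"
    using deriv_zero_off_closed[where k = F and p = "\<lambda>s. (s, b)" and s = a, OF K _ _ has_partials_fst[OF F]] q
    by (auto intro!: continuous_intros)
  show "F2 q = 0"
    using deriv_zero_off_closed[where k = F and p = "\<lambda>s. (a, s)" and s = b, OF K _ _ has_partials_snd[OF F]] q
    by (auto intro!: continuous_intros)
qed

section \<open>Variational inequalities of a minimizing graph\<close>

text \<open>For a C^2 function \<open>f\<close>, the quantity \<open>w\<close> is a polynomial in
  the C^1 functions \<open>f\<close>, \<open>f1\<close>, \<open>f2\<close>; its gradient is thus
  available, and no third derivative of \<open>f\<close> is ever taken.\<close>

locale minimizing_graph =
  fixes f f1 f2 w w1 w2 :: "real \<times> real \<Rightarrow> real"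
  assumes f: "has_partials f f1 f2" "C1_map f1" "C1_map f2"
    and w_eq: "\<And>q. w q = f1 q - 4 * f q * f2 q"
    and w: "has_partials w w1 w2" "continuous_on UNIV w1" "continuous_on UNIV w2"
    and min: "H_perimeter_minimizer (X1_subgraph f)"
begin

lemma continuous_data:
  "continuous_on S f" "continuous_on S f1" "continuous_on S f2"
  "continuous_on S w" "continuous_on S w1" "continuous_on S w2" "continuous_on S (\<lambda>q. area (w q))"
proof -
  show "continuous_on S f" by (rule has_partials_continuous[OF f(1)])
  show "continuous_on S f1" "continuous_on S f2" by (rule C1_map_continuous f)+
  show "continuous_on S w" by (rule has_partials_continuous[OF w(1)])
  then show "continuous_on S (\<lambda>q. area (w q))"
    by (rule continuous_on_compose2[OF continuous_area]) auto
  show "continuous_on S w1" "continuous_on S w2" using w(2,3) continuous_on_subset by blast+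
qed

lemma area_w_nonzero: "area (w q) \<noteq> 0"
  using area_pos[of "w q"] by simp

lemma has_partials_normal:
  "has_partials (\<lambda>q. w q / area (w q)) (\<lambda>q. w1 q / area (w q) ^ 3) (\<lambda>q. w2 q / area (w q) ^ 3)"
  using has_partials_compose[OF w(1) area_slope_deriv] by simp

context
  fixes g g1 g2 :: "real \<times> real \<Rightarrow> real" and R :: real
  assumes g: "has_partials g g1 g2" "continuous_on UNIV g1" "continuous_on UNIV g2"
    and gs: "\<And>q. norm q > R \<Longrightarrow> g q = 0" and R: "0 < R"
begin

lemma test_partials_zero: "norm q > R \<Longrightarrow> g1 q = 0" "norm q > R \<Longrightarrow> g2 q = 0"
  using has_partials_zero_off_closed[OF g(1) closed_cball[of 0 R]] gs by auto

lemma continuous_test: "continuous_on UNIV g" "continuous_on UNIV g1" "continuous_on UNIV g2"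
  using has_partials_continuous[OF g(1)] g by auto

lemma integrable_cball_support:
  assumes "continuous_on UNIV (h :: real \<times> real \<Rightarrow> real)" "\<And>q. norm q > R \<Longrightarrow> h q = 0"
  shows "integrable lborel h"
  by (rule integrable_continuous_compact_support[OF assms(1) compact_cball[of 0 R]]) (use assms(2) in auto)

text \<open>The linearization of \<open>w\<close> in direction \<open>g\<close>; in divergence form
  it is \<open>g1\<close> minus four times the \<open>\<tau>\<close>-derivative of
  \<open>f * g\<close>.\<close>

abbreviation "L q \<equiv> g1 q - 4 * f q * g2 q - 4 * f2 q * g q"

text \<open>The perturbed \<open>w\<close> is exactly \<open>w + e * L + e^2 * N\<close>. The
  pointwise quadratic bound for \<open>area\<close> integrates to a polynomial inequality in
  \<open>e\<close> with cubic error, so differentiation under the integral is avoided.\<close>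

lemma variations:
  "(\<integral>q. w q / area (w q) * L q \<partial>lborel) = 0"
  "0 \<le> (\<integral>q. w q / area (w q) * (- 4 * g q * g2 q) + (L q)\<^sup>2 / (2 * area (w q) ^ 3) \<partial>lborel)"
proof -
  note cont = continuous_intros continuous_data continuous_test
  define N where "N q = - 4 * g q * g2 q" for q
  define A where "A q = w q / area (w q) * L q" for q
  define B where "B q = w q / area (w q) * N q + (L q)\<^sup>2 / (2 * area (w q) ^ 3)" for q
  define C where "C q = \<bar>L q * N q\<bar> + (N q)\<^sup>2 + (\<bar>L q\<bar> + \<bar>N q\<bar>) ^ 3" for q
  have cA: "continuous_on UNIV A" "continuous_on UNIV B" "continuous_on UNIV C"
    unfolding A_def B_def C_def N_def by (intro cont ballI; simp add: area_w_nonzero)+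
  have sA: "A q = 0" "B q = 0" "C q = 0" if "norm q > R" for q
    using gs[OF that] test_partials_zero[OF that] by (simp_all add: A_def B_def C_def N_def)
  have int: "integrable lborel A" "integrable lborel B" "integrable lborel C"
    by (rule integrable_cball_support; use cA sA in blast)+
  \<comment> \<open>A ball strictly larger than the support of \<open>g\<close>, as minimality is
    tested on a neighbourhood of that support.\<close>
  let ?D = "ball 0 (R + 1) :: (real \<times> real) set"
  have ind: "indicator ?D q * A q = A q" "indicator ?D q * B q = B q" "indicator ?D q * C q = C q" for q
    using sA[of q] by (auto simp: indicator_def)
  have "compact (g ` cball 0 R)"
    using continuous_test by (intro compact_continuous_image) (auto intro: continuous_on_subset)
  then obtain G where G0: "\<And>q. q \<in> cball 0 R \<Longrightarrow> \<bar>g q\<bar> \<le> G"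
    using compact_imp_bounded bounded_iff by (metis imageI real_norm_def)
  have Gp: "0 \<le> G" using G0[of 0] R by auto
  have G: "\<bar>g q\<bar> \<le> G" for q
    using G0[of q] gs[of q] Gp by (cases "norm q \<le> R") auto
  \<comment> \<open>Small enough for \<open>\<bar>e * g\<bar> \<le> 1\<close> everywhere, the size
    limit of \<open>minimizer_area_le\<close>, and for \<open>\<bar>e\<bar> \<le> 1\<close>.\<close>
  define e0 where "e0 = 1 / (G + 1)"
  have e0: "0 < e0" "e0 \<le> 1" using Gp by (auto simp: e0_def)
  have "0 \<le> e * integral\<^sup>L lborel A + e\<^sup>2 * integral\<^sup>L lborel B + \<bar>e\<bar> ^ 3 * integral\<^sup>L lborel C"
    if e: "\<bar>e\<bar> \<le> e0" for e
  proof -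
    have eg: "\<bar>e * g q\<bar> \<le> 1" for q
    proof -
      have "\<bar>e * g q\<bar> \<le> e0 * G" unfolding abs_mult using e G by (intro mult_mono) auto
      also have "\<dots> \<le> 1" using Gp by (simp add: e0_def field_simps)
      finally show ?thesis .
    qed
    have "(\<integral>q. indicator ?D q * area (f1 q - 4 * f q * f2 q) \<partial>lborel) \<le>
      (\<integral>q. indicator ?D q * area (f1 q + e * g1 q - 4 * (f q + e * g q) * (f2 q + e * g2 q)) \<partial>lborel)"
      by (rule minimizer_area_le[OF f min has_partials_cmult[OF g(1)], where R' = R])
         (use R gs eg in \<open>auto intro!: cont\<close>)
    also have "\<dots> \<le> (\<integral>q. indicator ?D q * (area (w q) + e * A q + e\<^sup>2 * B q + \<bar>e\<bar> ^ 3 * C q) \<partial>lborel)"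
    proof (rule integral_mono[OF integrable_on_ball integrable_on_ball])
      show "continuous_on UNIV (\<lambda>q. area (f1 q + e * g1 q - 4 * (f q + e * g q) * (f2 q + e * g2 q)))"
        by (rule continuous_on_compose2[OF continuous_area[of UNIV]]) (auto intro!: cont)
      show "continuous_on UNIV (\<lambda>q. area (w q) + e * A q + e\<^sup>2 * B q + \<bar>e\<bar> ^ 3 * C q)"
        by (intro cont cA)
      fix q :: "real \<times> real"
      define x where "x = e * L q + e\<^sup>2 * N q"
      have x: "f1 q + e * g1 q - 4 * (f q + e * g q) * (f2 q + e * g2 q) = w q + x"
        by (simp add: x_def w_eq N_def algebra_simps power2_eq_square)
      have "\<bar>e\<bar> \<le> 1" using e e0 by linarith
      from area_quadratic_bound[OF this, of "w q" "L q" "N q"]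
      have "area (w q + x) \<le> area (w q) + e * A q + e\<^sup>2 * B q + \<bar>e\<bar> ^ 3 * C q"
        unfolding x_def A_def B_def C_def .
      then show "indicator ?D q * area (f1 q + e * g1 q - 4 * (f q + e * g q) * (f2 q + e * g2 q))
         \<le> indicator ?D q * (area (w q) + e * A q + e\<^sup>2 * B q + \<bar>e\<bar> ^ 3 * C q)"
        unfolding x by (intro mult_left_mono) auto
    qed
    also have "\<dots> = (\<integral>q. indicator ?D q * area (w q) + (e * A q + e\<^sup>2 * B q + \<bar>e\<bar> ^ 3 * C q) \<partial>lborel)"
    proof (rule Bochner_Integration.integral_cong[OF refl])
      fix q
      have "indicator ?D q * (area (w q) + e * A q + e\<^sup>2 * B q + \<bar>e\<bar> ^ 3 * C q) =
         indicator ?D q * area (w q) + (e * (indicator ?D q * A q) + e\<^sup>2 * (indicator ?D q * B q) + \<bar>e\<bar> ^ 3 * (indicator ?D q * C q))"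
        by (simp add: algebra_simps)
      then show "indicator ?D q * (area (w q) + e * A q + e\<^sup>2 * B q + \<bar>e\<bar> ^ 3 * C q) =
         indicator ?D q * area (w q) + (e * A q + e\<^sup>2 * B q + \<bar>e\<bar> ^ 3 * C q)"
        unfolding ind .
    qed
    also have "\<dots> = (\<integral>q. indicator ?D q * area (w q) \<partial>lborel) +
       (e * integral\<^sup>L lborel A + e\<^sup>2 * integral\<^sup>L lborel B + \<bar>e\<bar> ^ 3 * integral\<^sup>L lborel C)"
      using int integrable_on_ball[OF continuous_data(7)] by simp
    finally show ?thesis by (simp add: w_eq)
  qed
  note cubic_bound_coeffs[OF e0(1) this]
  then show "(\<integral>q. w q / area (w q) * L q \<partial>lborel) = 0"
    "0 \<le> (\<integral>q. w q / area (w q) * (- 4 * g q * g2 q) + (L q)\<^sup>2 / (2 * area (w q) ^ 3) \<partial>lborel)"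
    by (simp_all add: A_def[abs_def] B_def[abs_def] N_def)
qed

text \<open>With \<open>G = w / area w\<close> one has
  \<open>G L = d_\<eta> (G g) - 4 d_\<tau> (G f g) - g (G1 - 4 f G2)\<close>, and the two
  derivatives integrate to zero, as does the left side by the first variation.\<close>

lemma weak_transport: "(\<integral>q. g q * ((w1 q - 4 * f q * w2 q) / area (w q) ^ 3) \<partial>lborel) = 0"
proof -
  note cont = continuous_intros continuous_data continuous_test
  define G where "G q = w q / area (w q)" for q
  define G1 where "G1 q = w1 q / area (w q) ^ 3" for q
  define G2 where "G2 q = w2 q / area (w q) ^ 3" for q
  have Gp: "has_partials G G1 G2" unfolding G_def[abs_def] G1_def[abs_def] G2_def[abs_def] by (rule has_partials_normal)
  have cG: "continuous_on UNIV G" "continuous_on UNIV G1" "continuous_on UNIV G2"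
    unfolding G_def G1_def G2_def by (intro cont ballI; simp add: area_w_nonzero)+
  define k1 where "k1 q = G1 q * g q + G q * g1 q" for q
  define k2 where "k2 q = (G2 q * f q + G q * f2 q) * g q + G q * f q * g2 q" for q
  have k1: "has_partials (\<lambda>q. G q * g q) k1 (\<lambda>q. G2 q * g q + G q * g2 q)"
    unfolding k1_def[abs_def] by (rule has_partials_mult[OF Gp g(1)])
  have k2: "has_partials (\<lambda>q. G q * f q * g q) (\<lambda>q. (G1 q * f q + G q * f1 q) * g q + G q * f q * g1 q) k2"
    unfolding k2_def[abs_def] by (rule has_partials_mult[OF has_partials_mult[OF Gp f(1)] g(1)])
  have c: "continuous_on UNIV k1" "continuous_on UNIV k2"
    unfolding k1_def k2_def by (intro cont cG)+
  have z1: "integral\<^sup>L lborel k1 = 0"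
    by (rule integral_deriv_fst(1)[OF has_partials_fst[OF k1] c(1) compact_cball[of 0 R]]) (simp add: gs)
  have z2: "integral\<^sup>L lborel k2 = 0"
    by (rule integral_deriv_snd[OF has_partials_snd[OF k2] c(2) compact_cball[of 0 R]]) (simp add: gs)
  have int: "integrable lborel k1" "integrable lborel k2" "integrable lborel (\<lambda>q. G q * L q)"
    by (rule integrable_cball_support; force intro!: cont cG c simp: k1_def k2_def gs test_partials_zero)+
  have "(\<integral>q. g q * ((w1 q - 4 * f q * w2 q) / area (w q) ^ 3) \<partial>lborel) = (\<integral>q. k1 q - 4 * k2 q - G q * L q \<partial>lborel)"
    by (rule Bochner_Integration.integral_cong) (simp_all add: k1_def k2_def G1_def G2_def algebra_simps diff_divide_distrib)
  also have "\<dots> = integral\<^sup>L lborel k1 - 4 * integral\<^sup>L lborel k2 - (\<integral>q. G q * L q \<partial>lborel)"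
    using int by simp
  also have "\<dots> = 0" using z1 z2 variations(1) by (simp add: G_def)
  finally show ?thesis .
qed

text \<open>The term \<open>- 4 * G * g * g2\<close> is \<open>- 2 * G\<close> times the
  \<open>\<tau>\<close>-derivative of \<open>g^2\<close>. Integration by parts turns it into
  \<open>2 * w2 * g^2 / area w ^ 3\<close>, which carries the same weight as
  \<open>L^2 / 2\<close>.\<close>

lemma stability: "0 \<le> (\<integral>q. ((L q)\<^sup>2 + 4 * w2 q * (g q)\<^sup>2) / area (w q) ^ 3 \<partial>lborel)"
proof -
  note cont = continuous_intros continuous_data continuous_test
  define G where "G q = w q / area (w q)" for q
  define G1 where "G1 q = w1 q / area (w q) ^ 3" for q
  define G2 where "G2 q = w2 q / area (w q) ^ 3" for q
  have Gp: "has_partials G G1 G2" unfolding G_def[abs_def] G1_def[abs_def] G2_def[abs_def] by (rule has_partials_normal)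
  have cG: "continuous_on UNIV G" "continuous_on UNIV G1" "continuous_on UNIV G2"
    unfolding G_def G1_def G2_def by (intro cont ballI; simp add: area_w_nonzero)+
  define k where "k q = G2 q * (g q * g q) + G q * (g2 q * g q + g q * g2 q)" for q
  have k: "has_partials (\<lambda>q. G q * (g q * g q)) (\<lambda>q. G1 q * (g q * g q) + G q * (g1 q * g q + g q * g1 q)) k"
    unfolding k_def[abs_def] by (rule has_partials_mult[OF Gp has_partials_mult[OF g(1) g(1)]])
  have c: "continuous_on UNIV k" unfolding k_def by (intro cont cG)
  have z: "integral\<^sup>L lborel k = 0"
    by (rule integral_deriv_snd[OF has_partials_snd[OF k] c compact_cball[of 0 R]]) (simp add: gs)
  have int: "integrable lborel k"
    by (rule integrable_cball_support) (use c in \<open>auto simp: k_def gs test_partials_zero\<close>)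
  define S where "S q = ((L q)\<^sup>2 + 4 * w2 q * (g q)\<^sup>2) / area (w q) ^ 3" for q
  have int2: "integrable lborel S"
    unfolding S_def
    by (rule integrable_cball_support) (intro cont ballI, simp add: area_w_nonzero, simp add: gs test_partials_zero)
  have "0 \<le> (\<integral>q. w q / area (w q) * (- 4 * g q * g2 q) + (L q)\<^sup>2 / (2 * area (w q) ^ 3) \<partial>lborel)"
    by (rule variations(2))
  also have "\<dots> = (\<integral>q. S q / 2 - 2 * k q \<partial>lborel)"
  proof (rule Bochner_Integration.integral_cong[OF refl])
    fix q
    define l where "l = L q"
    show "w q / area (w q) * (- 4 * g q * g2 q) + (L q)\<^sup>2 / (2 * area (w q) ^ 3) = S q / 2 - 2 * k q"
      unfolding S_def l_def[symmetric]
      by (simp add: k_def G_def G2_def algebra_simps add_divide_distrib power2_eq_square)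
  qed
  also have "\<dots> = (\<integral>q. S q \<partial>lborel) / 2"
    using int int2 z by simp
  finally show ?thesis by (simp add: S_def)
qed

end

text \<open>The fundamental lemma of the calculus of variations: a bump supported where
  \<open>K\<close> has the sign of \<open>K q\<close> contradicts the weak equation. Multiplying the
  integrand by \<open>K q\<close> treats both signs at once.\<close>

lemma transport: "w1 q = 4 * f q * w2 q"
proof (rule ccontr)
  assume ne: "w1 q \<noteq> 4 * f q * w2 q"
  define K where "K p = (w1 p - 4 * f p * w2 p) / area (w p) ^ 3" for p
  have cK: "continuous_on UNIV K"
    unfolding K_def by (intro continuous_intros continuous_data ballI) (simp add: area_w_nonzero)
  have Kq: "K q \<noteq> 0" using ne by (simp add: K_def area_w_nonzero)
  have "open {p. 0 < K q * K p}" by (intro open_Collect_less continuous_intros cK)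
  moreover have "q \<in> {p. 0 < K q * K p}" using Kq unfolding mem_Collect_eq zero_less_mult_iff by linarith
  ultimately obtain e where e: "e > 0" "ball q e \<subseteq> {p. 0 < K q * K p}" by (metis openE)
  \<comment> \<open>The square of half side \<open>e / 2\<close> lies in the ball, since the norm of
    a pair is at most the sum of the norms of its entries.\<close>
  define r where "r = e / 2"
  have r: "r > 0" using e by (simp add: r_def)
  \<comment> \<open>The arguments keep the affine normal form, zero coefficients included, so that
    the gradient of \<open>F\<close> follows from \<open>has_partials_affine\<close>.\<close>
  define F where "F p = bump (1 / r * fst p + 0 * snd p + - fst q / r) * bump (0 * fst p + 1 / r * snd p + - snd q / r)" for p
  have F: "F p = bump ((fst p - fst q) / r) * bump ((snd p - snd q) / r)" for p
    by (simp add: F_def diff_divide_distrib)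
  have Fs: "p \<in> ball q e" if "F p \<noteq> 0" for p
  proof -
    have nz: "bump ((fst p - fst q) / r) \<noteq> 0" "bump ((snd p - snd q) / r) \<noteq> 0"
      using that unfolding F by auto
    have "\<bar>(fst p - fst q) / r\<bar> < 1"
      using nz(1) bump_props(4)[of "(fst p - fst q) / r"] by (meson not_less)
    moreover have "\<bar>(snd p - snd q) / r\<bar> < 1"
      using nz(2) bump_props(4)[of "(snd p - snd q) / r"] by (meson not_less)
    ultimately have lt: "\<bar>fst p - fst q\<bar> < r" "\<bar>snd p - snd q\<bar> < r"
      using r by (simp_all add: abs_divide divide_less_eq)
    have "norm (p - q) = norm (fst p - fst q, snd p - snd q)"
      by (rule arg_cong[where f = norm]) (simp add: prod_eq_iff)
    also have "\<dots> \<le> norm (fst p - fst q) + norm (snd p - snd q)" by (rule norm_Pair_le)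
    also have "\<dots> < e" using lt by (simp add: r_def)
    finally show ?thesis by (simp add: dist_norm norm_minus_commute)
  qed
  note aff = has_partials_compose[OF has_partials_affine bump_deriv]
  note Fp = has_partials_mult[OF aff[of "1 / r" 0 "- fst q / r"] aff[of 0 "1 / r" "- snd q / r"], folded F_def]
  have Fc: "continuous_on UNIV F" by (rule has_partials_continuous[OF Fp])
  have supp: "F p = 0" if "norm p > norm q + e" for p
  proof (rule ccontr)
    assume "F p \<noteq> 0"
    then have "norm (q - p) < e" using Fs by (auto simp: dist_norm)
    then show False using that norm_triangle_ineq2[of p q] by (simp add: norm_minus_commute)
  qed
  have "(\<integral>p. F p * K p \<partial>lborel) = 0"
    unfolding K_def
  proof (rule weak_transport[OF Fp _ _ supp])
    show "0 < norm q + e" using e by (intro add_nonneg_pos) auto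
  qed (use r in \<open>auto intro!: continuous_intros continuous_on_compose2[OF continuous_bump(1)]
      continuous_on_compose2[OF continuous_bump(2)]\<close>)
  then have "(\<integral>p. K q * (F p * K p) \<partial>lborel) = 0" by simp
  moreover have "0 \<le> K q * (F p * K p)" for p
  proof (cases "F p = 0")
    case False
    then have "0 < K q * K p" using Fs e(2) by blast
    moreover have "0 \<le> F p" unfolding F using bump_props(1) by simp
    ultimately have "0 \<le> F p * (K q * K p)" by simp
    then show ?thesis by (simp add: mult_ac)
  qed simp
  moreover have c: "continuous_on UNIV (\<lambda>p. K q * (F p * K p))" by (intro continuous_intros cK Fc)
  moreover have "integrable lborel (\<lambda>p. K q * (F p * K p))"
    by (rule integrable_continuous_compact_support[OF c compact_cball[of 0 "norm q + e"]]) (simp add: supp)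
  ultimately have "K q * (F q * K q) = 0" by (intro continuous_nonneg_integral_zero[of "\<lambda>p. K q * (F p * K p)"]) 
  then show False using Kq by (simp add: F bump_props)
qed

end

section \<open>Blow-up of the stability inequality along a characteristic\<close>

text \<open>On the interval between \<open>- \<bar>t\<bar>\<close> and \<open>\<bar>t\<bar>\<close>
  the rate is bounded by a constant \<open>B\<close>; then \<open>N s * exp (- B * s)\<close>
  decreases forwards from 0 and \<open>N s * exp (B * s)\<close> decreases when followed
  backwards.\<close>

lemma gronwall_zero:
  fixes N N' C :: "real \<Rightarrow> real"
  assumes N: "\<And>s. (N has_real_derivative N' s) (at s)" and le: "\<And>s. \<bar>N' s\<bar> \<le> C s * N s"
    and C: "continuous_on UNIV C" and pos: "\<And>s. 0 \<le> N s" and z: "N 0 = 0"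
  shows "N t = 0"
proof -
  have "compact (C ` {-\<bar>t\<bar>..\<bar>t\<bar>})"
    using C by (intro compact_continuous_image) (auto intro: continuous_on_subset)
  then obtain B where "\<forall>x \<in> C ` {-\<bar>t\<bar>..\<bar>t\<bar>}. norm x \<le> B"
    using compact_imp_bounded bounded_iff by blast
  then have B: "C s \<le> B" if "-\<bar>t\<bar> \<le> s" "s \<le> \<bar>t\<bar>" for s
    using that by (force dest: bspec)
  have le': "\<bar>N' s\<bar> \<le> B * N s" if "-\<bar>t\<bar> \<le> s" "s \<le> \<bar>t\<bar>" for s
    using le[of s] mult_right_mono[OF B[OF that] pos[of s]] by linarith
  show ?thesis
  proof (cases "0 \<le> t")
    case True
    have "N t * exp (- B * t) \<le> N 0 * exp (- B * 0)"
    proof (rule DERIV_nonpos_imp_nonincreasing[OF True])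
      fix s assume s: "0 \<le> s" "s \<le> t"
      have "((\<lambda>s. N s * exp (- B * s)) has_real_derivative (N' s - B * N s) * exp (- B * s)) (at s)"
        by (rule derivative_eq_intros N refl)+ (simp add: algebra_simps)
      moreover have "(N' s - B * N s) * exp (- B * s) \<le> 0"
        using le'[of s] s by (intro mult_nonpos_nonneg) auto
      ultimately show "\<exists>y. ((\<lambda>s. N s * exp (- B * s)) has_real_derivative y) (at s) \<and> y \<le> 0" by blast
    qed
    then show ?thesis using z pos[of t] by (simp add: mult_le_0_iff)
  next
    case False
    have "N t * exp (B * t) \<le> N 0 * exp (B * 0)"
    proof (rule DERIV_nonneg_imp_nondecreasing[of t 0])
      fix s assume s: "t \<le> s" "s \<le> 0"
      have "((\<lambda>s. N s * exp (B * s)) has_real_derivative (N' s + B * N s) * exp (B * s)) (at s)"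
        by (rule derivative_eq_intros N refl)+ (simp add: algebra_simps)
      moreover have "0 \<le> (N' s + B * N s) * exp (B * s)"
        using le'[of s] s False by (intro mult_nonneg_nonneg) auto
      ultimately show "\<exists>y. ((\<lambda>s. N s * exp (B * s)) has_real_derivative y) (at s) \<and> 0 \<le> y" by blast
    qed (use False in simp)
    then show ?thesis using z pos[of t] by (simp add: mult_le_0_iff)
  qed
qed

lemma integrable_const_on_compact:
  fixes K :: "'a::euclidean_space set" and C :: real
  assumes "compact K"
  shows "integrable lborel (\<lambda>p. C * indicator K p)"
proof -
  have "integrable lborel (\<lambda>p. indicator K p *\<^sub>R C)"
    by (rule borel_integrable_compact[OF assms]) simp
  then show ?thesis by (simp only: real_scaleR_def mult.commute)
qed

lemma continuous_bounded_on_interval: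
  fixes h :: "real \<Rightarrow> real"
  assumes "continuous_on UNIV h"
  obtains B where "0 \<le> B" "\<And>x. \<bar>x\<bar> \<le> N \<Longrightarrow> \<bar>h x\<bar> \<le> B"
proof -
  have "compact (h ` {-N..N})"
    using assms by (intro compact_continuous_image) (auto intro: continuous_on_subset)
  then obtain B where B: "\<forall>x \<in> h ` {-N..N}. norm x \<le> B"
    using compact_imp_bounded bounded_iff by blast
  have "\<bar>h x\<bar> \<le> max 0 B" if "\<bar>x\<bar> \<le> N" for x
  proof -
    have "h x \<in> h ` {-N..N}" using that by (intro imageI) auto
    then have "norm (h x) \<le> B" using B by blast
    then show ?thesis by simp
  qed
  then show thesis by (intro that[of "max 0 B"]) auto
qed

lemma has_partials_fst_fun:
  assumes "\<And>x. (h has_real_derivative h' x) (at x)"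
  shows "has_partials (\<lambda>q. h (fst q)) (\<lambda>q. h' (fst q)) (\<lambda>q. 0)"
  using has_partials_compose[OF has_partials_affine[of 1 0 0] assms] by simp

text \<open>The map is affine on each vertical fibre, so Fubini reduces the substitution to one real
  variable; continuity of \<open>c\<close> and \<open>m\<close> suffices, and \<open>m\<close> is
  the Jacobian.\<close>

lemma integral_fiber_affine:
  fixes S :: "real \<times> real \<Rightarrow> real" and c m :: "real \<Rightarrow> real"
  assumes S: "continuous_on UNIV S" "compact K" "\<And>q. q \<notin> K \<Longrightarrow> S q = 0"
    and c: "continuous_on UNIV c" and m: "continuous_on UNIV m" "\<And>x. 0 < m x"
  shows "integral\<^sup>L lborel S = (\<integral>p. m (fst p) * S (fst p, c (fst p) + m (fst p) * snd p) \<partial>lborel)"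
proof -
  define g where "g q = (fst q, (snd q - c (fst q)) / m (fst q))" for q :: "real \<times> real"
  have m0: "m x \<noteq> 0" for x using m(2)[of x] by simp
  have cg: "continuous_on UNIV g"
    unfolding g_def by (intro continuous_intros continuous_on_compose2[OF c] continuous_on_compose2[OF m(1)])
      (auto simp: m0)
  have "compact (g ` K)" using S(2) cg compact_continuous_image continuous_on_subset by blast
  have out: "m (fst p) * S (fst p, c (fst p) + m (fst p) * snd p) = 0" if "p \<notin> g ` K" for p
  proof -
    have "p = g (fst p, c (fst p) + m (fst p) * snd p)" by (simp add: g_def m0)
    then have "(fst p, c (fst p) + m (fst p) * snd p) \<notin> K" using that by blast
    then show ?thesis using S(3) by simp
  qed
  have int: "integrable lborel (\<lambda>p. m (fst p) * S (fst p, c (fst p) + m (fst p) * snd p))"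
    by (rule integrable_continuous_compact_support[OF _ \<open>compact (g ` K)\<close> out])
       (intro continuous_intros continuous_on_compose2[OF S(1)] continuous_on_compose2[OF c]
          continuous_on_compose2[OF m(1)]; simp)
  have "integral\<^sup>L lborel S = (\<integral>x. \<integral>y. S (x, y) \<partial>lborel \<partial>lborel)"
    by (rule lborel_fst_integral[OF integrable_continuous_compact_support[OF S]])
  also have "\<dots> = (\<integral>x. \<integral>y. m x * S (x, c x + m x * y) \<partial>lborel \<partial>lborel)"
  proof (rule Bochner_Integration.integral_cong[OF refl])
    fix x
    have "(\<integral>y. S (x, y) \<partial>lborel) = \<bar>m x\<bar> *\<^sub>R (\<integral>y. S (x, c x + m x * y) \<partial>lborel)"
      by (rule lborel_integral_real_affine[OF m0])
    then show "(\<integral>y. S (x, y) \<partial>lborel) = (\<integral>y. m x * S (x, c x + m x * y) \<partial>lborel)"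
      using m(2)[of x] by simp
  qed
  also have "\<dots> = (\<integral>p. m (fst p) * S (fst p, c (fst p) + m (fst p) * snd p) \<partial>lborel)"
    by (subst lborel_fst_integral[OF int]) simp
  finally show ?thesis .
qed

section \<open>Characteristics and the Jacobian of their flow\<close>

context minimizing_graph
begin

text \<open>Along the explicit parabola the defects of \<^term>\<open>f\<close> and \<^term>\<open>w\<close> from
  their expected values solve a homogeneous linear system of ordinary differential equations,
  so no existence theorem for characteristics is needed.\<close>

lemma along_characteristic:
  defines "c t x \<equiv> t - 4 * f (0, t) * x - 2 * w (0, t) * x\<^sup>2"
  shows "f (x, c t x) = f (0, t) + w (0, t) * x" "w (x, c t x) = w (0, t)"
proof -
  define a where "a = f (0, t)"
  define b where "b = w (0, t)"
  have cd: "(c t has_real_derivative - 4 * (a + b * s)) (at s)" for s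
    unfolding c_def a_def b_def by (auto intro!: derivative_eq_intros)
  have cc: "continuous_on UNIV (c t)" unfolding c_def by (intro continuous_intros)
  define e where "e s = f (s, c t s) - (a + b * s)" for s
  define h where "h s = w (s, c t s) - b" for s
  \<comment> \<open>Writing the slope of the parabola as \<open>- 4 * f + 4 * e\<close>, the first
    part reproduces \<open>w\<close> in the derivative of \<open>f\<close> and, by
    \<open>transport\<close>, zero in that of \<open>w\<close>. The remainder is linear in the
    defects.\<close>
  have ed: "(e has_real_derivative h s + 4 * f2 (s, c t s) * e s) (at s)" for s
  proof -
    have "(e has_real_derivative (1 * f1 (s, c t s) + - 4 * (a + b * s) * f2 (s, c t s)) - b) (at s)"
      unfolding e_def
      by (rule derivative_eq_intros has_partials_along[OF f(1) DERIV_ident cd] refl)+ simp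
    then show ?thesis by (rule DERIV_cong) (simp add: h_def e_def w_eq algebra_simps)
  qed
  have hd: "(h has_real_derivative 4 * w2 (s, c t s) * e s) (at s)" for s
  proof -
    have "(h has_real_derivative (1 * w1 (s, c t s) + - 4 * (a + b * s) * w2 (s, c t s))) (at s)"
      unfolding h_def
      by (rule derivative_eq_intros has_partials_along[OF w(1) DERIV_ident cd] refl)+ simp
    then show ?thesis by (rule DERIV_cong) (simp add: transport e_def algebra_simps)
  qed
  define N where "N s = (e s)\<^sup>2 + (h s)\<^sup>2" for s
  \<comment> \<open>The derivative of \<open>N\<close> is
    \<open>2 e h + 8 f2 e^2 + 8 w2 e h\<close>; the summands of \<open>C\<close> match these terms
    through \<open>2 * \<bar>e * h\<bar> \<le> N\<close> and \<open>e^2 \<le> N\<close>.\<close>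
  define C where "C s = 1 + 8 * \<bar>f2 (s, c t s)\<bar> + 4 * \<bar>w2 (s, c t s)\<bar>" for s
  have "N x = 0"
  proof (rule gronwall_zero[where C = C and N = N and
        N' = "\<lambda>s. 2 * e s * (h s + 4 * f2 (s, c t s) * e s) + 2 * h s * (4 * w2 (s, c t s) * e s)"])
    fix s
    let ?F = "f2 (s, c t s)" and ?W = "w2 (s, c t s)"
    show "(N has_real_derivative 2 * e s * (h s + 4 * ?F * e s) + 2 * h s * (4 * ?W * e s)) (at s)"
      unfolding N_def by (rule derivative_eq_intros ed hd refl)+ simp
    have 1: "\<bar>2 * (e s * h s)\<bar> \<le> N s"
      using sum_squares_bound[of "\<bar>e s\<bar>" "\<bar>h s\<bar>"] by (simp add: N_def abs_mult)
    have 2: "(e s)\<^sup>2 \<le> N s" by (simp add: N_def)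
    have 3: "\<bar>8 * ?F * (e s)\<^sup>2\<bar> \<le> 8 * \<bar>?F\<bar> * N s"
      using mult_left_mono[OF 2, of "8 * \<bar>?F\<bar>"] by (simp add: abs_mult)
    have 4: "\<bar>4 * ?W * (2 * (e s * h s))\<bar> \<le> 4 * \<bar>?W\<bar> * N s"
      using mult_left_mono[OF 1, of "4 * \<bar>?W\<bar>"] by (simp add: abs_mult)
    have "2 * e s * (h s + 4 * ?F * e s) + 2 * h s * (4 * ?W * e s) =
        2 * (e s * h s) + 8 * ?F * (e s)\<^sup>2 + 4 * ?W * (2 * (e s * h s))"
      by (simp add: algebra_simps power2_eq_square)
    also have "\<bar>\<dots>\<bar> \<le> N s + 8 * \<bar>?F\<bar> * N s + 4 * \<bar>?W\<bar> * N s" using 1 3 4 by linarith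
    finally show "\<bar>2 * e s * (h s + 4 * ?F * e s) + 2 * h s * (4 * ?W * e s)\<bar> \<le> C s * N s"
      by (simp add: C_def algebra_simps)
    show "0 \<le> N s" by (simp add: N_def)
  next
    show "N 0 = 0" by (simp add: N_def e_def h_def c_def a_def b_def)
    show "continuous_on UNIV C" unfolding C_def
      by (intro continuous_intros continuous_on_compose2[OF continuous_data(3)[of UNIV]]
          continuous_on_compose2[OF continuous_data(6)[of UNIV]] cc) auto
  qed
  then have "e x = 0" "h x = 0" by (simp_all add: N_def sum_power2_eq_zero_iff)
  then show "f (x, c t x) = f (0, t) + w (0, t) * x" "w (x, c t x) = w (0, t)"
    by (simp_all add: e_def h_def a_def b_def)
qed

context
  fixes t :: real
begin

definition "a \<equiv> f (0, t)"
definition "b \<equiv> w (0, t)"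
definition "a' \<equiv> f2 (0, t)"
definition "b' \<equiv> w2 (0, t)"
definition "c x \<equiv> t - 4 * a * x - 2 * b * x\<^sup>2" for x
definition "J x \<equiv> 1 - 4 * a' * x - 2 * b' * x\<^sup>2" for x
definition "J' x \<equiv> - 4 * a' - 4 * b' * x" for x

lemma J_deriv: "(J has_real_derivative J' x) (at x)" "(J' has_real_derivative - 4 * b') (at x)"
  unfolding J_def J'_def by (auto intro!: derivative_eq_intros)

lemma c_deriv: "(c has_real_derivative - 4 * f (x, c x)) (at x)"
  unfolding c_def using along_characteristic(1)[of x t]
  by (auto intro!: derivative_eq_intros simp: a_def b_def)

lemma w_c: "w (x, c x) = b"
  using along_characteristic(2)[of x t] by (simp add: a_def b_def c_def)

text \<open>Both identities of \<open>along_characteristic\<close> are differentiated in the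
  starting height \<open>t\<close>; the end point of the characteristic moves with speed
  \<open>J x\<close>.\<close>

lemma slopes_along_characteristic: "f2 (x, c x) * J x = a' + b' * x" "w2 (x, c x) * J x = b'"
proof -
  define cc where "cc s = s - 4 * f (0, s) * x - 2 * w (0, s) * x\<^sup>2" for s
  have cc: "(cc has_real_derivative J x) (at t)"
    unfolding cc_def J_def a'_def b'_def
    by (rule derivative_eq_intros has_partials_snd[OF f(1)] has_partials_snd[OF w(1)] refl)+ simp
  have cct: "cc t = c x" by (simp add: cc_def c_def a_def b_def)
  have "((\<lambda>s. f (x, cc s)) has_real_derivative 0 * f1 (x, cc t) + J x * f2 (x, cc t)) (at t)"
    by (rule has_partials_along[OF f(1) DERIV_const cc])
  moreover have "((\<lambda>s. f (x, cc s)) has_real_derivative a' + b' * x) (at t)"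
    unfolding cc_def along_characteristic a'_def b'_def
    by (rule derivative_eq_intros has_partials_snd[OF f(1)] has_partials_snd[OF w(1)] refl)+ simp
  ultimately show "f2 (x, c x) * J x = a' + b' * x"
    using DERIV_unique cct by fastforce
  have "((\<lambda>s. w (x, cc s)) has_real_derivative 0 * w1 (x, cc t) + J x * w2 (x, cc t)) (at t)"
    by (rule has_partials_along[OF w(1) DERIV_const cc])
  moreover have "((\<lambda>s. w (x, cc s)) has_real_derivative b') (at t)"
    unfolding cc_def along_characteristic b'_def by (rule has_partials_snd[OF w(1)])
  ultimately show "w2 (x, c x) * J x = b'"
    using DERIV_unique cct by fastforce
qed

text \<open>Since \<open>J 0 = 1\<close>, a failure of positivity produces a zero \<open>y\<close>
  of \<open>J\<close>. There the finite slopes \<open>f2\<close> and \<open>w2\<close> force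
  \<open>b' = 0\<close> and \<open>a' + b' * y = 0\<close>, hence \<open>a' = 0\<close> and
  \<open>J = 1\<close>, which is absurd.\<close>

lemma J_pos: "0 < J x"
proof (rule ccontr)
  assume "\<not> 0 < J x"
  then have "\<exists>s\<ge>0. s \<le> 1 \<and> J (s * x) = 0"
    by (intro IVT2') (auto simp: J_def intro!: continuous_intros)
  then obtain y where y: "J y = 0" by blast
  then have "b' = 0" "a' + b' * y = 0" using slopes_along_characteristic[of y] by auto
  then have "J y = 1" by (simp add: J_def)
  then show False using y by simp
qed

lemma J_nonzero: "J x \<noteq> 0" using J_pos[of x] by simp

lemma f2_c: "- 4 * f2 (x, c x) = J' x / J x"
  using slopes_along_characteristic(1)[of x] J_nonzero[of x] by (simp add: J'_def field_simps)

lemma w2_c: "w2 (x, c x) = b' / J x"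
  using slopes_along_characteristic(2)[of x] J_nonzero[of x] by (simp add: field_simps)

lemma continuous_c: "continuous_on S c" "continuous_on S J" "continuous_on S J'"
  unfolding c_def J_def J'_def by (intro continuous_intros)+

text \<open>The stability inequality, rescaled around the characteristic through \<^term>\<open>(0, t)\<close>.
  The test functions are stretched by \<^term>\<open>J\<close>, so that they are transported by the flow up to
  an error which vanishes in the limit.\<close>

lemma stability_blowup:
  assumes U: "\<And>x. (U has_real_derivative U' x) (at x)" "continuous_on UNIV U'"
    and supp: "\<And>x. \<bar>x\<bar> \<ge> N \<Longrightarrow> U x = 0" "\<And>x. \<bar>x\<bar> \<ge> N \<Longrightarrow> U' x = 0" and N: "0 < N"
  shows "0 \<le> (\<integral>p. (bump (snd p))\<^sup>2 * ((U' (fst p) + J' (fst p) / J (fst p) * U (fst p))\<^sup>2 * J (fst p)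
    + 4 * b' * (U (fst p))\<^sup>2) \<partial>lborel)"
proof -
  have Uc: "continuous_on UNIV U"
    using U(1) by (meson DERIV_continuous continuous_at_imp_continuous_on)
  have compf: "continuous_on UNIV (\<lambda>q::real\<times>real. g (h q))"
    if "continuous_on UNIV g" "continuous_on UNIV h" for g h :: "_ \<Rightarrow> real"
    by (rule continuous_on_compose2[OF that]) auto
  have comp1: "continuous_on UNIV (\<lambda>q::real\<times>real. g (fst q))"
    if "continuous_on UNIV g" for g :: "real \<Rightarrow> real"
    by (rule compf[OF that]) (intro continuous_intros)
  define rr where "rr n = inverse (real (Suc n))" for n
  have rr: "0 < rr n" "rr n \<le> 1" "rr n \<noteq> 0" for n by (auto simp: rr_def field_simps)
  have rr0: "rr \<longlonglongrightarrow> 0" unfolding rr_def by (rule LIMSEQ_inverse_real_of_nat)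
  \<comment> \<open>The vertical distance from the characteristic in units of
    \<open>rr n * J\<close>. Nearby characteristics spread in proportion to \<open>J\<close>, so to
    first order they are level sets of this coordinate.\<close>
  define \<theta> where "\<theta> n q = (snd q - c (fst q)) * inverse (rr n * J (fst q))" for n q
  define \<theta>1 where "\<theta>1 n q = 4 * f (fst q, c (fst q)) * inverse (rr n * J (fst q))
     - (snd q - c (fst q)) * (rr n * J' (fst q) * inverse (rr n * J (fst q)) ^ 2)" for n q
  define \<theta>2 where "\<theta>2 n q = inverse (rr n * J (fst q))" for n and q :: "real \<times> real"
  have \<theta>p: "has_partials (\<theta> n) (\<theta>1 n) (\<theta>2 n)" for n
  proof -
    have Jd: "((\<lambda>x. inverse (rr n * J x)) has_real_derivative - (rr n * J' x * inverse (rr n * J x) ^ 2)) (at x)" for x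
      using J_nonzero[of x] rr(3)[of n]
      by (auto intro!: derivative_eq_intros J_deriv simp: power2_eq_square)
    have s: "has_partials snd (\<lambda>_. 0) (\<lambda>_. 1)" using has_partials_affine[of 0 1 0] by simp
    have c': "((\<lambda>x. - c x) has_real_derivative 4 * f (x, c x)) (at x)" for x
      by (auto intro!: derivative_eq_intros c_deriv)
    from has_partials_mult[OF has_partials_add[OF s has_partials_fst_fun[OF c']] has_partials_fst_fun[OF Jd]]
    show ?thesis unfolding \<theta>_def[abs_def] \<theta>1_def[abs_def] \<theta>2_def[abs_def] by simp
  qed
  define \<psi> where "\<psi> n q = U (fst q) * bump (\<theta> n q)" for n q
  define \<psi>1 where "\<psi>1 n q = U' (fst q) * bump (\<theta> n q) + U (fst q) * (bump' (\<theta> n q) * \<theta>1 n q)" for n q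
  define \<psi>2 where "\<psi>2 n q = U (fst q) * (bump' (\<theta> n q) * \<theta>2 n q)" for n q
  have \<psi>p: "has_partials (\<psi> n) (\<psi>1 n) (\<psi>2 n)" for n
    using has_partials_mult[OF has_partials_fst_fun[OF U(1)] has_partials_compose[OF \<theta>p bump_deriv]]
    unfolding \<psi>_def[abs_def] \<psi>1_def[abs_def] \<psi>2_def[abs_def] by simp
  have fcc: "continuous_on UNIV (\<lambda>q::real\<times>real. f (fst q, c (fst q)))"
    by (rule continuous_on_compose2[OF continuous_data(1)[of UNIV]])
       (auto intro!: continuous_intros comp1 continuous_c)
  have c\<theta>: "continuous_on UNIV (\<theta> n)" "continuous_on UNIV (\<theta>1 n)" "continuous_on UNIV (\<theta>2 n)" for n
    unfolding \<theta>_def \<theta>1_def \<theta>2_def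
    by (intro continuous_intros comp1 continuous_c fcc ballI; simp add: J_nonzero rr(3))+
  have c\<psi>: "continuous_on UNIV (\<psi>1 n)" "continuous_on UNIV (\<psi>2 n)" for n
    unfolding \<psi>1_def \<psi>2_def
    by (intro continuous_intros comp1 Uc U(2) c\<theta> compf[OF continuous_bump(1) c\<theta>(1)] compf[OF continuous_bump(2) c\<theta>(1)])+
  obtain Bc where Bc: "0 \<le> Bc" "\<And>x. \<bar>x\<bar> \<le> N \<Longrightarrow> \<bar>c x\<bar> \<le> Bc"
    using continuous_bounded_on_interval[OF continuous_c(1)] by blast
  obtain BJ where BJ: "0 \<le> BJ" "\<And>x. \<bar>x\<bar> \<le> N \<Longrightarrow> \<bar>J x\<bar> \<le> BJ"
    using continuous_bounded_on_interval[OF continuous_c(2)] by blast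
  have "continuous_on UNIV (\<lambda>x. J' x / J x)" by (intro continuous_intros continuous_c ballI J_nonzero)
  then obtain BK where BK: "0 \<le> BK" "\<And>x. \<bar>x\<bar> \<le> N \<Longrightarrow> \<bar>J' x / J x\<bar> \<le> BK"
    using continuous_bounded_on_interval by blast
  obtain BU where BU: "0 \<le> BU" "\<And>x. \<bar>x\<bar> \<le> N \<Longrightarrow> \<bar>U x\<bar> \<le> BU"
    using continuous_bounded_on_interval[OF Uc] by blast
  obtain BV where BV: "0 \<le> BV" "\<And>x. \<bar>x\<bar> \<le> N \<Longrightarrow> \<bar>U' x\<bar> \<le> BV"
    using continuous_bounded_on_interval[OF U(2)] by blast
  \<comment> \<open>As \<open>rr n \<le> 1\<close>, the supports for all \<open>n\<close> lie in the
    one rectangle \<open>Q\<close>, on which \<open>f2\<close> and \<open>w2\<close> are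
    bounded.\<close>
  define M where "M = Bc + BJ"
  define Q where "Q = {-N..N} \<times> {-M..M}"
  have Qc: "compact Q" unfolding Q_def by (intro compact_Times compact_Icc)
  have bnd: "\<exists>B\<ge>0. \<forall>q\<in>Q. \<bar>g q\<bar> \<le> B" if "continuous_on UNIV g" for g :: "real \<times> real \<Rightarrow> real"
  proof -
    have "compact (g ` Q)" using that Qc by (intro compact_continuous_image) (auto intro: continuous_on_subset)
    then obtain B where "\<forall>x\<in>g ` Q. norm x \<le> B" using compact_imp_bounded bounded_iff by blast
    then have "norm (g q) \<le> B" if "q \<in> Q" for q using that by blast
    then show ?thesis by (intro exI[of _ "max 0 B"]) (auto simp: le_max_iff_disj)
  qed
  obtain B2 where B2: "0 \<le> B2" "\<And>q. q \<in> Q \<Longrightarrow> \<bar>f2 q\<bar> \<le> B2"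
    using bnd[OF continuous_data(3)] by blast
  obtain BW where BW: "0 \<le> BW" "\<And>q. q \<in> Q \<Longrightarrow> \<bar>w2 q\<bar> \<le> BW"
    using bnd[OF continuous_data(6)] by blast
  have inQ: "(x, c x + h * J x) \<in> Q" if "\<bar>x\<bar> \<le> N" "\<bar>h\<bar> \<le> 1" for x h
  proof -
    have "\<bar>h * J x\<bar> \<le> 1 * BJ" unfolding abs_mult using that BJ by (intro mult_mono) auto
    then show ?thesis using that Bc(2)[of x] by (auto simp: Q_def M_def)
  qed
  have \<psi>0: "\<psi> n q = 0" if "q \<notin> Q" for n q
  proof (rule ccontr)
    assume "\<psi> n q \<noteq> 0"
    then have "U (fst q) \<noteq> 0" "bump (\<theta> n q) \<noteq> 0" by (auto simp: \<psi>_def)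
    then have x: "\<bar>fst q\<bar> < N" and "\<bar>\<theta> n q\<bar> < 1"
      using supp(1)[of "fst q"] bump_props(4)[of "\<theta> n q"] by (meson not_less)+
    then have "\<bar>rr n * \<theta> n q\<bar> \<le> 1" using rr(1,2)[of n] by (simp add: abs_mult mult_le_one)
    from inQ[OF less_imp_le[OF x] this] have "(fst q, c (fst q) + rr n * \<theta> n q * J (fst q)) \<in> Q" .
    moreover have "c (fst q) + rr n * \<theta> n q * J (fst q) = snd q"
      using J_nonzero[of "fst q"] rr(3)[of n] by (simp add: \<theta>_def field_simps)
    ultimately show False using that by simp
  qed
  have Qb: "norm q \<le> N + M" if "q \<in> Q" for q
    using that norm_Pair_le[of "fst q" "snd q"] by (cases q) (auto simp: Q_def)
  have M: "0 \<le> M" using Bc BJ by (simp add: M_def)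
  have \<psi>R: "\<psi> n q = 0" if "norm q > N + M" for n q
    using \<psi>0 Qb[of q] that by fastforce
  define L where "L n q = \<psi>1 n q - 4 * f q * \<psi>2 n q - 4 * f2 q * \<psi> n q" for n q
  define S where "S n q = ((L n q)\<^sup>2 + 4 * w2 q * (\<psi> n q)\<^sup>2) / area (w q) ^ 3" for n q
  have Spos: "0 \<le> integral\<^sup>L lborel (S n)" for n
    unfolding S_def[abs_def] L_def
  proof (rule stability[OF \<psi>p c\<psi>, where R = "N + M"])
    show "\<psi> n q = 0" if "N + M < norm q" for q using that by (rule \<psi>R)
    show "0 < N + M" using N M by simp
  qed
  have cS: "continuous_on UNIV (S n)" for n
    unfolding S_def L_def
    by (intro continuous_intros continuous_data c\<psi> has_partials_continuous[OF \<psi>p] ballI) (simp add: area_w_nonzero)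
  have S0: "S n q = 0" if "q \<notin> Q" for n q
    using \<psi>0[OF that] has_partials_zero_off_closed[OF \<psi>p compact_imp_closed[OF Qc] \<psi>0 that]
    by (simp add: S_def L_def)
  define q where "q n p = (fst p, c (fst p) + rr n * J (fst p) * snd p)" for n and p :: "real \<times> real"
  define T where "T n p = J (fst p) * S n (q n p)" for n p
  have cq: "continuous_on UNIV (q n)" for n
    unfolding q_def by (intro continuous_intros comp1 continuous_c)
  have cT: "continuous_on UNIV (T n)" for n
    unfolding T_def by (intro continuous_intros comp1 continuous_c continuous_on_compose2[OF cS cq]) auto
  \<comment> \<open>The substitution has Jacobian \<open>rr n * J\<close>. Removing the positive
    factor \<open>rr n\<close> keeps the sign and prevents the limit from degenerating to
    zero.\<close>
  have Tpos: "0 \<le> integral\<^sup>L lborel (T n)" for n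
  proof -
    have "integral\<^sup>L lborel (S n) = (\<integral>p. rr n * J (fst p) * S n (fst p, c (fst p) + rr n * J (fst p) * snd p) \<partial>lborel)"
      by (rule integral_fiber_affine[OF cS Qc S0 continuous_c(1)])
         (auto intro!: continuous_intros continuous_c simp: rr J_pos)
    also have "\<dots> = (\<integral>p. rr n * T n p \<partial>lborel)" by (simp add: T_def q_def mult_ac)
    also have "\<dots> = rr n * integral\<^sup>L lborel (T n)" by simp
    finally show ?thesis using Spos[of n] rr(1)[of n] by (simp add: zero_le_mult_iff)
  qed
  \<comment> \<open>The derivative of \<open>\<theta> n\<close> under
    \<open>d_\<eta> - 4 f d_\<tau>\<close> at the rescaled point, that is, the error by which it
    fails to be transported. Its first part tends to \<open>- 4 * snd p * f2\<close>, which
    \<open>f2_c\<close> cancels against the second.\<close>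
  define D where "D n p = - 4 * ((f (q n p) - f (fst p, c (fst p))) / (rr n * J (fst p))) - snd p * (J' (fst p) / J (fst p))" for n p
  have \<theta>q: "\<theta> n (q n p) = snd p" for n p
    using J_nonzero[of "fst p"] rr(3)[of n] by (simp add: \<theta>_def q_def field_simps)
  have Lq: "L n (q n p) = U' (fst p) * bump (snd p) + U (fst p) * bump' (snd p) * D n p
      - 4 * f2 (q n p) * (U (fst p) * bump (snd p))" for n p
  proof -
    have "\<theta>1 n (q n p) - 4 * f (q n p) * \<theta>2 n (q n p) = D n p"
      using J_nonzero[of "fst p"] rr(3)[of n]
      by (simp add: \<theta>1_def \<theta>2_def D_def q_def power2_eq_square field_simps)
    then show ?thesis
      unfolding L_def \<psi>1_def \<psi>2_def \<psi>_def \<theta>q by (simp add: q_def algebra_simps flip: distrib_left)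
  qed
  define T0 where "T0 p = (bump (snd p))\<^sup>2 * ((U' (fst p) + J' (fst p) / J (fst p) * U (fst p))\<^sup>2 * J (fst p)
    + 4 * b' * (U (fst p))\<^sup>2) / area b ^ 3" for p
  \<comment> \<open>One bound for each summand of \<open>Lq\<close>:
    \<open>\<bar>bump\<bar> \<le> 1\<close> for the outer two, and
    \<open>\<bar>bump'\<bar> \<le> 4\<close> with \<open>\<bar>D\<bar> \<le> 4 * B2 + BK\<close> for
    the middle one.\<close>
  define CL where "CL = BV + BU * 4 * (4 * B2 + BK) + 4 * B2 * BU"
  define CT where "CT = BJ * (CL\<^sup>2 + 4 * BW * BU\<^sup>2)"
  have lim: "(\<lambda>n. T n p) \<longlonglongrightarrow> T0 p" for p
  proof -
    obtain x s where p: "p = (x, s)" by (cases p)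
    have ps: "fst p = x" "snd p = s" by (simp_all add: p)
    have "(\<lambda>n. (x, c x + rr n * J x * s)) \<longlonglongrightarrow> (x, c x + 0 * J x * s)" by (intro tendsto_intros rr0)
    then have q0: "(\<lambda>n. q n p) \<longlonglongrightarrow> (x, c x)" by (simp add: q_def p)
    have along: "(\<lambda>n. g (q n p)) \<longlonglongrightarrow> g (x, c x)" if "continuous_on UNIV g" for g :: "real \<times> real \<Rightarrow> real"
      using continuous_on_tendsto_compose[OF that q0] by simp
    \<comment> \<open>For \<open>s = 0\<close> the difference quotient has zero denominator, but
      then \<open>D n p\<close> is exactly 0.\<close>
    have D0: "(\<lambda>n. D n p) \<longlonglongrightarrow> 0"
    proof (cases "s = 0")
      case True
      then show ?thesis by (simp add: D_def q_def p)
    next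
      case False
      have "((\<lambda>h. (f (x, c x + h) - f (x, c x)) / h) \<longlongrightarrow> f2 (x, c x)) (at 0)"
        using has_partials_snd[OF f(1), of x "c x"] unfolding DERIV_def .
      moreover have "filterlim (\<lambda>n. rr n * J x * s) (at 0) sequentially"
        unfolding filterlim_at
      proof
        show "(\<lambda>n. rr n * J x * s) \<longlonglongrightarrow> 0" using tendsto_mult[OF tendsto_mult[OF rr0 tendsto_const] tendsto_const] by simp
      qed (use False J_nonzero rr(3) in simp)
      ultimately have "(\<lambda>n. (f (x, c x + rr n * J x * s) - f (x, c x)) / (rr n * J x * s)) \<longlonglongrightarrow> f2 (x, c x)"
        by (rule filterlim_compose)
      then have "(\<lambda>n. - 4 * (s * ((f (x, c x + rr n * J x * s) - f (x, c x)) / (rr n * J x * s))) - s * (J' x / J x))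
         \<longlonglongrightarrow> - 4 * (s * f2 (x, c x)) - s * (J' x / J x)"
        by (intro tendsto_intros)
      also have "(\<lambda>n. - 4 * (s * ((f (x, c x + rr n * J x * s) - f (x, c x)) / (rr n * J x * s))) - s * (J' x / J x)) = (\<lambda>n. D n p)"
        using False by (simp add: D_def q_def p)
      also have "- 4 * (s * f2 (x, c x)) - s * (J' x / J x) = 0"
        using f2_c[of x] by (simp add: algebra_simps flip: f2_c)
      finally show ?thesis .
    qed
    have "(\<lambda>n. L n (q n p)) \<longlonglongrightarrow> U' x * bump s + U x * bump' s * 0 - 4 * f2 (x, c x) * (U x * bump s)"
      unfolding Lq ps by (intro tendsto_intros D0 along continuous_data)
    moreover have "(\<lambda>n. (\<psi> n (q n p))) \<longlonglongrightarrow> U x * bump s"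
      unfolding \<psi>_def \<theta>q by (simp add: q_def p)
    ultimately have "(\<lambda>n. T n p) \<longlonglongrightarrow> J x * (((U' x * bump s + U x * bump' s * 0 - 4 * f2 (x, c x) * (U x * bump s))\<^sup>2
        + 4 * w2 (x, c x) * (U x * bump s)\<^sup>2) / area (w (x, c x)) ^ 3)"
      unfolding T_def S_def ps
      by (intro tendsto_intros along continuous_data) (auto simp: area_w_nonzero)
    also have "U' x * bump s + U x * bump' s * 0 - 4 * f2 (x, c x) * (U x * bump s) = bump s * (U' x + J' x / J x * U x)"
      by (simp add: algebra_simps flip: f2_c)
    also have "J x * (((bump s * (U' x + J' x / J x * U x))\<^sup>2 + 4 * w2 (x, c x) * (U x * bump s)\<^sup>2) / area (w (x, c x)) ^ 3) = T0 p"
    proof -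
      define z where "z = U' x + J' x / J x * U x"
      show ?thesis
        unfolding w2_c w_c T0_def ps z_def[symmetric]
        using J_nonzero[of x] by (simp add: power_mult_distrib algebra_simps)
    qed
    finally show ?thesis .
  qed
  have bound: "\<bar>T n p\<bar> \<le> CT * indicator ({-N..N} \<times> {-1..1}) p" for n p
  proof -
    obtain x s where p: "p = (x, s)" by (cases p)
    have ps: "fst p = x" "snd p = s" by (simp_all add: p)
    show ?thesis
    proof (cases "\<bar>x\<bar> \<le> N \<and> \<bar>s\<bar> \<le> 1")
      case False
      then have "U x = 0 \<and> U' x = 0 \<or> bump s = 0 \<and> bump' s = 0"
        using supp[of x] bump_props(4,5)[of s] by force
      then have "T n p = 0" unfolding T_def S_def Lq unfolding \<psi>_def \<theta>q by (auto simp: p q_def)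
      moreover have "p \<notin> {-N..N} \<times> {-1..1}" using False by (auto simp: p)
      ultimately show ?thesis by simp
    next
      case True
      have rs: "\<bar>rr n * s\<bar> \<le> 1" using True rr(1,2)[of n] by (simp add: abs_mult mult_le_one)
      have qQ: "q n p \<in> Q" using inQ[OF _ rs, of x] True by (simp add: q_def p mult_ac)
      \<comment> \<open>The mean value bound along the vertical segment, which stays in
        \<open>Q\<close>, cancels the denominator \<open>rr n * J\<close> of \<open>D\<close> and so
        makes its bound uniform in \<open>n\<close>.\<close>
      have fd: "\<bar>f (q n p) - f (x, c x)\<bar> \<le> B2 * \<bar>rr n * J x * s\<bar>"
      proof -
        have "norm (f (x, c x + rr n * J x * s) - f (x, c x)) \<le> B2 * norm (c x + rr n * J x * s - c x)"
        proof (rule field_differentiable_bound)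
          show "convex (closed_segment (c x) (c x + rr n * J x * s))" by simp
          fix y assume "y \<in> closed_segment (c x) (c x + rr n * J x * s)"
          then obtain u where u: "0 \<le> u" "u \<le> 1" and y: "y = c x + (u * (rr n * s)) * J x"
            by (auto simp: closed_segment_def algebra_simps)
          have "\<bar>u * (rr n * s)\<bar> \<le> 1" using u rs by (simp add: abs_mult mult_le_one)
          then have "(x, y) \<in> Q" unfolding y using inQ True by blast
          then show "norm (f2 (x, y)) \<le> B2" using B2 by simp
          show "((\<lambda>y. f (x, y)) has_field_derivative f2 (x, y)) (at y within closed_segment (c x) (c x + rr n * J x * s))"
            by (rule has_field_derivative_at_within[OF has_partials_snd[OF f(1)]])
        qed auto
        then show ?thesis by (simp add: q_def p)
      qed
      have "\<bar>D n p\<bar> \<le> 4 * B2 + BK"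
      proof -
        have "\<bar>(f (q n p) - f (x, c x)) / (rr n * J x)\<bar> \<le> B2 * \<bar>rr n * J x * s\<bar> / \<bar>rr n * J x\<bar>"
          unfolding abs_divide by (rule divide_right_mono[OF fd]) simp
        also have "\<dots> = B2 * \<bar>s\<bar>" using J_nonzero[of x] rr(3)[of n] by (simp add: abs_mult)
        also have "\<dots> \<le> B2 * 1" using True B2(1) by (intro mult_left_mono) auto
        finally have "\<bar>(f (q n p) - f (x, c x)) / (rr n * J x)\<bar> \<le> B2" by simp
        moreover have "\<bar>s * (J' x / J x)\<bar> \<le> 1 * BK"
          unfolding abs_mult[of s] using True BK by (intro mult_mono) auto
        ultimately show ?thesis unfolding D_def ps by linarith
      qed
      moreover have b1: "\<bar>bump s\<bar> \<le> 1" using bump_props(1,2)[of s] by simp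
      have b2: "\<bar>bump' s\<bar> \<le> 4"
      proof -
        have "\<bar>s\<bar> * max 0 (1 - s\<^sup>2) \<le> 1 * 1" using True by (intro mult_mono) auto
        then show ?thesis by (simp add: bump'_def abs_mult)
      qed
      ultimately have "\<bar>L n (q n p)\<bar> \<le> CL"
      proof -
        have 1: "\<bar>U' x * bump s\<bar> \<le> BV * 1" unfolding abs_mult using BV True b1 by (intro mult_mono) auto
        have 2: "\<bar>U x * bump' s * D n p\<bar> \<le> BU * 4 * (4 * B2 + BK)"
          unfolding abs_mult using BU True b2 \<open>\<bar>D n p\<bar> \<le> _\<close> by (intro mult_mono) auto
        have 3: "\<bar>4 * f2 (q n p) * (U x * bump s)\<bar> \<le> 4 * B2 * (BU * 1)"
          unfolding abs_mult using B2 qQ BU True b1 by (intro mult_mono) auto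
        show ?thesis unfolding Lq CL_def ps using 1 2 3 by linarith
      qed
      then have L2: "(L n (q n p))\<^sup>2 \<le> CL\<^sup>2"
        using power_mono[of "\<bar>L n (q n p)\<bar>" CL 2] by simp
      have "\<psi> n (q n p) = U x * bump s" unfolding \<psi>_def \<theta>q by (simp add: q_def p)
      moreover have "\<bar>U x * bump s\<bar> \<le> BU * 1" unfolding abs_mult using BU True b1 by (intro mult_mono) auto
      ultimately have "\<bar>\<psi> n (q n p)\<bar> \<le> BU" by simp
      then have P2: "(\<psi> n (q n p))\<^sup>2 \<le> BU\<^sup>2"
        using power_mono[of "\<bar>\<psi> n (q n p)\<bar>" BU 2] by simp
      have "\<bar>4 * w2 (q n p) * (\<psi> n (q n p))\<^sup>2\<bar> \<le> 4 * BW * BU\<^sup>2"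
        unfolding abs_mult using BW qQ P2 by (intro mult_mono) auto
      then have "\<bar>(L n (q n p))\<^sup>2 + 4 * w2 (q n p) * (\<psi> n (q n p))\<^sup>2\<bar> \<le> CL\<^sup>2 + 4 * BW * BU\<^sup>2"
        using L2 abs_power2[of "L n (q n p)"]
          abs_triangle_ineq[of "(L n (q n p))\<^sup>2" "4 * w2 (q n p) * (\<psi> n (q n p))\<^sup>2"] by linarith
      moreover have "\<bar>S n (q n p)\<bar> \<le> \<bar>(L n (q n p))\<^sup>2 + 4 * w2 (q n p) * (\<psi> n (q n p))\<^sup>2\<bar>"
      proof -
        have "1 \<le> area (w (q n p)) ^ 3" by (rule one_le_power[OF area_ge_1])
        then show ?thesis unfolding S_def abs_divide by (intro divide_le_eq[THEN iffD2]) (auto simp: mult_le_cancel_left1)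
      qed
      ultimately have "\<bar>S n (q n p)\<bar> \<le> CL\<^sup>2 + 4 * BW * BU\<^sup>2" by linarith
      then have "\<bar>T n p\<bar> \<le> CT"
        unfolding T_def CT_def abs_mult using BJ True by (intro mult_mono) (auto simp: p)
      moreover have "p \<in> {-N..N} \<times> {-1..1}" using True by (auto simp: p)
      ultimately show ?thesis by simp
    qed
  qed
  have "(\<lambda>n. integral\<^sup>L lborel (T n)) \<longlonglongrightarrow> integral\<^sup>L lborel T0"
  proof (rule integral_dominated_convergence)
    show "integrable lborel (\<lambda>p. CT * indicator ({-N..N} \<times> {-1..1::real}) p)"
      by (intro integrable_const_on_compact compact_Times compact_Icc)
    show "T n \<in> borel_measurable lborel" for n using borel_measurable_continuous_onI[OF cT] by simp
    have "continuous_on UNIV T0" unfolding T0_def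
      by (intro continuous_intros comp1 continuous_c Uc U(2) compf[OF continuous_bump(1)] ballI)
         (use J_nonzero area_pos[of b] in auto)
    then show "T0 \<in> borel_measurable lborel" using borel_measurable_continuous_onI by simp
  qed (use lim bound in auto)
  then have "0 \<le> integral\<^sup>L lborel T0" by (rule LIMSEQ_le_const) (use Tpos in auto)
  \<comment> \<open>In the limit the weight is evaluated on the characteristic, where
    \<open>w\<close> has the constant value \<open>b\<close>; it factors out as a positive
    number.\<close>
  then have "0 \<le> (\<integral>p. (bump (snd p))\<^sup>2 * ((U' (fst p) + J' (fst p) / J (fst p) * U (fst p))\<^sup>2 * J (fst p)
    + 4 * b' * (U (fst p))\<^sup>2) \<partial>lborel) / area b ^ 3"
    unfolding T0_def[abs_def] by simp
  then show ?thesis using zero_less_power[OF area_pos[of b], of 3] by (simp add: zero_le_divide_iff)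
qed

end

end

section \<open>Rigidity\<close>

lemma integral_indicator_rectangle:
  fixes l1 u1 l2 u2 :: real
  assumes "l1 \<le> u1" "l2 \<le> u2"
  shows "(\<integral>p. C * indicator ({l1..u1} \<times> {l2..u2}) p \<partial>lborel) = C * ((u1 - l1) * (u2 - l2))"
proof -
  have "measure lborel ({l1..u1} \<times> {l2..u2}) = (u1 - l1) * (u2 - l2)"
    using content_Pair[of l1 l2 u1 u2] assms by (simp add: cbox_Pair_eq)
  then show ?thesis by simp
qed

context minimizing_graph
begin

text \<open>Taking \<open>U = v / sqrt J\<close> turns the weight of the derivative term into 1. As
  \<open>J'' = - 4 * b'\<close>, integrating the cross term by parts leaves
  \<open>v'^2 - 3/4 * (2 * J * J'' - J'^2) * v^2 / J^2\<close>, and the bracket is the constant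
  \<open>8 * \<delta>\<close>, minus the discriminant of \<open>J\<close>; hence the factor
  \<open>6 * \<delta>\<close>.\<close>

lemma w2_axis: "w2 (0, t) = 0"
proof (rule ccontr)
  let ?J = "J t" and ?J' = "J' t" and ?b = "b' t" and ?a = "a' t"
  assume "w2 (0, t) \<noteq> 0"
  then have b0: "?b \<noteq> 0" by (simp add: b'_def)
  \<comment> \<open>The sum \<open>J x + J (- x)\<close> equals \<open>2 - 4 * b' * x^2\<close>,
    which is \<open>- 2\<close> at the chosen \<open>x\<close>.\<close>
  have "?b < 0"
  proof (rule ccontr)
    assume "\<not> ?b < 0"
    then have bp: "0 < ?b" using b0 by simp
    define x where "x = sqrt (1 / ?b)"
    have "?b * x\<^sup>2 = 1" using bp by (simp add: x_def)
    then have "?J x + ?J (- x) < 0" by (simp add: J_def)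
    then show False using J_pos[of t x] J_pos[of t "- x"] by simp
  qed
  define \<delta> where "\<delta> = - (?b + 2 * ?a\<^sup>2)"
  \<comment> \<open>The minimum of the parabola \<open>J\<close>, at its vertex; positivity there,
    with \<open>b' < 0\<close>, is the sign of \<open>\<delta>\<close>.\<close>
  have "?J (- ?a / ?b) = (?b + 2 * ?a\<^sup>2) / ?b"
    using b0 by (simp add: J_def field_simps power2_eq_square)
  then have \<delta>: "0 < \<delta>"
    using J_pos[of t "- ?a / ?b"] \<open>?b < 0\<close> by (simp add: \<delta>_def zero_less_divide_iff)
  obtain BJ where BJ: "0 \<le> BJ" "\<And>x. \<bar>x\<bar> \<le> 1 \<Longrightarrow> \<bar>?J x\<bar> \<le> BJ"
    using continuous_bounded_on_interval[OF continuous_c(2)] by blast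
  have "?J 0 = 1" by (simp add: J_def)
  then have BJ1: "1 \<le> BJ" using BJ(2)[of 0] by simp
  \<comment> \<open>A lower bound for the negative term on the rectangle with
    \<open>\<bar>x\<bar> \<le> 1\<close> and \<open>\<bar>s\<bar> \<le> 1/2\<close>: there both bump
    factors are at least \<open>(1 - 1/4)^2 = 9/16\<close>, and \<open>J\<close> is at most
    \<open>BJ\<close>.\<close>
  define \<kappa> where "\<kappa> = 6 * \<delta> * ((9/16)\<^sup>2 * (9/16)\<^sup>2 / BJ\<^sup>2)"
  have \<kappa>: "0 < \<kappa>" using \<delta> BJ1 by (simp add: \<kappa>_def)
  obtain n :: nat where n: "32 / \<kappa> < real n" using reals_Archimedean2 by blast
  \<comment> \<open>The summand 2 ensures \<open>\<bar>x / N\<bar> \<le> 1/2\<close> for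
    \<open>\<bar>x\<bar> \<le> 1\<close>. The energy is at most \<open>16 / N^2\<close> on an area
    of \<open>4 * N\<close>, against a gain of \<open>2 * \<kappa>\<close>, so
    \<open>32 / N < \<kappa>\<close> decides.\<close>
  define N where "N = real n + 2"
  have N: "2 \<le> N" "32 / N < \<kappa>"
    using n \<kappa> by (auto simp: N_def field_simps)
  define v where "v x = bump (x / N)" for x
  define v' where "v' x = bump' (x / N) / N" for x
  have vd: "(v has_real_derivative v' x) (at x)" for x
  proof -
    have "((\<lambda>x. x / N) has_real_derivative 1 / N) (at x)" using N by (auto intro!: derivative_eq_intros)
    from DERIV_chain2[OF bump_deriv this] show ?thesis by (simp add: v_def[abs_def] v'_def)
  qed
  have vc: "continuous_on UNIV v" "continuous_on UNIV v'"
    unfolding v_def v'_def using N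
    by (auto intro!: continuous_intros continuous_on_compose2[OF continuous_bump(1)[of UNIV]]
        continuous_on_compose2[OF continuous_bump(2)[of UNIV]])
  have v0: "v x = 0" "v' x = 0" if "\<bar>x\<bar> \<ge> N" for x
    using that N bump_props(4,5)[of "x / N"] by (auto simp: v_def v'_def field_simps)
  define U where "U x = v x / sqrt (?J x)" for x
  define U' where "U' x = (v' x - v x * ?J' x / (2 * ?J x)) / sqrt (?J x)" for x
  have sq: "0 < sqrt (?J x)" "sqrt (?J x) \<noteq> 0" "(sqrt (?J x))\<^sup>2 = ?J x" for x
    using J_pos[of t x] by auto
  have Ud: "(U has_real_derivative U' x) (at x)" for x
  proof -
    have "((\<lambda>x. sqrt (?J x)) has_real_derivative ?J' x * (inverse (sqrt (?J x)) / 2)) (at x)"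
      using J_pos[of t x] by (auto intro!: derivative_eq_intros J_deriv(1) DERIV_chain2[OF DERIV_real_sqrt])
    from DERIV_divide[OF vd this sq(2)] show ?thesis
      unfolding U_def[abs_def]
    proof (rule DERIV_cong)
      show "(v' x * sqrt (?J x) - v x * (?J' x * (inverse (sqrt (?J x)) / 2))) / (sqrt (?J x) * sqrt (?J x)) = U' x"
        using sq[of x] J_pos[of t x] by (simp add: U'_def field_simps)
    qed
  qed
  have U'c: "continuous_on UNIV U'"
    unfolding U'_def by (intro continuous_intros vc continuous_c ballI) (use J_nonzero sq in auto)
  define A where "A p = (bump (snd p))\<^sup>2 * ((v' (fst p))\<^sup>2 - 6 * \<delta> * (v (fst p))\<^sup>2 / (?J (fst p))\<^sup>2)" for p :: "real \<times> real"
  \<comment> \<open>The cross term \<open>v * v' * J' / J\<close> is part of the derivative of this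
    function; subtracting the whole derivative carries out the integration by parts.\<close>
  define k where "k x = ?J' x * (v x)\<^sup>2 / (2 * ?J x)" for x
  define k' where "k' x = - 4 * ?b * (v x)\<^sup>2 / (2 * ?J x) + ?J' x * v x * v' x / ?J x - (?J' x)\<^sup>2 * (v x)\<^sup>2 / (2 * (?J x)\<^sup>2)" for x
  let ?R = "{-N..N} \<times> {-1..1::real}"
  have R: "compact ?R" by (intro compact_Times compact_Icc)
  have kd: "(k has_real_derivative k' x) (at x)" for x
  proof -
    have "(k has_real_derivative ((- 4 * ?b * (v x)\<^sup>2 + (2 * (v' x * v x)) * ?J' x) * (2 * ?J x) - ?J' x * (v x)\<^sup>2 * (2 * ?J' x))
       / (2 * ?J x * (2 * ?J x))) (at x)"
      unfolding k_def[abs_def] using J_nonzero[of t x]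
      by (auto intro!: derivative_eq_intros J_deriv vd)
    then show ?thesis
      by (rule DERIV_cong) (use J_nonzero[of t x] in \<open>simp add: k'_def field_simps power2_eq_square\<close>)
  qed
  have comp1: "continuous_on UNIV (\<lambda>q::real\<times>real. g (fst q))" "continuous_on UNIV (\<lambda>q::real\<times>real. g (snd q))"
    if "continuous_on UNIV g" for g :: "real \<Rightarrow> real"
    using that by (auto intro!: continuous_intros continuous_on_compose2[OF that])
  have k'c: "continuous_on UNIV k'"
    unfolding k'_def by (intro continuous_intros vc continuous_c ballI) (use J_nonzero in auto)
  have Ac: "continuous_on UNIV A"
    unfolding A_def by (intro continuous_intros comp1 continuous_bump vc continuous_c ballI) (use J_nonzero in auto)
  have kc: "continuous_on UNIV (\<lambda>p::real\<times>real. (bump (snd p))\<^sup>2 * k' (fst p))"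
    by (intro continuous_intros comp1 continuous_bump k'c)
  have out: "bump (snd p) = 0 \<or> v (fst p) = 0 \<and> v' (fst p) = 0" if "p \<notin> ?R" for p
    using that v0[of "fst p"] bump_props(4)[of "snd p"] by (cases p) force
  have intA: "integrable lborel A"
  proof (rule integrable_continuous_compact_support[OF Ac R])
    show "A p = 0" if "p \<notin> ?R" for p using out[OF that] by (auto simp: A_def)
  qed
  have intk: "integrable lborel (\<lambda>p. (bump (snd p))\<^sup>2 * k' (fst p))"
  proof (rule integrable_continuous_compact_support[OF kc R])
    show "(bump (snd p))\<^sup>2 * k' (fst p) = 0" if "p \<notin> ?R" for p using out[OF that] by (auto simp: k'_def)
  qed
  have k0: "(\<integral>p. (bump (snd p))\<^sup>2 * k' (fst p) \<partial>lborel) = 0"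
  proof (rule integral_deriv_fst(1)[OF _ kc R, where k = "\<lambda>p. (bump (snd p))\<^sup>2 * k (fst p)"])
    show "((\<lambda>x. (bump (snd (x, y)))\<^sup>2 * k (fst (x, y))) has_real_derivative (bump (snd (x, y)))\<^sup>2 * k' (fst (x, y))) (at x)" for x y
      using DERIV_cmult[OF kd] by simp
    show "(bump (snd p))\<^sup>2 * k (fst p) = 0" if "p \<notin> ?R" for p
      using out[OF that] by (auto simp: k_def)
  qed
  have "0 \<le> (\<integral>p. (bump (snd p))\<^sup>2 * ((U' (fst p) + ?J' (fst p) / ?J (fst p) * U (fst p))\<^sup>2 * ?J (fst p)
    + 4 * ?b * (U (fst p))\<^sup>2) \<partial>lborel)"
    by (rule stability_blowup[OF Ud U'c, where N = N]) (use v0 N in \<open>auto simp: U_def U'_def\<close>)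
  also have "\<dots> = (\<integral>p. A p + (bump (snd p))\<^sup>2 * k' (fst p) \<partial>lborel)"
  proof (rule Bochner_Integration.integral_cong[OF refl])
    fix p :: "real \<times> real"
    define x where "x = fst p"
    define j where "j = ?J x"
    define j' where "j' = ?J' x"
    have j: "j > 0" "j \<noteq> 0" using J_pos[of t x] by (auto simp: j_def)
    \<comment> \<open>The discriminant of a quadratic polynomial equals
      \<open>J'^2 - 2 * J * J''\<close> at every point, so \<open>\<delta>\<close> can be expressed
      through the values of \<open>J\<close> and \<open>J'\<close> at the current
      \<open>x\<close>.\<close>
    have disc: "4 * \<delta> * 6 = - 24 * ?b * j - 3 * j'\<^sup>2"
      by (simp add: \<delta>_def j_def j'_def J_def J'_def power2_eq_square algebra_simps)
    have "U' x + j' / j * U x = (v' x + v x * j' / (2 * j)) / sqrt j"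
      using j by (simp add: U'_def U_def j_def[symmetric] j'_def[symmetric] field_simps)
    then have "(U' x + j' / j * U x)\<^sup>2 * j = (v' x + v x * j' / (2 * j))\<^sup>2"
      using j by (simp add: power_divide)
    moreover have "(U x)\<^sup>2 = (v x)\<^sup>2 / j" using j by (simp add: U_def j_def[symmetric] power_divide)
    moreover have "(v' x + v x * j' / (2 * j))\<^sup>2 + 4 * ?b * ((v x)\<^sup>2 / j) =
       ((v' x)\<^sup>2 - 6 * \<delta> * (v x)\<^sup>2 / j\<^sup>2) + (- 4 * ?b * (v x)\<^sup>2 / (2 * j) + j' * v x * v' x / j - j'\<^sup>2 * (v x)\<^sup>2 / (2 * j\<^sup>2))"
    proof -
      have "\<delta> = - ?b * j - j'\<^sup>2 / 8" using disc by simp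
      then show ?thesis using j by (simp only:) (simp add: field_simps power2_eq_square)
    qed
    ultimately show "(bump (snd p))\<^sup>2 * ((U' (fst p) + ?J' (fst p) / ?J (fst p) * U (fst p))\<^sup>2 * ?J (fst p)
      + 4 * ?b * (U (fst p))\<^sup>2) = A p + (bump (snd p))\<^sup>2 * k' (fst p)"
      unfolding A_def k'_def x_def[symmetric] j_def[symmetric] j'_def[symmetric] by (simp only: distrib_left[symmetric])
  qed
  also have "\<dots> = integral\<^sup>L lborel A" using intA intk k0 by simp
  also have "\<dots> \<le> (\<integral>p. 16 / N\<^sup>2 * indicator ?R p - \<kappa> * indicator ({-1..1::real} \<times> {-1/2..1/2}) p \<partial>lborel)"
  proof (rule integral_mono[OF intA])
    show "integrable lborel (\<lambda>p. 16 / N\<^sup>2 * indicator ?R p - \<kappa> * indicator ({-1..1::real} \<times> {-1/2..1/2::real}) p)"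
      by (intro Bochner_Integration.integrable_diff integrable_const_on_compact compact_Times compact_Icc)
    fix p :: "real \<times> real"
    obtain x s where p: "p = (x, s)" by (cases p)
    have "(bump s)\<^sup>2 * (v' x)\<^sup>2 \<le> 16 / N\<^sup>2 * indicator ?R p"
    proof (cases "p \<in> ?R")
      case False
      then show ?thesis using out[OF False] by (auto simp: p)
    next
      case True
      have "\<bar>x / N\<bar> \<le> 1" using True N by (auto simp: p field_simps)
      then have "\<bar>x / N\<bar> * max 0 (1 - (x / N)\<^sup>2) \<le> 1 * 1" by (intro mult_mono) auto
      then have "\<bar>bump' (x / N)\<bar> \<le> 4" by (simp add: bump'_def abs_mult)
      then have "(bump' (x / N))\<^sup>2 \<le> 4\<^sup>2" using power_mono[of "\<bar>bump' (x / N)\<bar>" 4 2] by simp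
      then have "(v' x)\<^sup>2 \<le> 16 / N\<^sup>2" using N by (simp add: v'_def power_divide divide_right_mono)
      moreover have "(bump s)\<^sup>2 \<le> 1" using bump_props(1,2)[of s] by (simp add: power_le_one_iff)
      ultimately have "(bump s)\<^sup>2 * (v' x)\<^sup>2 \<le> 1 * (16 / N\<^sup>2)" by (intro mult_mono) auto
      then show ?thesis using True by simp
    qed
    moreover have "\<kappa> * indicator ({-1..1::real} \<times> {-1/2..1/2}) p \<le> (bump s)\<^sup>2 * (6 * \<delta> * (v x)\<^sup>2 / (?J x)\<^sup>2)"
    proof (cases "p \<in> {-1..1} \<times> {-1/2..1/2}")
      case False
      then show ?thesis using \<delta> by simp
    next
      case True
      have bl: "(9/16)\<^sup>2 \<le> (bump y)\<^sup>2" if "\<bar>y\<bar> \<le> 1/2" for y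
      proof -
        have y: "y\<^sup>2 \<le> 1/4" using power_mono[OF that abs_ge_zero, of 2] by (simp add: power2_eq_square)
        then have "(3/4)\<^sup>2 \<le> (1 - y\<^sup>2)\<^sup>2" by (intro power_mono) auto
        then have "9/16 \<le> bump y" using y by (simp add: bump_def pos_sq_def power2_eq_square)
        then show ?thesis by (intro power_mono) auto
      qed
      have "\<bar>x / N\<bar> \<le> 1/2" using True N by (auto simp: p field_simps)
      then have vl: "(9/16)\<^sup>2 \<le> (v x)\<^sup>2" unfolding v_def by (rule bl)
      have sl: "(9/16)\<^sup>2 \<le> (bump s)\<^sup>2" using True by (intro bl) (auto simp: p)
      have "\<bar>?J x\<bar> \<le> BJ" using True by (intro BJ(2)) (auto simp: p)
      then have "(?J x)\<^sup>2 \<le> BJ\<^sup>2" using power_mono[of "\<bar>?J x\<bar>" BJ 2] by simp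
      moreover have "0 < (?J x)\<^sup>2" using J_nonzero[of t x] by simp
      ultimately have "(9/16)\<^sup>2 * (9/16)\<^sup>2 / BJ\<^sup>2 \<le> (bump s)\<^sup>2 * (v x)\<^sup>2 / (?J x)\<^sup>2"
        using vl sl by (intro frac_le mult_mono) auto
      then have "6 * \<delta> * ((9/16)\<^sup>2 * (9/16)\<^sup>2 / BJ\<^sup>2) \<le> 6 * \<delta> * ((bump s)\<^sup>2 * (v x)\<^sup>2 / (?J x)\<^sup>2)"
        using \<delta> by (intro mult_left_mono) auto
      then show ?thesis using True by (simp add: \<kappa>_def mult_ac)
    qed
    ultimately show "A p \<le> 16 / N\<^sup>2 * indicator ?R p - \<kappa> * indicator ({-1..1::real} \<times> {-1/2..1/2}) p"
      unfolding A_def p fst_conv snd_conv right_diff_distrib by linarith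
  qed
  also have "\<dots> = (\<integral>p. 16 / N\<^sup>2 * indicator ?R p \<partial>lborel) - (\<integral>p. \<kappa> * indicator ({-1..1::real} \<times> {-1/2..1/2::real}) p \<partial>lborel)"
    by (intro Bochner_Integration.integral_diff integrable_const_on_compact compact_Times compact_Icc)
  also have "(\<integral>p. 16 / N\<^sup>2 * indicator ?R p \<partial>lborel) = 16 / N\<^sup>2 * ((N - - N) * (1 - - 1))"
    by (rule integral_indicator_rectangle) (use N in auto)
  also have "(\<integral>p. \<kappa> * indicator ({-1..1::real} \<times> {-1/2..1/2::real}) p \<partial>lborel) = \<kappa> * ((1 - - 1) * (1/2 - - 1/2))"
    by (rule integral_indicator_rectangle) auto
  also have "16 / N\<^sup>2 * ((N - - N) * (1 - - 1)) - \<kappa> * ((1 - - 1) * (1/2 - - 1/2)) = 2 * (32 / N - \<kappa>)"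
    using N by (simp add: field_simps power2_eq_square)
  also have "\<dots> < 0" using N by simp
  finally show False by simp
qed

lemma f2_axis: "f2 (0, t) = 0"
proof (rule ccontr)
  assume nz: "f2 (0, t) \<noteq> 0"
  have "J t (1 / (4 * f2 (0, t))) = 0"
    using nz w2_axis[of t] by (simp add: J_def a'_def b'_def)
  then show False using J_nonzero by blast
qed

lemma affine: "f (x, y) = f (0, 0) + w (0, 0) * x"
proof -
  have f0: "f (0, s) = f (0, 0)" for s
    using DERIV_isconst_all[of "\<lambda>s. f (0, s)" s 0] has_partials_snd[OF f(1), of 0] by (simp add: f2_axis)
  have w0: "w (0, s) = w (0, 0)" for s
    using DERIV_isconst_all[of "\<lambda>s. w (0, s)" s 0] has_partials_snd[OF w(1), of 0] by (simp add: w2_axis)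
  \<comment> \<open>The starting height of the characteristic through \<open>(x, y)\<close>,
    explicit because all characteristics share the same coefficients.\<close>
  define s where "s = y + 4 * f (0, 0) * x + 2 * w (0, 0) * x\<^sup>2"
  have "s - 4 * f (0, s) * x - 2 * w (0, s) * x\<^sup>2 = y"
    unfolding f0[of s] w0[of s] by (simp add: s_def)
  then have "f (x, y) = f (0, s) + w (0, s) * x"
    using along_characteristic(1)[of x s] by simp
  then show ?thesis unfolding f0[of s] w0[of s] .
qed

end

theorem theorem5p3:
  fixes \<phi> :: "real \<times> real \<Rightarrow> real"
    and S E :: "heis set"
  assumes "C2_map \<phi>"
    and "S = X1_graph \<phi>"
    and "E = X1_subgraph \<phi>"
    and "H_perimeter_minimizer E"
  shows "vertical_plane S \<and> (\<exists>w c :: real. \<forall>\<eta> \<tau>. \<phi> (\<eta>, \<tau>) = w * \<eta> + c)"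
proof -
  obtain f1 f2 where f: "has_partials \<phi> f1 f2" "C1_map f1" "C1_map f2"
    using C2_map_partials[OF assms(1)] .
  have fC: "C1_map \<phi>" by (rule has_partials_C1_map[OF f(1)]) (intro C1_map_continuous f)+
  define w where "w q = f1 q - 4 * \<phi> q * f2 q" for q
  have "C1_map w" unfolding w_def by (intro C1_map_intros f fC)
  then obtain w1 w2 where w: "has_partials w w1 w2" "continuous_on UNIV w1" "continuous_on UNIV w2"
    by (rule C1_map_partials)
  interpret minimizing_graph \<phi> f1 f2 w w1 w2
    by standard (use f w assms(3,4) in \<open>auto simp: w_def\<close>)
  define c where "c = \<phi> (0, 0)"
  define m where "m = w (0, 0)"
  have aff: "\<phi> (x, y) = m * x + c" for x y
    using affine[of x y] by (simp add: c_def m_def)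
  have "S = {(x, y, t). 1 * x + (- m) * y = c}"
  proof (intro set_eqI iffI)
    fix p :: heis assume "p \<in> S"
    then show "p \<in> {(x, y, t). 1 * x + (- m) * y = c}"
      unfolding assms(2) X1_graph_def by (auto simp: aff)
  next
    fix p :: heis assume "p \<in> {(x, y, t). 1 * x + (- m) * y = c}"
    \<comment> \<open>The parameter of a point of the plane is its projection along
      \<open>X1\<close>, which subtracts \<open>2 * y * x\<close> with \<open>x = m * y + c\<close>
      from the last coordinate.\<close>
    then obtain y t where p: "p = (m * y + c, y, t)" by (cases p) (auto simp: algebra_simps)
    then have "p = (0, y, t - 2 * y * (m * y + c)) \<cdot>\<^sub>H (\<phi> (y, t - 2 * y * (m * y + c)), 0, 0)"
      by (simp add: aff algebra_simps)
    then show "p \<in> S" unfolding assms(2) X1_graph_def by blast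
  qed
  then have "vertical_plane S" unfolding vertical_plane_def by (intro exI[of _ 1] exI[of _ "- m"] exI[of _ c]) simp
  then show ?thesis using aff by blast
qed

end
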